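(* Let $\mu\in\mathbb{C}$ with $|\mu|>1$, let $p\ge2$ be an integer, let $\varphi\in \mathrm{Diff}^{\infty}([0,\infty))$ satisfy $\varphi(x)>x$ for all $x>0$ and be tangent to the identity to infinite order at $0$, and let $(R,\mathcal{F},J)$ be the $5$-dimensional LC Reeb component $R=\tilde R/T^{\mathbb{Z}}$ with $T(z_1,z_2,x)=(\mu^p z_1+z_2^p,\mu z_2,\varphi(x))$ (i.e. $\tau=1$, $\lambda=\mu^p$), with boundary Hopf surface $H$. Then the group $\mathrm{Aut}(R,H)$ admits the following sequence of extension $$0\to\mathcal{S}_{\varphi,\mu}(\mathbf{c})\to\mathrm{Aut}(R,H)\to Z_\varphi\to1,$$ where $\mathbf{c}=(c_0,\dots,c_{p-1})\in\mathbb{C}^p$ with $c_j=\binom{p}{j}\mu^{-j}$, and $\mathcal{S}_{\varphi,\mu}(\mathbf{c})$ is an infinite dimensional vector space which is the set of tuples of functions $(\beta_{1,0},\dots,\beta_{1,p-1},\beta_2)$ satisfying $$\beta_{1,j}(\varphi(x))=\mu^{p-j}\beta_{1,j}(x)+c_j\,\beta_2(x)^{p-j}\quad(j=0,1,\dots,p-1),\qquad \beta_2(\varphi(x))=\mu\beta_2(x).$$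
   Context: Setting. $\tilde R=(\mathbb{C}^2\times[0,\infty))\setminus\{(O,0)\}$ carries the foliation $\tilde{\mathcal F}$ with leaves $\mathbb{C}^2\times\{x\}$ ($x>0$) and $\tilde H=(\mathbb{C}^2\setminus\{O\})\times\{0\}$, with the standard complex structure on leaves. With $G(z_1,z_2)=(\mu^p z_1+z_2^p,\mu z_2)$ (the case $\tau=1$, $\lambda=\mu^p$ of the general normal form $G(z_1,z_2)=(\lambda z_1+\tau z_2^p,\mu z_2)$ of primary Hopf surfaces), put $T=G\times\varphi$. The quotient $R=\tilde R/T^{\mathbb{Z}}$ with the induced foliation $\mathcal F$ and leafwise complex structure $J$ is called an LC Reeb component; its boundary leaf $H=(\mathbb{C}^2\setminus\{O\})/G^{\mathbb{Z}}$ is a primary Hopf surface. A leafwise holomorphic smooth automorphism is a smooth diffeomorphism preserving the foliation and mapping leaves biholomorphically to leaves; $\mathrm{Aut}\,R$ is the group of these for $(R,\mathcal F,J)$, and $\mathrm{Aut}(R,H)$ is the kernel of the restriction map $\mathrm{Aut}\,R\to\mathrm{Aut}\,H$, where $\mathrm{Aut}\,H$ is the group of holomorphic automorphisms of $H$. Each $f\in\mathrm{Aut}(R,H)$ has a unique lift to a leafwise holomorphic smooth automorphism of $\tilde R$ commuting with $T$ and equal to the identity on $\tilde H$; this lift has the form $(\xi_1(z_1,z_2,x),\xi_2(z_1,z_2,x),\eta(x))$, and the map $\mathrm{Aut}(R,H)\to Z_\varphi$ sends $f$ to $\eta$. Here $Z_\varphi$ is the centralizer of $\varphi$ in $\mathrm{Diff}^\infty([0,\infty))$.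 $\mathcal{S}_{\varphi,\mu}(\mathbf{c})$ is the space of solutions on $(0,\infty)$, by smooth $\mathbb{C}$-valued functions, of the displayed system; every solution extends to smooth functions on $[0,\infty)$ that are flat at $0$. A tuple $(\beta_{1,0},\dots,\beta_{1,p-1},\beta_2)$ in it corresponds to the element of $\mathrm{Aut}(R,H)$ whose lift is $(z_1,z_2,x)\mapsto\left(z_1+\sum_{j=0}^{p-1}\beta_{1,j}(x)z_2^j,\ z_2+\beta_2(x),\ x\right)$.
   Formalization: The solution set is not closed under pointwise sums and the kernel is not abelian; so S has composition as group law, and "infinite dimensional vector space" means some such structure exists on S, equal to composition on commuting elements and pointwise in β_2, β_{1,p-1}. *)

theory Defs
  imports
    "HOL-Analysis.Analysis"
    "HOL-Algebra.Bij"
    "Jordan_Normal_Form.Missing_VectorSpace"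
begin

section \<open>Smooth and holomorphic maps\<close>

text \<open>Intended for open \<open>S\<close>: \<open>f\<close> is of class \<open>C\<^sup>k\<close> on \<open>S\<close>, formulated by iterated directional
  derivatives so that the codomain does not change.\<close>

primrec Ck_on :: "nat \<Rightarrow> 'a::euclidean_space set \<Rightarrow> ('a \<Rightarrow> 'b::real_normed_vector) \<Rightarrow> bool" where
  "Ck_on 0 = (\<lambda>S f. continuous_on S f)"
| "Ck_on (Suc k) = (\<lambda>S f. (\<forall>x\<in>S. f differentiable (at x)) \<and>
      (\<forall>v. Ck_on k S (\<lambda>x. frechet_derivative f (at x) v)))"

text \<open>Smoothness on an arbitrary set: local extendability to smooth maps on open sets of the
  ambient Euclidean space. On \<open>[0,\<infinity>)\<close> and on \<open>\<complex>\<^sup>2 \<times> [0,\<infinity>)\<close> this is smoothness up to the boundary.\<close>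

definition smooth_on :: "'a::euclidean_space set \<Rightarrow> ('a \<Rightarrow> 'b::real_normed_vector) \<Rightarrow> bool" where
  "smooth_on S f \<longleftrightarrow> (\<forall>x\<in>S. \<exists>U g. open U \<and> x \<in> U \<and> (\<forall>k. Ck_on k U g) \<and> (\<forall>y\<in>U \<inter> S. g y = f y))"

text \<open>Holomorphic maps on an open subset of \<open>\<complex>\<^sup>2\<close>: the real derivative exists and is
  complex linear.\<close>

definition holomorphic2_on :: "(complex \<times> complex \<Rightarrow> complex \<times> complex) \<Rightarrow> (complex \<times> complex) set \<Rightarrow> bool" where
  "holomorphic2_on h W \<longleftrightarrow> (\<forall>w\<in>W. \<exists>D. (h has_derivative D) (at w) \<and>
      (\<forall>a v1 v2. D (a * v1, a * v2) = (a * fst (D (v1, v2)), a * snd (D (v1, v2)))))"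

section \<open>Diffeomorphisms of the closed half line\<close>

definition Diff_half :: "(real \<Rightarrow> real) monoid" where
  "Diff_half = BijGroup {0..}\<lparr>carrier :=
     {f \<in> Bij {0..}. smooth_on {0..} f \<and> smooth_on {0..} (inv_into {0..} f)}\<rparr>"

definition Diff_centralizer :: "(real \<Rightarrow> real) \<Rightarrow> (real \<Rightarrow> real) monoid" where
  "Diff_centralizer \<phi> = Diff_half\<lparr>carrier :=
     {\<eta> \<in> carrier Diff_half. \<eta> \<otimes>\<^bsub>Diff_half\<^esub> \<phi> = \<phi> \<otimes>\<^bsub>Diff_half\<^esub> \<eta>}\<rparr>"

text \<open>All one-sided derivatives at \<open>0\<close> of \<open>\<phi> - id\<close>, including that of order \<open>0\<close>, vanish.\<close>

definition tangent_to_id_infinite_order :: "(real \<Rightarrow> real) \<Rightarrow> bool" where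
  "tangent_to_id_infinite_order \<phi> \<longleftrightarrow>
     (\<forall>k. ((\<lambda>g x. vector_derivative g (at x within {0..})) ^^ k) (\<lambda>x. \<phi> x - x) 0 = 0)"

section \<open>The Reeb component\<close>

type_synonym point = "complex \<times> complex \<times> real"

definition Rtilde :: "point set" where
  "Rtilde = {(z1, z2, x). 0 \<le> x} - {(0, 0, 0)}"

text \<open>The leaves of the foliation of \<open>Rtilde\<close>; for \<open>x = 0\<close> the origin is missing. \<open>leaf_plane x\<close> is
  the same leaf as an open subset of \<open>\<complex>\<^sup>2\<close>.\<close>

definition leaf_tilde :: "real \<Rightarrow> point set" where
  "leaf_tilde x = {q \<in> Rtilde. snd (snd q) = x}"

definition at_level :: "real \<Rightarrow> complex \<times> complex \<Rightarrow> point" where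
  "at_level x w = (fst w, snd w, x)"

definition planar :: "point \<Rightarrow> complex \<times> complex" where
  "planar q = (fst q, fst (snd q))"

definition leaf_plane :: "real \<Rightarrow> (complex \<times> complex) set" where
  "leaf_plane x = {w. at_level x w \<in> Rtilde}"

fun reeb_T :: "complex \<Rightarrow> nat \<Rightarrow> (real \<Rightarrow> real) \<Rightarrow> point \<Rightarrow> point" where
  "reeb_T \<mu> p \<phi> (z1, z2, x) = (\<mu> ^ p * z1 + z2 ^ p, \<mu> * z2, \<phi> x)"

text \<open>In the following \<open>T\<close> is a bijection of \<open>Rtilde\<close> generating a properly discontinuous action.
  Points of the quotient are the orbits of the group generated by \<open>T\<close>.\<close>

definition orbit_rel :: "(point \<Rightarrow> point) \<Rightarrow> (point \<times> point) set" where
  "orbit_rel T = {(q, r). q \<in> Rtilde \<and> r \<in> Rtilde \<and> (\<exists>n. (T ^^ n) q = r \<or> (T ^^ n) r = q)}"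

definition reeb :: "(point \<Rightarrow> point) \<Rightarrow> point set set" where
  "reeb T = Rtilde // orbit_rel T"

definition proj :: "(point \<Rightarrow> point) \<Rightarrow> point \<Rightarrow> point set" where
  "proj T q = orbit_rel T `` {q}"

definition leaf :: "(point \<Rightarrow> point) \<Rightarrow> real \<Rightarrow> point set set" where
  "leaf T x = proj T ` leaf_tilde x"

abbreviation boundary_leaf :: "(point \<Rightarrow> point) \<Rightarrow> point set set" where
  "boundary_leaf T \<equiv> leaf T 0"

text \<open>The projection is a local diffeomorphism, and biholomorphic locally along leaves. Hence a
  self-map of the quotient is smooth (holomorphic from one leaf to another) iff it is locally
  covered by smooth (holomorphic) maps.\<close>

definition reeb_smooth :: "(point \<Rightarrow> point) \<Rightarrow> (point set \<Rightarrow> point set) \<Rightarrow> bool" where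
  "reeb_smooth T f \<longleftrightarrow> (\<forall>q\<in>Rtilde. \<exists>U F. open U \<and> q \<in> U \<and> smooth_on (U \<inter> Rtilde) F \<and>
      F ` (U \<inter> Rtilde) \<subseteq> Rtilde \<and> (\<forall>r\<in>U \<inter> Rtilde. f (proj T r) = proj T (F r)))"

definition leaf_holomorphic :: "(point \<Rightarrow> point) \<Rightarrow> real \<Rightarrow> real \<Rightarrow> (point set \<Rightarrow> point set) \<Rightarrow> bool" where
  "leaf_holomorphic T x y f \<longleftrightarrow> (\<forall>w\<in>leaf_plane x. \<exists>W h. open W \<and> w \<in> W \<and> W \<subseteq> leaf_plane x \<and>
      holomorphic2_on h W \<and> h ` W \<subseteq> leaf_plane y \<and>
      (\<forall>v\<in>W. f (proj T (at_level x v)) = proj T (at_level y (h v))))"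

definition Aut_reeb :: "(point \<Rightarrow> point) \<Rightarrow> (point set \<Rightarrow> point set) monoid" where
  "Aut_reeb T = BijGroup (reeb T)\<lparr>carrier :=
     {f \<in> Bij (reeb T). reeb_smooth T f \<and> reeb_smooth T (inv_into (reeb T) f) \<and>
        (\<forall>x\<ge>0. \<exists>y\<ge>0. f ` leaf T x = leaf T y \<and> leaf_holomorphic T x y f \<and>
           leaf_holomorphic T y x (inv_into (reeb T) f))}\<rparr>"

definition Aut_boundary :: "(point \<Rightarrow> point) \<Rightarrow> (point set \<Rightarrow> point set) monoid" where
  "Aut_boundary T = BijGroup (boundary_leaf T)\<lparr>carrier :=
     {f \<in> Bij (boundary_leaf T). leaf_holomorphic T 0 0 f \<and>
        leaf_holomorphic T 0 0 (inv_into (boundary_leaf T) f)}\<rparr>"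

definition Aut_rel :: "(point \<Rightarrow> point) \<Rightarrow> (point set \<Rightarrow> point set) monoid" where
  "Aut_rel T = Aut_reeb T\<lparr>carrier :=
     kernel (Aut_reeb T) (Aut_boundary T) (\<lambda>f. restrict f (boundary_leaf T))\<rparr>"

section \<open>Lifts and the transverse map\<close>

definition Aut_tilde :: "(point \<Rightarrow> point) set" where
  "Aut_tilde = {F \<in> Bij Rtilde. smooth_on Rtilde F \<and> smooth_on Rtilde (inv_into Rtilde F) \<and>
     (\<forall>x\<ge>0. \<exists>y\<ge>0. F ` leaf_tilde x = leaf_tilde y \<and>
        holomorphic2_on (\<lambda>w. planar (F (at_level x w))) (leaf_plane x) \<and>
        holomorphic2_on (\<lambda>w. planar (inv_into Rtilde F (at_level y w))) (leaf_plane y))}"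

definition is_lift :: "(point \<Rightarrow> point) \<Rightarrow> (point set \<Rightarrow> point set) \<Rightarrow> (point \<Rightarrow> point) \<Rightarrow> bool" where
  "is_lift T f F \<longleftrightarrow> F \<in> Aut_tilde \<and> (\<forall>q\<in>Rtilde. proj T (F q) = f (proj T q)) \<and>
     (\<forall>q\<in>Rtilde. F (T q) = T (F q)) \<and> (\<forall>q\<in>leaf_tilde 0. F q = q)"

text \<open>The map \<open>\<eta>\<close> on \<open>[0,\<infinity>)\<close> with \<open>F (z1, z2, x) = (_, _, \<eta> x)\<close> for the lift \<open>F\<close> of \<open>f\<close>.\<close>

definition transverse :: "(point \<Rightarrow> point) \<Rightarrow> (point set \<Rightarrow> point set) \<Rightarrow> real \<Rightarrow> real" where
  "transverse T f = (THE \<eta>. \<eta> \<in> extensional {0..} \<and>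
     (\<exists>F. is_lift T f F \<and> (\<forall>(z1, z2, x)\<in>Rtilde. snd (snd (F (z1, z2, x))) = \<eta> x)))"

section \<open>The solution space\<close>

text \<open>A tuple is a pair of \<open>(\<lambda>j. \<beta>\<^bsub>1,j\<^esub>)\<close> and \<open>\<beta>\<^sub>2\<close>, extensional in \<open>j < p\<close> and in \<open>x > 0\<close>.\<close>

type_synonym tuple = "(nat \<Rightarrow> real \<Rightarrow> complex) \<times> (real \<Rightarrow> complex)"

definition solutions :: "(real \<Rightarrow> real) \<Rightarrow> complex \<Rightarrow> nat \<Rightarrow> (nat \<Rightarrow> complex) \<Rightarrow> tuple set" where
  "solutions \<phi> \<mu> p c = {(\<beta>1, \<beta>2).
     \<beta>1 \<in> {..<p} \<rightarrow>\<^sub>E extensional {0<..} \<and> \<beta>2 \<in> extensional {0<..} \<and>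
     (\<forall>j<p. smooth_on {0<..} (\<beta>1 j)) \<and> smooth_on {0<..} \<beta>2 \<and>
     (\<forall>j<p. \<forall>x>0. \<beta>1 j (\<phi> x) = \<mu> ^ (p - j) * \<beta>1 j x + c j * \<beta>2 x ^ (p - j)) \<and>
     (\<forall>x>0. \<beta>2 (\<phi> x) = \<mu> * \<beta>2 x)}"

text \<open>The automorphism of \<open>Rtilde\<close> belonging to a tuple. Solutions extend flatly, hence by the
  value \<open>0\<close>, to \<open>x = 0\<close>. The induced map on orbits is taking images, as \<open>tuple_lift p \<beta>\<close> commutes
  with \<open>T\<close>.\<close>

fun tuple_lift :: "nat \<Rightarrow> tuple \<Rightarrow> point \<Rightarrow> point" where
  "tuple_lift p (\<beta>1, \<beta>2) (z1, z2, x) =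
     (if x > 0 then (z1 + (\<Sum>j<p. \<beta>1 j x * z2 ^ j), z2 + \<beta>2 x, x) else (z1, z2, x))"

definition tuple_aut :: "(point \<Rightarrow> point) \<Rightarrow> nat \<Rightarrow> tuple \<Rightarrow> point set \<Rightarrow> point set" where
  "tuple_aut T p \<beta> = (\<lambda>P\<in>reeb T. tuple_lift p \<beta> ` P)"

text \<open>The group law is composition: expanding
  \<open>z1 + (\<Sum>j<p. \<gamma>1 j x * z2 ^ j) + (\<Sum>k<p. \<beta>1 k x * (z2 + \<gamma>2 x) ^ k)\<close> in powers of \<open>z2\<close> gives the
  tuple of \<open>tuple_lift p \<beta> \<circ> tuple_lift p \<gamma>\<close>. It is not commutative.\<close>

fun tuple_comp :: "nat \<Rightarrow> tuple \<Rightarrow> tuple \<Rightarrow> tuple" where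
  "tuple_comp p (\<beta>1, \<beta>2) (\<gamma>1, \<gamma>2) =
     ((\<lambda>j\<in>{..<p}. \<lambda>x\<in>{0<..}. \<gamma>1 j x + (\<Sum>k=j..<p. of_nat (k choose j) * \<beta>1 k x * \<gamma>2 x ^ (k - j))),
      (\<lambda>x\<in>{0<..}. \<beta>2 x + \<gamma>2 x))"

definition solution_group :: "(real \<Rightarrow> real) \<Rightarrow> complex \<Rightarrow> nat \<Rightarrow> (nat \<Rightarrow> complex) \<Rightarrow> tuple monoid" where
  "solution_group \<phi> \<mu> p c = \<lparr>carrier = solutions \<phi> \<mu> p c, mult = tuple_comp p,
     one = ((\<lambda>j\<in>{..<p}. \<lambda>x\<in>{0<..}. 0), (\<lambda>x\<in>{0<..}. 0))\<rparr>"

definition complex_field :: "complex ring" where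
  "complex_field = \<lparr>carrier = UNIV, mult = (*), one = 1, zero = 0, add = (+)\<rparr>"

text \<open>The equations for \<open>\<beta>\<^bsub>1,j\<^esub>\<close> with \<open>j < p - 1\<close> are not linear in \<open>\<beta>\<^sub>2\<close>, so the solution set is not
  closed under the pointwise operations. Its vector space structure \<open>V\<close> is required to be
  tied to the tuples and to composition as follows: sums of commuting elements are their
  compositions; the operations are pointwise in the two components \<open>\<beta>\<^sub>2\<close>, \<open>\<beta>\<^bsub>1,p-1\<^esub>\<close> with linear
  equations, and pointwise in all components on the linear subspace \<open>\<beta>\<^sub>2 = 0\<close> (for sums the
  latter is an instance of the first condition). Such a structure is the one of the Lie algebra
  of vector fields \<open>(\<Sum>j<p. Q\<^sub>j(x) z2\<^sup>j) \<partial>\<^sub>1 + \<beta>\<^sub>2(x) \<partial>\<^sub>2\<close> invariant under \<open>T\<close>, transported by the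
  exponential map.\<close>

definition solution_vs_structure ::
  "(real \<Rightarrow> real) \<Rightarrow> complex \<Rightarrow> nat \<Rightarrow> (nat \<Rightarrow> complex) \<Rightarrow> (complex, tuple) module \<Rightarrow> bool" where
  "solution_vs_structure \<phi> \<mu> p c V \<longleftrightarrow>
     carrier V = solutions \<phi> \<mu> p c \<and>
     vectorspace complex_field V \<and>
     (\<forall>\<beta>\<in>carrier V. \<forall>\<gamma>\<in>carrier V. tuple_comp p \<beta> \<gamma> = tuple_comp p \<gamma> \<beta> \<longrightarrow>
        \<beta> \<oplus>\<^bsub>V\<^esub> \<gamma> = tuple_comp p \<beta> \<gamma>) \<and>
     (\<forall>\<beta>\<in>carrier V. \<forall>\<gamma>\<in>carrier V. \<forall>x>0.
        snd (\<beta> \<oplus>\<^bsub>V\<^esub> \<gamma>) x = snd \<beta> x + snd \<gamma> x \<and>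
        fst (\<beta> \<oplus>\<^bsub>V\<^esub> \<gamma>) (p - 1) x = fst \<beta> (p - 1) x + fst \<gamma> (p - 1) x) \<and>
     (\<forall>a. \<forall>\<beta>\<in>carrier V. \<forall>x>0.
        snd (a \<odot>\<^bsub>V\<^esub> \<beta>) x = a * snd \<beta> x \<and>
        fst (a \<odot>\<^bsub>V\<^esub> \<beta>) (p - 1) x = a * fst \<beta> (p - 1) x) \<and>
     (\<forall>a. \<forall>\<beta>\<in>carrier V. (\<forall>x>0. snd \<beta> x = 0) \<longrightarrow>
        (\<forall>j<p. \<forall>x>0. fst (a \<odot>\<^bsub>V\<^esub> \<beta>) j x = a * fst \<beta> j x))"

end

theory Submission
  imports Defs "HOL-Complex_Analysis.Cauchy_Integral_Formula"
begin

text \<open>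
  An element of \<open>Aut(R,H)\<close> lifts to a leafwise holomorphic automorphism \<open>F\<close> of \<open>Rtilde\<close> that commutes
  with \<open>T\<close> and is the identity on the boundary. The set \<open>Rtilde\<close> is star-shaped, \<open>T\<close> acts properly
  discontinuously on it, and the lifts of an automorphism are the sections of a covering of
  \<open>Rtilde\<close>. So lifts exist (\<open>covering_space_pullback\<close>, \<open>equivariant_lift_exists\<close>) and two lifts of one
  map that agree at a point are equal (\<open>lift_unique\<close>). Everything about \<open>Aut(R,H)\<close> is thereby
  translated into statements about equivariant maps. The effect on levels is a diffeomorphism in
  the centralizer of \<open>\<phi>\<close>, and each \<open>\<eta>\<close> in the centralizer is reached by \<open>(z1, z2, x) \<mapsto> (z1, z2, \<eta> x)\<close>.

  A tuple of functions gives a map that commutes with \<open>T\<close> if and only if it solves the system of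
  functional equations (\<open>functional_equations_iff_commute\<close>). That this map is smooth at the boundary
  is a decay statement: along orbits of \<open>\<phi>\<close> a solution is multiplied by numbers of modulus larger
  than \<open>1\<close>, up to terms whose decay is known before, whereas \<open>\<phi>\<close> is tangent to the identity at \<open>0\<close>, so
  that solutions and their derivatives vanish to every order at \<open>0\<close>
  (\<open>jet_order_functional_equation\<close>, \<open>zero_extension_smooth\<close>).

  Conversely, let \<open>F = (xi1, xi2, x)\<close> preserve every leaf. On the leaf of level \<open>x\<close>, suitable large
  circles are taken by a negative power of \<open>T\<close> into a fixed compact set at a level close to \<open>0\<close>,
  where \<open>F\<close> is uniformly close to the identity (\<open>uniformly_close_to_identity\<close>). As \<open>F\<close> commutes with \<open>T\<close>,
  this bounds the growth of \<open>xi1 - z1\<close> and \<open>xi2 - z2\<close> on these circles, and Cauchy's estimates show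
  that \<open>xi2 - z2\<close> is constant on the leaf and \<open>xi1 - z1\<close> is a polynomial in \<open>z2\<close> of degree below \<open>p\<close>
  (\<open>xi2_eq\<close>, \<open>xi1_eq\<close>). So the kernel of the map to the centralizer consists of the tuples.

  For the linear structure, the tuples are time-one maps of vector fields
  \<open>(\<Sum>k<p. q k x * z2 ^ k) \<partial>\<^sub>1 + \<beta>2 x \<partial>\<^sub>2\<close>, and invariance of these fields under \<open>T\<close> is a linear system. The
  exponential map is unipotent and triangular in the coefficients, hence a bijection between the
  two solution sets (\<open>tuple_exp_surj\<close>). It turns sums of commuting fields into compositions
  (\<open>exp_poly_commuting\<close>). Bump functions on a fundamental interval of \<open>\<phi>\<close> give infinitely many linearly
  independent solutions (\<open>not_fin_dim_sol_space\<close>).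
\<close>

section \<open>Calculus of smooth maps\<close>

lemma Ck_on_cong:
  fixes f g :: "'a::euclidean_space \<Rightarrow> 'b::real_normed_vector"
  assumes "open S" "\<And>x. x \<in> S \<Longrightarrow> f x = g x" "Ck_on k S f"
  shows "Ck_on k S g"
  using assms(2,3)
proof (induction k arbitrary: f g)
  case 0
  then show ?case using continuous_on_cong[of S S f g] by simp
next
  case (Suc k)
  have *: "(g has_derivative frechet_derivative f (at x)) (at x)" if "x \<in> S" for x
  proof -
    have "(f has_derivative frechet_derivative f (at x)) (at x)"
      using Suc.prems(2) that frechet_derivative_works by auto
    then show ?thesis
      by (rule has_derivative_transform_within_open[OF _ \<open>open S\<close> that]) (rule Suc.prems(1))
  qed
  then have eq: "frechet_derivative f (at x) = frechet_derivative g (at x)" if "x \<in> S" for x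
    using frechet_derivative_at that by blast
  show ?case
    using * Suc.prems(2) Suc.IH[of "\<lambda>x. frechet_derivative f (at x) v"
        "\<lambda>x. frechet_derivative g (at x) v" for v] eq
    by (auto simp: differentiable_def)
qed

lemma Ck_on_SucI:
  fixes f :: "'a::euclidean_space \<Rightarrow> 'b::real_normed_vector"
  assumes "open S" "\<And>x. x \<in> S \<Longrightarrow> (f has_derivative D x) (at x)"
    and "\<And>v. Ck_on k S (\<lambda>x. D x v)"
  shows "Ck_on (Suc k) S f"
proof -
  have "D x = frechet_derivative f (at x)" if "x \<in> S" for x
    using assms(2) frechet_derivative_at that by blast
  then have "Ck_on k S (\<lambda>x. frechet_derivative f (at x) v)" for v
    using Ck_on_cong[OF assms(1) _ assms(3)[of v]] by simp
  then show ?thesis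
    using assms(2) by (auto simp: differentiable_def)
qed

lemma Ck_on_SucE:
  fixes f :: "'a::euclidean_space \<Rightarrow> 'b::real_normed_vector"
  assumes "Ck_on (Suc k) S f"
  obtains D where "\<And>x. x \<in> S \<Longrightarrow> (f has_derivative D x) (at x)"
    and "\<And>v. Ck_on k S (\<lambda>x. D x v)"
  using assms that[of "\<lambda>x. frechet_derivative f (at x)"] frechet_derivative_works by auto

lemma Ck_on_imp_continuous_on:
  "Ck_on k S f \<Longrightarrow> continuous_on S f"
  by (cases k) (auto intro!: continuous_at_imp_continuous_on differentiable_imp_continuous_within)

lemma Ck_on_Suc_lower: "Ck_on (Suc k) S f \<Longrightarrow> Ck_on k S f"
proof (induction k arbitrary: f)
  case 0
  then show ?case using Ck_on_imp_continuous_on by fastforce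
next
  case (Suc k)
  then show ?case by auto
qed

lemma Ck_on_subset: "Ck_on k S f \<Longrightarrow> T \<subseteq> S \<Longrightarrow> Ck_on k T f"
  by (induction k arbitrary: f) (auto intro: continuous_on_subset)

lemma Ck_on_const: "open S \<Longrightarrow> Ck_on k S (\<lambda>x. c)"
proof (induction k arbitrary: c)
  case (Suc k)
  then show ?case by (intro Ck_on_SucI[where D = "\<lambda>_ _. 0"]) auto
qed simp

lemma Ck_on_bounded_linear:
  fixes f :: "'a::euclidean_space \<Rightarrow> 'b::real_normed_vector"
  assumes "bounded_linear L" "open S" "Ck_on k S f"
  shows "Ck_on k S (\<lambda>x. L (f x))"
  using assms(3)
proof (induction k arbitrary: f)
  case 0
  then show ?case using bounded_linear.continuous_on[OF assms(1)] by simp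
next
  case (Suc k)
  from Suc.prems obtain D where D: "\<And>x. x \<in> S \<Longrightarrow> (f has_derivative D x) (at x)"
    "\<And>v. Ck_on k S (\<lambda>x. D x v)"
    by (rule Ck_on_SucE) blast
  show ?case
  proof (rule Ck_on_SucI[where D = "\<lambda>x v. L (D x v)"])
    show "((\<lambda>x. L (f x)) has_derivative (\<lambda>v. L (D x v))) (at x)" if "x \<in> S" for x
      by (rule bounded_linear.has_derivative[OF assms(1) D(1)[OF that]])
  qed (use D assms Suc.IH in auto)
qed

lemma Ck_on_id: "open S \<Longrightarrow> Ck_on k S (\<lambda>x. x)"
  by (cases k) (auto intro!: Ck_on_SucI[where D = "\<lambda>_ v. v"] Ck_on_const)

lemma Ck_on_add:
  fixes f :: "'a::euclidean_space \<Rightarrow> 'b::real_normed_vector"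
  assumes "open S" "Ck_on k S f" "Ck_on k S g"
  shows "Ck_on k S (\<lambda>x. f x + g x)"
  using assms(2,3)
proof (induction k arbitrary: f g)
  case (Suc k)
  obtain D where D: "\<And>x. x \<in> S \<Longrightarrow> (f has_derivative D x) (at x)"
    "\<And>v. Ck_on k S (\<lambda>x. D x v)" using Suc.prems(1) by (rule Ck_on_SucE) blast
  obtain E where E: "\<And>x. x \<in> S \<Longrightarrow> (g has_derivative E x) (at x)"
    "\<And>v. Ck_on k S (\<lambda>x. E x v)" using Suc.prems(2) by (rule Ck_on_SucE) blast
  show ?case
    by (rule Ck_on_SucI[where D = "\<lambda>x v. D x v + E x v"])
      (use D E assms(1) Suc.IH has_derivative_add in auto)
qed (auto intro: continuous_intros)

lemma Ck_on_sum:
  fixes f :: "'i \<Rightarrow> 'a::euclidean_space \<Rightarrow> 'b::real_normed_vector"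
  assumes "open S" "\<And>i. i \<in> I \<Longrightarrow> Ck_on k S (f i)"
  shows "Ck_on k S (\<lambda>x. \<Sum>i\<in>I. f i x)"
  using assms(2)
  by (induction I rule: infinite_finite_induct) (auto intro: Ck_on_add Ck_on_const assms(1))

lemma Ck_on_bounded_bilinear:
  fixes f :: "'a::euclidean_space \<Rightarrow> 'b::real_normed_vector"
    and g :: "'a \<Rightarrow> 'c::real_normed_vector"
  assumes "bounded_bilinear pr" "open S" "Ck_on k S f" "Ck_on k S g"
  shows "Ck_on k S (\<lambda>x. pr (f x) (g x))"
  using assms(3,4)
proof (induction k arbitrary: f g)
  case 0
  then show ?case using bounded_bilinear.continuous_on[OF assms(1)] by simp
next
  case (Suc k)
  obtain D where D: "\<And>x. x \<in> S \<Longrightarrow> (f has_derivative D x) (at x)"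
    "\<And>v. Ck_on k S (\<lambda>x. D x v)" using Suc.prems(1) by (rule Ck_on_SucE) blast
  obtain E where E: "\<And>x. x \<in> S \<Longrightarrow> (g has_derivative E x) (at x)"
    "\<And>v. Ck_on k S (\<lambda>x. E x v)" using Suc.prems(2) by (rule Ck_on_SucE) blast
  have low: "Ck_on k S f" "Ck_on k S g"
    using Suc.prems Ck_on_Suc_lower by blast+
  show ?case
  proof (rule Ck_on_SucI[where D = "\<lambda>x v. pr (f x) (E x v) + pr (D x v) (g x)"])
    show "((\<lambda>x. pr (f x) (g x)) has_derivative (\<lambda>v. pr (f x) (E x v) + pr (D x v) (g x))) (at x)"
      if "x \<in> S" for x
      using bounded_bilinear.FDERIV[OF assms(1) D(1) E(1)] that by blast
    show "Ck_on k S (\<lambda>x. pr (f x) (E x v) + pr (D x v) (g x))" for v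
      by (intro Ck_on_add assms(2) Suc.IH low D(2) E(2))
  qed (rule assms(2))
qed

text \<open>The chain rule expands the derivative of the outer map over the standard basis, so that
  only directional derivatives in fixed directions occur and the induction hypothesis applies.\<close>

lemma Ck_on_compose:
  fixes g :: "'a::euclidean_space \<Rightarrow> 'b::euclidean_space" and f :: "'b \<Rightarrow> 'c::real_normed_vector"
  assumes "open U" "open V" "g ` U \<subseteq> V" "Ck_on k U g" "Ck_on k V f"
  shows "Ck_on k U (\<lambda>x. f (g x))"
  using assms(4,5)
proof (induction k arbitrary: f)
  case 0
  then show ?case using assms(3) continuous_on_compose2 by auto
next
  case (Suc k)
  obtain D where D: "\<And>x. x \<in> U \<Longrightarrow> (g has_derivative D x) (at x)"
    "\<And>v. Ck_on k U (\<lambda>x. D x v)" using Suc.prems(1) by (rule Ck_on_SucE) blast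
  obtain E where E: "\<And>x. x \<in> V \<Longrightarrow> (f has_derivative E x) (at x)"
    "\<And>v. Ck_on k V (\<lambda>x. E x v)" using Suc.prems(2) by (rule Ck_on_SucE) blast
  have low: "Ck_on k U g"
    using Suc.prems Ck_on_Suc_lower by blast
  show ?case
  proof (rule Ck_on_SucI[where D = "\<lambda>x v. \<Sum>b\<in>Basis. (D x v \<bullet> b) *\<^sub>R E (g x) b"])
    fix x assume x: "x \<in> U"
    with assms(3) have gx: "g x \<in> V" by auto
    have chain: "((\<lambda>x. f (g x)) has_derivative (\<lambda>v. E (g x) (D x v))) (at x)"
      using diff_chain_at[OF D(1)[OF x] E(1)[OF gx]] by (simp add: o_def)
    have expand: "E (g x) w = (\<Sum>b\<in>Basis. (w \<bullet> b) *\<^sub>R E (g x) b)" for w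
    proof -
      have lin: "linear (E (g x))"
        using E(1)[OF gx] has_derivative_linear by blast
      have "E (g x) w = E (g x) (\<Sum>b\<in>Basis. (w \<bullet> b) *\<^sub>R b)"
        by (simp add: euclidean_representation)
      also have "\<dots> = (\<Sum>b\<in>Basis. (w \<bullet> b) *\<^sub>R E (g x) b)"
        using lin by (simp add: linear_sum linear_scale o_def)
      finally show ?thesis .
    qed
    have "(\<lambda>v. E (g x) (D x v)) = (\<lambda>v. \<Sum>b\<in>Basis. (D x v \<bullet> b) *\<^sub>R E (g x) b)"
      using expand by (intro ext)
    with chain show "((\<lambda>x. f (g x)) has_derivative (\<lambda>v. \<Sum>b\<in>Basis. (D x v \<bullet> b) *\<^sub>R E (g x) b)) (at x)"
      by argo
  next
    fix v
    show "Ck_on k U (\<lambda>x. \<Sum>b\<in>Basis. (D x v \<bullet> b) *\<^sub>R E (g x) b)"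
    proof (intro Ck_on_sum Ck_on_bounded_bilinear[OF bounded_bilinear_scaleR] assms(1))
      fix b :: 'b
      show "Ck_on k U (\<lambda>x. D x v \<bullet> b)"
        using Ck_on_bounded_linear[OF bounded_linear_inner_left assms(1) D(2)] .
      show "Ck_on k U (\<lambda>x. E (g x) b)"
        using Suc.IH[OF low E(2)] .
    qed
  qed (use assms in auto)
qed

lemma Ck_on_Pair:
  fixes f :: "'a::euclidean_space \<Rightarrow> 'b::real_normed_vector" and g :: "'a \<Rightarrow> 'c::real_normed_vector"
  assumes "open S" "Ck_on k S f" "Ck_on k S g"
  shows "Ck_on k S (\<lambda>x. (f x, g x))"
proof -
  have L: "bounded_linear (\<lambda>u::'b. (u, 0::'c))" "bounded_linear (\<lambda>u::'c. (0::'b, u))"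
    by (intro bounded_linear_Pair bounded_linear_ident bounded_linear_zero)+
  have "Ck_on k S (\<lambda>x. (f x, 0) + (0, g x))"
    by (intro Ck_on_add assms Ck_on_bounded_linear[OF L(1)] Ck_on_bounded_linear[OF L(2)])
  then show ?thesis by simp
qed

lemma Ck_on_local:
  fixes f :: "'a::euclidean_space \<Rightarrow> 'b::real_normed_vector"
  assumes "\<And>x. x \<in> S \<Longrightarrow> \<exists>U. open U \<and> x \<in> U \<and> Ck_on k U f"
  shows "Ck_on k S f"
  using assms
proof (induction k arbitrary: f)
  case 0
  have "isCont f x" if "x \<in> S" for x
    using 0[OF that] continuous_on_eq_continuous_at by auto
  then show ?case
    by (simp add: continuous_at_imp_continuous_on)
next
  case (Suc k)
  show ?case
  proof (simp, intro conjI ballI allI)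
    show "f differentiable at x" if "x \<in> S" for x
      using Suc.prems[OF that] by auto
    show "Ck_on k S (\<lambda>x. frechet_derivative f (at x) v)" for v
      using Suc.prems by (intro Suc.IH) (metis Ck_on.simps(2))
  qed
qed

subsection \<open>Smoothness on arbitrary sets\<close>

lemma smooth_onE:
  assumes "smooth_on S f" "x \<in> S"
  obtains U g where "open U" "x \<in> U" "\<And>k. Ck_on k U g" "\<And>y. y \<in> U \<inter> S \<Longrightarrow> g y = f y"
  using assms unfolding smooth_on_def by meson

lemma smooth_onI:
  assumes "\<And>x. x \<in> S \<Longrightarrow> \<exists>U g. open U \<and> x \<in> U \<and> (\<forall>k. Ck_on k U g) \<and> (\<forall>y\<in>U \<inter> S. g y = f y)"
  shows "smooth_on S f"
  using assms unfolding smooth_on_def by blast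

lemma smooth_on_if_Ck_on:
  assumes "open U" "\<And>k. Ck_on k U f" "S \<subseteq> U"
  shows "smooth_on S f"
  using assms by (intro smooth_onI exI[of _ U] exI[of _ f]) auto

lemma smooth_on_cong: "smooth_on S f \<Longrightarrow> (\<And>x. x \<in> S \<Longrightarrow> f x = g x) \<Longrightarrow> smooth_on S g"
  unfolding smooth_on_def by (metis IntE)

lemma smooth_on_subset:
  assumes "smooth_on S f" "T \<subseteq> S"
  shows "smooth_on T f"
proof (rule smooth_onI)
  fix x assume "x \<in> T"
  with assms obtain U g where "open U" "x \<in> U" "\<And>k. Ck_on k U g" "\<And>y. y \<in> U \<inter> S \<Longrightarrow> g y = f y"
    by (meson smooth_onE subsetD)
  with assms(2) show "\<exists>U g. open U \<and> x \<in> U \<and> (\<forall>k. Ck_on k U g) \<and> (\<forall>y\<in>U \<inter> T. g y = f y)"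
    by (intro exI[of _ U] exI[of _ g]) auto
qed

lemma smooth_on_local:
  assumes "\<And>x. x \<in> S \<Longrightarrow> \<exists>U. open U \<and> x \<in> U \<and> smooth_on (U \<inter> S) f"
  shows "smooth_on S f"
proof (rule smooth_onI)
  fix x assume x: "x \<in> S"
  from assms[OF x] obtain U where U: "open U" "x \<in> U" "smooth_on (U \<inter> S) f" by blast
  obtain V g where V: "open V" "x \<in> V" "\<And>k. Ck_on k V g" "\<And>y. y \<in> V \<inter> (U \<inter> S) \<Longrightarrow> g y = f y"
    by (rule smooth_onE[OF U(3), of x]) (use U x in auto)
  have "open (U \<inter> V)" "x \<in> U \<inter> V" "\<forall>k. Ck_on k (U \<inter> V) g" "\<forall>y\<in>(U \<inter> V) \<inter> S. g y = f y"
    using U V Ck_on_subset[OF V(3)] by (auto intro!: V(4))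
  then show "\<exists>U g. open U \<and> x \<in> U \<and> (\<forall>k. Ck_on k U g) \<and> (\<forall>y\<in>U \<inter> S. g y = f y)" by blast
qed

lemma smooth_on_open_iff: "open S \<Longrightarrow> smooth_on S f \<longleftrightarrow> (\<forall>k. Ck_on k S f)"
proof
  assume S: "open S" "smooth_on S f"
  show "\<forall>k. Ck_on k S f"
  proof (intro allI Ck_on_local)
    fix k x assume x: "x \<in> S"
    obtain U g where U: "open U" "x \<in> U" "\<And>k. Ck_on k U g" "\<And>y. y \<in> U \<inter> S \<Longrightarrow> g y = f y"
      by (rule smooth_onE[OF S(2) x]) blast
    have "Ck_on k (U \<inter> S) f"
      by (rule Ck_on_cong[OF _ U(4) Ck_on_subset[OF U(3)]]) (use U S in auto)
    then show "\<exists>U. open U \<and> x \<in> U \<and> Ck_on k U f"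
      using U S x by blast
  qed
qed (simp add: smooth_on_if_Ck_on)

lemma smooth_on_imp_continuous_on:
  assumes "smooth_on S f"
  shows "continuous_on S f"
  unfolding continuous_on_eq_continuous_within
proof
  fix x assume x: "x \<in> S"
  obtain U g where U: "open U" "x \<in> U" "\<And>k. Ck_on k U g" "\<And>y. y \<in> U \<inter> S \<Longrightarrow> g y = f y"
    by (rule smooth_onE[OF assms x]) blast
  have "continuous_on (U \<inter> S) g"
    using U(3)[of 0] by (auto intro: continuous_on_subset)
  then have "continuous_on (U \<inter> S) f"
    using U(4) continuous_on_cong[of "U \<inter> S" "U \<inter> S" g f] by simp
  then have "continuous (at x within S \<inter> U) f"
    using U x by (auto simp: continuous_on_eq_continuous_within Int_commute)
  then show "continuous (at x within S) f"
    using at_within_nhd[OF U(2,1), of S "S \<inter> U"] by auto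
qed

lemma smooth_on_compose:
  fixes g :: "'a::euclidean_space \<Rightarrow> 'b::euclidean_space" and f :: "'b \<Rightarrow> 'c::real_normed_vector"
  assumes "smooth_on S g" "smooth_on T f" "\<And>x. x \<in> S \<Longrightarrow> g x \<in> T"
  shows "smooth_on S (\<lambda>x. f (g x))"
proof (rule smooth_onI)
  fix x assume x: "x \<in> S"
  obtain U g' where U: "open U" "x \<in> U" "\<And>k. Ck_on k U g'" "\<And>y. y \<in> U \<inter> S \<Longrightarrow> g' y = g y"
    by (rule smooth_onE[OF assms(1) x]) blast
  obtain V f' where V: "open V" "g x \<in> V" "\<And>k. Ck_on k V f'" "\<And>y. y \<in> V \<inter> T \<Longrightarrow> f' y = f y"
    by (rule smooth_onE[OF assms(2) assms(3)[OF x]]) blast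
  define W where "W = U \<inter> g' -` V"
  have "open W"
    unfolding W_def using U(1) V(1) Ck_on_imp_continuous_on[OF U(3)]
    by (simp add: continuous_open_preimage)
  moreover have "x \<in> W" using U V x unfolding W_def by auto
  moreover have "Ck_on k W (\<lambda>x. f' (g' x))" for k
    by (rule Ck_on_compose[OF \<open>open W\<close> V(1)]) (auto simp: W_def intro: U V Ck_on_subset)
  moreover have "\<forall>y\<in>W \<inter> S. f' (g' y) = f (g y)"
    using U(4) V(4) assms(3) unfolding W_def by auto
  ultimately show "\<exists>U h. open U \<and> x \<in> U \<and> (\<forall>k. Ck_on k U h) \<and> (\<forall>y\<in>U \<inter> S. h y = f (g y))"
    by blast
qed

lemma smooth_on_binary:
  fixes f :: "'a::euclidean_space \<Rightarrow> 'b::real_normed_vector" and g :: "'a \<Rightarrow> 'c::real_normed_vector"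
    and h :: "'b \<Rightarrow> 'c \<Rightarrow> 'd::real_normed_vector"
  assumes f: "smooth_on S f" and g: "smooth_on S g"
    and h: "\<And>k (U::'a set) f g. open U \<Longrightarrow> Ck_on k U f \<Longrightarrow> Ck_on k U g \<Longrightarrow> Ck_on k U (\<lambda>x. h (f x) (g x))"
  shows "smooth_on S (\<lambda>x. h (f x) (g x))"
proof (rule smooth_onI)
  fix x assume x: "x \<in> S"
  obtain U f' where U: "open U" "x \<in> U" "\<And>k. Ck_on k U f'" "\<And>y. y \<in> U \<inter> S \<Longrightarrow> f' y = f y"
    by (rule smooth_onE[OF f x]) blast
  obtain V g' where V: "open V" "x \<in> V" "\<And>k. Ck_on k V g'" "\<And>y. y \<in> V \<inter> S \<Longrightarrow> g' y = g y"
    by (rule smooth_onE[OF g x]) blast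
  have "Ck_on k (U \<inter> V) (\<lambda>x. h (f' x) (g' x))" for k
    by (rule h[of "U \<inter> V" k f' g']) (use U V in \<open>auto intro: Ck_on_subset\<close>)
  then show "\<exists>U k. open U \<and> x \<in> U \<and> (\<forall>n. Ck_on n U k) \<and> (\<forall>y\<in>U \<inter> S. k y = h (f y) (g y))"
    using U V by (intro exI[of _ "U \<inter> V"] exI[of _ "\<lambda>x. h (f' x) (g' x)"]) auto
qed

lemma smooth_on_Pair: "smooth_on S f \<Longrightarrow> smooth_on S g \<Longrightarrow> smooth_on S (\<lambda>x. (f x, g x))"
  by (rule smooth_on_binary) (auto intro: Ck_on_Pair)

lemma smooth_on_add: "smooth_on S f \<Longrightarrow> smooth_on S g \<Longrightarrow> smooth_on S (\<lambda>x. f x + g x)"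
  by (rule smooth_on_binary) (auto intro: Ck_on_add)

lemma smooth_on_bilinear:
  "bounded_bilinear pr \<Longrightarrow> smooth_on S f \<Longrightarrow> smooth_on S g \<Longrightarrow> smooth_on S (\<lambda>x. pr (f x) (g x))"
  by (rule smooth_on_binary) (auto intro: Ck_on_bounded_bilinear)

lemmas smooth_on_mult = smooth_on_bilinear[OF bounded_bilinear_mult]

lemma smooth_on_const: "smooth_on S (\<lambda>x. c)"
  by (rule smooth_on_if_Ck_on[of UNIV]) (auto intro: Ck_on_const)

lemma smooth_on_id: "smooth_on S (\<lambda>x. x)"
  by (rule smooth_on_if_Ck_on[of UNIV]) (auto intro: Ck_on_id)

lemma smooth_on_linear:
  assumes "bounded_linear L" "smooth_on S f"
  shows "smooth_on S (\<lambda>x. L (f x))"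
  using smooth_on_binary[OF assms(2) assms(2), of "\<lambda>u _. L u"] Ck_on_bounded_linear[OF assms(1)] by blast

lemmas smooth_on_fst = smooth_on_linear[OF bounded_linear_fst]
lemmas smooth_on_snd = smooth_on_linear[OF bounded_linear_snd]

lemma smooth_on_minus: 
  assumes "smooth_on S f" "smooth_on S g" shows "smooth_on S (\<lambda>x. f x - g x)"
  using smooth_on_add[OF assms(1) smooth_on_linear[OF bounded_linear_minus[OF bounded_linear_ident] assms(2)]]
  by simp

lemma smooth_on_sum: "(\<And>i. i \<in> I \<Longrightarrow> smooth_on S (f i)) \<Longrightarrow> smooth_on S (\<lambda>x. \<Sum>i\<in>I. f i x)"
  by (induction I rule: infinite_finite_induct) (auto intro: smooth_on_add smooth_on_const)

lemma smooth_on_power: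
  fixes f :: "'a::euclidean_space \<Rightarrow> 'b::real_normed_field"
  shows "smooth_on S f \<Longrightarrow> smooth_on S (\<lambda>x. f x ^ n)"
  by (induction n) (auto intro: smooth_on_mult smooth_on_const)

lemmas smooth_on_intros = smooth_on_Pair smooth_on_add smooth_on_mult smooth_on_const smooth_on_id
  smooth_on_fst smooth_on_snd smooth_on_minus smooth_on_sum smooth_on_power

section \<open>Decay of functions and their derivatives at the origin\<close>

definition vderiv :: "(real \<Rightarrow> 'b::real_normed_vector) \<Rightarrow> real \<Rightarrow> 'b" where
  "vderiv v x = vector_derivative v (at x)"

lemma vderiv_eq: "(v has_vector_derivative d) (at x) \<Longrightarrow> vderiv v x = d"
  by (simp add: vderiv_def vector_derivative_at)

lemma smooth_has_vderiv:
  assumes "open S" "smooth_on S v" "x \<in> S"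
  shows "(v has_vector_derivative vderiv v x) (at x)"
proof -
  have "Ck_on (Suc 0) S v" using assms smooth_on_open_iff by blast
  then have "v differentiable (at x)" using assms(3) by auto
  then show ?thesis by (simp add: vderiv_def vector_derivative_works)
qed

lemma smooth_vderiv:
  fixes v :: "real \<Rightarrow> 'b::real_normed_vector"
  assumes "open S" "smooth_on S v"
  shows "smooth_on S (vderiv v)"
  unfolding smooth_on_open_iff[OF assms(1)]
proof
  fix k
  have "Ck_on (Suc k) S v" using assms smooth_on_open_iff by blast
  then have "Ck_on k S (\<lambda>x. frechet_derivative v (at x) 1)" by simp
  then show "Ck_on k S (vderiv v)"
  proof (rule Ck_on_cong[OF assms(1), rotated])
    fix x assume "x \<in> S"
    from smooth_has_vderiv[OF assms this]
    have "(v has_derivative (\<lambda>t. t *\<^sub>R vderiv v x)) (at x)"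
      by (simp add: has_vector_derivative_def)
    from frechet_derivative_at[OF this]
    show "frechet_derivative v (at x) 1 = vderiv v x"
      by (metis scaleR_one)
  qed
qed

lemma vderiv_cong_open:
  assumes "open S" "x \<in> S" "\<And>y. y \<in> S \<Longrightarrow> v y = w y"
  shows "vderiv v x = vderiv w x"
proof -
  have "(v has_vector_derivative d) (at x) \<longleftrightarrow> (w has_vector_derivative d) (at x)" for d
    using assms has_vector_derivative_transform_within_open[of v d x S w]
      has_vector_derivative_transform_within_open[of w d x S v] by auto
  then show ?thesis
    by (simp add: vderiv_def vector_derivative_def)
qed

definition order_at_0 :: "nat \<Rightarrow> (real \<Rightarrow> 'b::real_normed_vector) \<Rightarrow> bool" where
  "order_at_0 k v \<longleftrightarrow> (\<exists>C. \<forall>\<^sub>F x in at_right 0. norm (v x) \<le> C * x ^ k)"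

text \<open>Only the behaviour to the right of \<open>0\<close> enters, so that no value at \<open>0\<close> has to be chosen. Order
  \<open>0\<close> means that the function and its first \<open>n\<close> derivatives are bounded near \<open>0\<close>.\<close>

primrec jet_order :: "nat \<Rightarrow> nat \<Rightarrow> (real \<Rightarrow> 'b::real_normed_vector) \<Rightarrow> bool" where
  "jet_order k 0 v = order_at_0 k v"
| "jet_order k (Suc n) v = (order_at_0 k v \<and> jet_order k n (vderiv v))"

lemma eventually_at_right_0_pos: "\<forall>\<^sub>F x::real in at_right 0. x > 0"
  by (simp add: eventually_at_right_less)

lemma order_at_0_nonneg:
  assumes "order_at_0 k v"
  obtains C where "C \<ge> 0" "\<forall>\<^sub>F x in at_right 0. norm (v x) \<le> C * x ^ k"
proof -
  obtain C where C: "\<forall>\<^sub>F x in at_right 0. norm (v x) \<le> C * x ^ k"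
    using assms unfolding order_at_0_def by blast
  have "\<forall>\<^sub>F x in at_right 0. norm (v x) \<le> \<bar>C\<bar> * x ^ k"
    using C eventually_at_right_0_pos
  proof eventually_elim
    case (elim x)
    have "C * x ^ k \<le> \<bar>C\<bar> * x ^ k" using elim by (intro mult_right_mono) auto
    with elim show ?case by linarith
  qed
  with that[of "\<bar>C\<bar>"] show ?thesis by simp
qed

lemma order_at_0_cong:
  assumes "d > 0" "\<And>x. 0 < x \<Longrightarrow> x < d \<Longrightarrow> v x = w x" "order_at_0 k v"
  shows "order_at_0 k w"
proof -
  obtain C where C: "\<forall>\<^sub>F x in at_right 0. norm (v x) \<le> C * x ^ k"
    using assms unfolding order_at_0_def by blast
  have "\<forall>\<^sub>F x::real in at_right 0. 0 < x \<and> x < d"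
    using assms(1) by (auto simp: eventually_at_right_field)
  with C have "\<forall>\<^sub>F x in at_right 0. norm (w x) \<le> C * x ^ k"
    by eventually_elim (use assms(2) in auto)
  then show ?thesis unfolding order_at_0_def by blast
qed

lemma order_at_0_bilinear:
  assumes "bounded_bilinear pr" "order_at_0 0 u" "order_at_0 k v"
  shows "order_at_0 k (\<lambda>x. pr (u x) (v x))"
proof -
  obtain A where A: "A \<ge> 0" "\<forall>\<^sub>F x in at_right 0. norm (u x) \<le> A * x ^ 0"
    by (rule order_at_0_nonneg[OF assms(2)]) blast
  obtain C where C: "C \<ge> 0" "\<forall>\<^sub>F x in at_right 0. norm (v x) \<le> C * x ^ k"
    by (rule order_at_0_nonneg[OF assms(3)]) blast
  obtain B where B: "B > 0" "\<And>a b. norm (pr a b) \<le> norm a * norm b * B"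
    using bounded_bilinear.pos_bounded[OF assms(1)] by blast
  have "\<forall>\<^sub>F x in at_right 0. norm (pr (u x) (v x)) \<le> (A * C * B) * x ^ k"
    using A(2) C(2)
  proof eventually_elim
    case (elim x)
    have "norm (pr (u x) (v x)) \<le> norm (u x) * norm (v x) * B" by (rule B)
    also have "\<dots> \<le> A * (C * x ^ k) * B"
      using elim A C B by (intro mult_right_mono mult_mono) auto
    finally show ?case by (simp add: mult_ac)
  qed
  then show ?thesis unfolding order_at_0_def by blast
qed

lemma order_at_0_linear:
  assumes "bounded_linear L" "order_at_0 k v"
  shows "order_at_0 k (\<lambda>x. L (v x))"
proof -
  obtain C where C: "C \<ge> 0" "\<forall>\<^sub>F x in at_right 0. norm (v x) \<le> C * x ^ k"
    by (rule order_at_0_nonneg[OF assms(2)]) blast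
  obtain B where B: "B > 0" "\<And>a. norm (L a) \<le> norm a * B"
    using bounded_linear.pos_bounded[OF assms(1)] by blast
  have "\<forall>\<^sub>F x in at_right 0. norm (L (v x)) \<le> (C * B) * x ^ k"
    using C(2)
  proof eventually_elim
    case (elim x)
    have "norm (L (v x)) \<le> norm (v x) * B" by (rule B)
    also have "\<dots> \<le> (C * x ^ k) * B"
      using elim B by (intro mult_right_mono) auto
    finally show ?case by (simp add: mult_ac)
  qed
  then show ?thesis unfolding order_at_0_def by blast
qed

lemma order_at_0_add:
  assumes "order_at_0 k u" "order_at_0 k v"
  shows "order_at_0 k (\<lambda>x. u x + v x)"
proof -
  obtain A where A: "\<forall>\<^sub>F x in at_right 0. norm (u x) \<le> A * x ^ k"
    using assms(1) unfolding order_at_0_def by blast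
  obtain C where C: "\<forall>\<^sub>F x in at_right 0. norm (v x) \<le> C * x ^ k"
    using assms(2) unfolding order_at_0_def by blast
  have "\<forall>\<^sub>F x in at_right 0. norm (u x + v x) \<le> (A + C) * x ^ k"
    using A C
  proof eventually_elim
    case (elim x)
    then show ?case using norm_triangle_ineq[of "u x" "v x"] by (simp add: algebra_simps)
  qed
  then show ?thesis unfolding order_at_0_def by blast
qed

lemma order_at_0_lower:
  assumes "order_at_0 k v"
  shows "order_at_0 0 v"
proof -
  obtain C where C: "C \<ge> 0" "\<forall>\<^sub>F x in at_right 0. norm (v x) \<le> C * x ^ k"
    by (rule order_at_0_nonneg[OF assms]) blast
  have "\<forall>\<^sub>F x::real in at_right 0. 0 < x \<and> x < 1"
    by (auto simp: eventually_at_right_field intro: exI[of _ 1])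
  with C(2) have "\<forall>\<^sub>F x in at_right 0. norm (v x) \<le> C * x ^ 0"
  proof eventually_elim
    case (elim x)
    have "C * x ^ k \<le> C * x ^ 0" using elim C by (intro mult_left_mono) (auto intro: power_le_one)
    with elim show ?case by linarith
  qed
  then show ?thesis unfolding order_at_0_def by blast
qed

lemma jet_order_cong:
  assumes "d > 0" "\<And>x. 0 < x \<Longrightarrow> x < d \<Longrightarrow> v x = w x" "jet_order k n v"
  shows "jet_order k n w"
  using assms(2,3)
proof (induction n arbitrary: v w)
  case 0
  then show ?case using order_at_0_cong[OF assms(1), of v w k] by simp
next
  case (Suc n)
  have "vderiv v x = vderiv w x" if "0 < x" "x < d" for x
    using that Suc.prems(1) by (intro vderiv_cong_open[of "{0<..<d}"]) auto
  then show ?case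
    using Suc.prems order_at_0_cong[OF assms(1), of v w k] Suc.IH[of "vderiv v" "vderiv w"] by simp
qed

lemma jet_order_cong_pos:
  "(\<And>x. 0 < x \<Longrightarrow> v x = w x) \<Longrightarrow> jet_order k n v \<Longrightarrow> jet_order k n w"
  by (rule jet_order_cong[of 1]) auto

lemma jet_order_0: "jet_order k n v \<Longrightarrow> order_at_0 k v"
  by (cases n) auto

lemma jet_order_Suc_lower: "jet_order k (Suc n) v \<Longrightarrow> jet_order k n v"
  by (induction n arbitrary: v) auto

lemma jet_order_lower: "jet_order k n v \<Longrightarrow> jet_order 0 n v"
  by (induction n arbitrary: v) (auto intro: order_at_0_lower)

lemma jet_order_add:
  assumes "smooth_on {0<..} u" "smooth_on {0<..} v" "jet_order k n u" "jet_order k n v"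
  shows "jet_order k n (\<lambda>x. u x + v x)"
  using assms
proof (induction n arbitrary: u v)
  case (Suc n)
  have "vderiv u x + vderiv v x = vderiv (\<lambda>x. u x + v x) x" if "0 < x" for x
    using that smooth_has_vderiv[of "{0<..}" _ x] Suc.prems
    by (intro vderiv_eq[symmetric] has_vector_derivative_add) auto
  moreover have "jet_order k n (\<lambda>x. vderiv u x + vderiv v x)"
    using Suc.prems by (intro Suc.IH smooth_vderiv) auto
  ultimately show ?case
    using Suc.prems jet_order_cong_pos[of "\<lambda>x. vderiv u x + vderiv v x"] order_at_0_add by auto
qed (simp add: order_at_0_add)

lemma jet_order_linear:
  assumes "bounded_linear L" "smooth_on {0<..} v" "jet_order k n v"
  shows "jet_order k n (\<lambda>x. L (v x))"
  using assms(2,3)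
proof (induction n arbitrary: v)
  case (Suc n)
  have "L (vderiv v x) = vderiv (\<lambda>x. L (v x)) x" if "0 < x" for x
    using that smooth_has_vderiv[of "{0<..}" _ x] Suc.prems
    by (intro vderiv_eq[symmetric] bounded_linear.has_vector_derivative[OF assms(1)]) auto
  moreover have "jet_order k n (\<lambda>x. L (vderiv v x))"
    using Suc.prems by (intro Suc.IH smooth_vderiv) auto
  ultimately show ?case
    using Suc.prems jet_order_cong_pos[of "\<lambda>x. L (vderiv v x)"] order_at_0_linear[OF assms(1)] by auto
qed (simp add: order_at_0_linear[OF assms(1)])

lemma jet_order_bilinear:
  assumes pr: "bounded_bilinear pr"
    and "smooth_on {0<..} u" "smooth_on {0<..} v" "jet_order 0 n u" "jet_order k n v"
  shows "jet_order k n (\<lambda>x. pr (u x) (v x))"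
  using assms(2-)
proof (induction n arbitrary: u v)
  case (Suc n)
  have "pr (u x) (vderiv v x) + pr (vderiv u x) (v x) = vderiv (\<lambda>x. pr (u x) (v x)) x" if "0 < x" for x
    using that smooth_has_vderiv[of "{0<..}" u x] smooth_has_vderiv[of "{0<..}" v x] Suc.prems
    by (intro vderiv_eq[symmetric] bounded_bilinear.has_vector_derivative[OF pr]) auto
  moreover have "jet_order k n (\<lambda>x. pr (u x) (vderiv v x) + pr (vderiv u x) (v x))"
  proof (intro jet_order_add smooth_on_bilinear[OF pr] Suc.IH smooth_vderiv)
    show "jet_order 0 n u" "jet_order k n v"
      using Suc.prems jet_order_Suc_lower by blast+
  qed (use Suc.prems in auto)
  ultimately show ?case
    using Suc.prems order_at_0_bilinear[OF pr]
      jet_order_cong_pos[of "\<lambda>x. pr (u x) (vderiv v x) + pr (vderiv u x) (v x)"] by auto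
qed (simp add: order_at_0_bilinear[OF pr])

lemma jet_order_power:
  fixes v :: "real \<Rightarrow> complex"
  assumes "smooth_on {0<..} v" "jet_order k n v" "m > 0"
  shows "jet_order k n (\<lambda>x. v x ^ m)"
  using assms(3)
proof (induction m)
  case (Suc m)
  show ?case
  proof (cases "m = 0")
    case False
    then have "jet_order k n (\<lambda>x. v x * v x ^ m)"
      using Suc assms by (intro jet_order_bilinear[OF bounded_bilinear_mult] smooth_on_power)
        (auto intro: jet_order_lower)
    then show ?thesis by simp
  qed (use assms in auto)
qed simp

text \<open>All derivatives are continuous at \<open>0\<close>, hence bounded nearby.\<close>

lemma jet_order_smooth_at_0:
  assumes "open U" "0 \<in> U" "smooth_on U g"
  shows "jet_order 0 n g"
  using assms(3)
proof (induction n arbitrary: g)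
  have *: "order_at_0 0 g" if "smooth_on U g" for g :: "real \<Rightarrow> 'a"
  proof -
    have "isCont g 0"
      using assms smooth_on_imp_continuous_on[OF that] continuous_on_eq_continuous_at by blast
    then have "(g \<longlongrightarrow> g 0) (at_right 0)"
      by (simp add: continuous_at filterlim_at_split)
    then have "((\<lambda>x. norm (g x)) \<longlongrightarrow> norm (g 0)) (at_right 0)"
      by (rule tendsto_norm)
    then have "\<forall>\<^sub>F x in at_right 0. norm (g x) < norm (g 0) + 1"
      by (rule order_tendstoD) simp
    then show ?thesis
      unfolding order_at_0_def by (intro exI[of _ "norm (g 0) + 1"]) (auto elim: eventually_mono)
  qed
  case 0
  then show ?case using * by simp
  case (Suc n)
  then show ?case using * smooth_vderiv[OF assms(1) Suc.prems] by simp
qed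

text \<open>Flatness makes the difference quotients at \<open>0\<close> of the extension and of all its derivatives
  tend to \<open>0\<close>; vanishing to order \<open>2\<close> of each derivative is enough for this.\<close>

lemma zero_extension_smooth:
  fixes v :: "real \<Rightarrow> 'b::real_normed_vector"
  assumes "smooth_on {0<..} v" "\<And>n. jet_order 2 n v"
  shows "Ck_on k UNIV (\<lambda>x. if x > 0 then v x else 0)"
proof -
  have deriv: "((\<lambda>x. if x > 0 then v x else 0) has_vector_derivative (if x > 0 then vderiv v x else 0)) (at x)"
    if v: "smooth_on {0<..} v" and o: "order_at_0 2 v" for v :: "real \<Rightarrow> 'b" and x
  proof (cases "x = 0")
    case True
    obtain C where C: "C \<ge> 0" "\<forall>\<^sub>F x in at_right 0. norm (v x) \<le> C * x ^ 2"
      by (rule order_at_0_nonneg[OF o]) blast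
    then obtain d where d: "d > 0" "\<And>x. 0 < x \<Longrightarrow> x < d \<Longrightarrow> norm (v x) \<le> C * x ^ 2"
      by (auto simp: eventually_at_right_field)
    have "((\<lambda>x. if x > 0 then v x else 0) has_derivative (\<lambda>_. 0)) (at 0)"
      unfolding has_derivative_at
    proof (intro conjI)
      have "((\<lambda>h::real. C * \<bar>h\<bar>) \<longlongrightarrow> C * \<bar>0\<bar>) (at 0)"
        by (intro tendsto_intros)
      then have l: "((\<lambda>h::real. C * \<bar>h\<bar>) \<longlongrightarrow> 0) (at 0)" by simp
      have "\<forall>\<^sub>F h in at 0. norm (norm ((if 0 + h > 0 then v (0 + h) else 0) - (if (0::real) > 0 then v 0 else 0) - 0) / norm h)
          \<le> C * \<bar>h\<bar>"
        unfolding eventually_at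
      proof (intro exI[of _ d] conjI ballI impI)
        fix h :: real assume "h \<noteq> 0 \<and> dist h 0 < d"
        then show "norm (norm ((if 0 + h > 0 then v (0 + h) else 0) - (if (0::real) > 0 then v 0 else 0) - 0) / norm h) \<le> C * \<bar>h\<bar>"
          using d(2)[of h] C(1) by (auto simp: field_simps power2_eq_square)
      qed (rule d)
      from Lim_null_comparison[OF this l]
      show "(\<lambda>h. norm ((if 0 + h > 0 then v (0 + h) else 0) - (if (0::real) > 0 then v 0 else 0) - 0) / norm h) \<midarrow>0\<rightarrow> 0" .
    qed simp
    then show ?thesis using True by (simp add: has_vector_derivative_def)
  next
    case False
    show ?thesis
    proof (cases "x > 0")
      case True
      have "((\<lambda>x. if x > 0 then v x else 0) has_vector_derivative vderiv v x) (at x)"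
        by (rule has_vector_derivative_transform_within_open[OF smooth_has_vderiv[of "{0<..}" v x]])
          (use True v in \<open>auto intro: open_greaterThan\<close>)
      with True show ?thesis by simp
    next
      case neg: False
      have "((\<lambda>x. if x > 0 then v x else 0) has_vector_derivative 0) (at x)"
        by (rule has_vector_derivative_transform_within_open[of "\<lambda>_. 0" _ _ "{..<0}"])
          (use neg \<open>x \<noteq> 0\<close> in auto)
      with neg show ?thesis by simp
    qed
  qed
  show ?thesis
    using assms
  proof (induction k arbitrary: v)
    case 0
    have "continuous_on UNIV (\<lambda>x. if x > 0 then v x else 0)"
      using deriv[OF 0(1) jet_order_0[OF 0(2)]]
      by (meson continuous_at_imp_continuous_on has_vector_derivative_continuous)
    then show ?case by simp
  next
    case (Suc k)
    show ?case
    proof (rule Ck_on_SucI)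
      show "((\<lambda>x. if x > 0 then v x else 0) has_derivative
          (\<lambda>t. t *\<^sub>R (if x > 0 then vderiv v x else 0))) (at x)" for x
        using deriv[OF Suc.prems(1) jet_order_0[OF Suc.prems(2)]]
        by (simp only: has_vector_derivative_def)
      have "jet_order 2 n (vderiv v)" for n
        using Suc.prems(2)[of "Suc n"] by simp
      then have "Ck_on k UNIV (\<lambda>x. if x > 0 then vderiv v x else 0)"
        by (intro Suc.IH smooth_vderiv Suc.prems) auto
      then show "Ck_on k UNIV (\<lambda>x. t *\<^sub>R (if x > 0 then vderiv v x else 0))" for t
        by (intro Ck_on_bounded_linear[OF bounded_linear_scaleR_right]) auto
    qed simp
  qed
qed

section \<open>Diffeomorphisms of the half line without fixed points in the interior\<close>

locale holonomy =
  fixes \<phi> :: "real \<Rightarrow> real"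
  assumes diffeo: "\<phi> \<in> carrier Diff_half"
    and moves: "\<And>x. x > 0 \<Longrightarrow> \<phi> x > x"
    and tangent: "tangent_to_id_infinite_order \<phi>"
begin

abbreviation psi :: "real \<Rightarrow> real" where "psi \<equiv> inv_into {0..} \<phi>"

lemma phi_bij: "bij_betw \<phi> {0..} {0..}" and phi_extensional: "\<phi> \<in> extensional {0..}"
  and phi_smooth: "smooth_on {0..} \<phi>" and psi_smooth: "smooth_on {0..} psi"
  using diffeo by (auto simp: Diff_half_def Bij_def)

lemma phi_nonneg: "x \<ge> 0 \<Longrightarrow> \<phi> x \<ge> 0"
  using phi_bij bij_betwE by fastforce

lemma psi_nonneg: "x \<ge> 0 \<Longrightarrow> psi x \<ge> 0"
  using bij_betw_inv_into[OF phi_bij] bij_betwE by fastforce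

lemma psi_phi: "x \<ge> 0 \<Longrightarrow> psi (\<phi> x) = x"
  using bij_betw_inv_into_left[OF phi_bij] by simp

lemma phi_psi: "x \<ge> 0 \<Longrightarrow> \<phi> (psi x) = x"
  using bij_betw_inv_into_right[OF phi_bij] by simp

lemma phi_0: "\<phi> 0 = 0"
proof -
  have "\<phi> (psi 0) = 0" "psi 0 \<ge> 0" by (auto simp: phi_psi psi_nonneg)
  moreover have "\<not> psi 0 > 0" using moves[of "psi 0"] \<open>\<phi> (psi 0) = 0\<close> by auto
  ultimately show ?thesis by (metis antisym_conv1)
qed

lemma phi_ge: "x \<ge> 0 \<Longrightarrow> \<phi> x \<ge> x"
  using moves[of x] phi_0 by (cases "x = 0") auto

lemma phi_continuous: "continuous_on {0..} \<phi>"
  by (rule smooth_on_imp_continuous_on[OF phi_smooth])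

lemma psi_continuous: "continuous_on {0..} psi"
  by (rule smooth_on_imp_continuous_on[OF psi_smooth])

lemma phi_strict_mono:
  assumes "0 \<le> x" "x < y"
  shows "\<phi> x < \<phi> y"
proof (rule ccontr)
  assume "\<not> \<phi> x < \<phi> y"
  then have "\<exists>z\<ge>0. z \<le> x \<and> \<phi> z = \<phi> y"
    using assms phi_nonneg[of y] phi_0
    by (intro IVT') (auto intro: continuous_on_subset[OF phi_continuous])
  then show False
    using assms psi_phi by (metis less_eq_real_def not_less order_trans)
qed

lemma phi_mono: "0 \<le> x \<Longrightarrow> x \<le> y \<Longrightarrow> \<phi> x \<le> \<phi> y"
  using phi_strict_mono[of x y] by (cases "x = y") auto

lemma phi_pos: "x > 0 \<Longrightarrow> \<phi> x > 0"
  using moves[of x] by linarith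

lemma psi_0: "psi 0 = 0"
  using psi_phi[of 0] phi_0 by simp

lemma psi_pos: "x > 0 \<Longrightarrow> psi x > 0"
  using phi_psi[of x] psi_nonneg[of x] phi_0 by (metis less_eq_real_def)

lemma psi_less: "x > 0 \<Longrightarrow> psi x < x"
  using moves[OF psi_pos[of x]] phi_psi[of x] by simp

lemma phi_pow_nonneg: "x \<ge> 0 \<Longrightarrow> (\<phi> ^^ n) x \<ge> 0"
  by (induction n) (auto intro: phi_nonneg)

lemma phi_pow_pos: "x > 0 \<Longrightarrow> (\<phi> ^^ n) x > 0"
  by (induction n) (auto intro: phi_pos)

lemma psi_pow_nonneg: "x \<ge> 0 \<Longrightarrow> (psi ^^ n) x \<ge> 0"
  by (induction n) (auto intro: psi_nonneg)

lemma psi_pow_pos: "x > 0 \<Longrightarrow> (psi ^^ n) x > 0"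
  by (induction n) (auto intro: psi_pos)

lemma phi_pow_psi_pow: "x \<ge> 0 \<Longrightarrow> (\<phi> ^^ n) ((psi ^^ n) x) = x"
proof (induction n)
  case (Suc n)
  have "(\<phi> ^^ Suc n) ((psi ^^ Suc n) x) = (\<phi> ^^ n) (\<phi> (psi ((psi ^^ n) x)))"
    by (simp add: funpow_swap1)
  then show ?case using Suc psi_pow_nonneg[of x n] by (simp add: phi_psi)
qed simp

lemma phi_pow_mono: "0 \<le> x \<Longrightarrow> x \<le> y \<Longrightarrow> (\<phi> ^^ n) x \<le> (\<phi> ^^ n) y"
  by (induction n) (auto intro: phi_mono phi_pow_nonneg)

lemma phi_pow_ge: "x \<ge> 0 \<Longrightarrow> m \<le> n \<Longrightarrow> (\<phi> ^^ m) x \<le> (\<phi> ^^ n) x"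
proof (induction n)
  case (Suc n)
  then show ?case
    using phi_ge[of "(\<phi> ^^ n) x"] phi_pow_nonneg[of x n] by (cases "m = Suc n") (auto simp: le_Suc_eq)
qed simp

text \<open>A bounded orbit would increase to a fixed point of \<open>\<phi>\<close> in the interior.\<close>

lemma phi_pow_escapes:
  assumes "x > 0"
  shows "\<exists>n. (\<phi> ^^ n) x > B"
proof (rule ccontr)
  assume "\<not> (\<exists>n. (\<phi> ^^ n) x > B)"
  then have bdd: "(\<phi> ^^ n) x \<le> B" for n by (simp add: not_less)
  have "incseq (\<lambda>n. (\<phi> ^^ n) x)"
    using assms phi_pow_ge by (auto simp: incseq_def)
  then obtain L where L: "(\<lambda>n. (\<phi> ^^ n) x) \<longlonglongrightarrow> L" "\<And>n. (\<phi> ^^ n) x \<le> L"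
    using incseq_convergent[of "\<lambda>n. (\<phi> ^^ n) x" B] bdd by blast
  have "L > 0" using L(2)[of 0] assms by simp
  have "(\<lambda>n. \<phi> ((\<phi> ^^ n) x)) \<longlonglongrightarrow> \<phi> L"
    using continuous_on_tendsto_compose[OF phi_continuous L(1)] \<open>L > 0\<close> phi_pow_nonneg assms by simp
  moreover have "(\<lambda>n. \<phi> ((\<phi> ^^ n) x)) \<longlonglongrightarrow> L"
    using LIMSEQ_Suc[OF L(1)] by simp
  ultimately have "\<phi> L = L" using LIMSEQ_unique by blast
  with moves[OF \<open>L > 0\<close>] show False by simp
qed

lemma psi_pow_tendsto_0:
  assumes "x \<ge> 0"
  shows "(\<lambda>n. (psi ^^ n) x) \<longlonglongrightarrow> 0"
proof -
  have "psi y \<le> y" if "y \<ge> 0" for y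
    using that psi_less[of y] psi_0 by (cases "y = 0") auto
  then have "decseq (\<lambda>n. (psi ^^ n) x)"
    using assms psi_pow_nonneg by (auto simp: decseq_Suc_iff)
  then obtain L where L: "(\<lambda>n. (psi ^^ n) x) \<longlonglongrightarrow> L" "\<And>n. L \<le> (psi ^^ n) x"
    using decseq_convergent[of "\<lambda>n. (psi ^^ n) x" 0] psi_pow_nonneg assms by auto
  have "L \<ge> 0" using LIMSEQ_le_const[OF L(1)] psi_pow_nonneg assms by blast
  have "(\<lambda>n. psi ((psi ^^ n) x)) \<longlonglongrightarrow> psi L"
    using continuous_on_tendsto_compose[OF psi_continuous L(1)] \<open>L \<ge> 0\<close> psi_pow_nonneg assms by simp
  moreover have "(\<lambda>n. psi ((psi ^^ n) x)) \<longlonglongrightarrow> L"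
    using LIMSEQ_Suc[OF L(1)] by simp
  ultimately have "psi L = L" using LIMSEQ_unique by blast
  with psi_less[of L] \<open>L \<ge> 0\<close> L(1) show ?thesis by (cases "L = 0") auto
qed

subsection \<open>First order behaviour at the origin\<close>

text \<open>One-sided smoothness at \<open>0\<close> is replaced by a two-sided extension, for which the rules of calculus
  on open sets apply.\<close>

lemma phi_local_extension:
  obtains d g where "d > 0" "smooth_on {-d<..<d} g" "\<And>x. 0 \<le> x \<Longrightarrow> x < d \<Longrightarrow> g x = \<phi> x"
    "vderiv g 0 = 1"
proof -
  obtain U g where U: "open U" "0 \<in> U" "\<And>k. Ck_on k U g" "\<And>y. y \<in> U \<inter> {0..} \<Longrightarrow> g y = \<phi> y"
    by (rule smooth_onE[OF phi_smooth, of 0]) auto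
  obtain d where d: "d > 0" "ball 0 d \<subseteq> U" using U(1,2) openE by blast
  have sub: "{-d<..<d} \<subseteq> U" using d(2) by (auto simp: subset_iff dist_real_def)
  have eq: "g x = \<phi> x" if "0 \<le> x" "x < d" for x
    by (rule U(4)) (use that sub d(1) in auto)
  have sm: "smooth_on {-d<..<d} g"
    using U smooth_on_if_Ck_on sub by blast
  have "(g has_vector_derivative vderiv g 0) (at 0 within {0..})"
    using smooth_has_vderiv[OF _ sm, of 0] d(1) by (auto intro: has_vector_derivative_at_within)
  then have "((\<lambda>x. g x - x) has_vector_derivative (vderiv g 0 - 1)) (at 0 within {0..})"
    by (intro has_vector_derivative_diff has_vector_derivative_id)
  then have "((\<lambda>x. \<phi> x - x) has_vector_derivative (vderiv g 0 - 1)) (at 0 within {0..})"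
    by (rule has_vector_derivative_transform_within[OF _ d(1)]) (auto simp: eq dist_real_def)
  moreover have "at (0::real) within {0..} \<noteq> bot"
    by (simp add: at_within_Ici_at_right)
  ultimately have "vector_derivative (\<lambda>x. \<phi> x - x) (at 0 within {0..}) = vderiv g 0 - 1"
    by (intro vector_derivative_within) auto
  moreover have "vector_derivative (\<lambda>x. \<phi> x - x) (at 0 within {0..}) = 0"
    using tangent[unfolded tangent_to_id_infinite_order_def, rule_format, of 1] by simp
  ultimately have "vderiv g 0 = 1" by simp
  with that[OF d(1) sm eq] show ?thesis by blast
qed

lemma phi_smooth_pos: "smooth_on {0<..} \<phi>"
  by (rule smooth_on_subset[OF phi_smooth]) auto

lemma psi_smooth_pos: "smooth_on {0<..} psi"
  by (rule smooth_on_subset[OF psi_smooth]) auto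

lemma vderiv_phi_jet: "jet_order 0 n (vderiv \<phi>)"
  and vderiv_phi_tendsto: "(vderiv \<phi> \<longlongrightarrow> 1) (at_right 0)"
  and phi_ratio_tendsto: "((\<lambda>x. \<phi> x / x) \<longlongrightarrow> 1) (at_right 0)"
proof -
  obtain d g where d: "d > 0" and g: "smooth_on {-d<..<d} g" 
    and eq: "\<And>x. 0 \<le> x \<Longrightarrow> x < d \<Longrightarrow> g x = \<phi> x" and g1: "vderiv g 0 = 1"
    by (rule phi_local_extension) blast
  have sm: "smooth_on {-d<..<d} (vderiv g)" by (rule smooth_vderiv[OF _ g]) simp
  have eq': "vderiv g x = vderiv \<phi> x" if "0 < x" "x < d" for x
    by (rule vderiv_cong_open[of "{0<..<d}"]) (use that eq in auto)
  have "jet_order 0 n (vderiv g)"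
    by (rule jet_order_smooth_at_0[OF _ _ sm]) (use d in auto)
  then show "jet_order 0 n (vderiv \<phi>)"
    by (rule jet_order_cong[OF d, rotated]) (rule eq')
  have near: "\<forall>\<^sub>F x in at_right 0. 0 < x \<and> x < d"
    using d by (auto simp: eventually_at_right_field)
  have "isCont (vderiv g) 0"
    using smooth_on_imp_continuous_on[OF sm] d
    by (intro continuous_on_interior[of "{-d<..<d}"]) (auto simp: interior_open)
  then have "(vderiv g \<longlongrightarrow> 1) (at_right 0)"
    using g1 by (simp add: continuous_at filterlim_at_split)
  then show "(vderiv \<phi> \<longlongrightarrow> 1) (at_right 0)"
    by (rule Lim_transform_eventually) (use near eq' in \<open>auto elim: eventually_mono\<close>)
  have "(g has_vector_derivative 1) (at 0)"
    using smooth_has_vderiv[OF _ g, of 0] d g1 by auto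
  then have "(g has_field_derivative 1) (at 0)"
    by (simp add: has_real_derivative_iff_has_vector_derivative)
  then have "((\<lambda>x. (g x - g 0) / (x - 0)) \<longlongrightarrow> 1) (at_right 0)"
    by (simp add: has_field_derivative_iff filterlim_at_split)
  then show "((\<lambda>x. \<phi> x / x) \<longlongrightarrow> 1) (at_right 0)"
    by (rule Lim_transform_eventually) (use near eq d phi_0 in \<open>auto elim!: eventually_mono\<close>)
qed

lemma filterlim_phi_at_right_0: "filterlim \<phi> (at_right 0) (at_right 0)"
  unfolding filterlim_at
proof
  show "\<forall>\<^sub>F x in at_right 0. \<phi> x \<in> {0<..} \<and> \<phi> x \<noteq> 0"
    using eventually_at_right_0_pos by eventually_elim (use phi_pos in force)
  have "(\<phi> \<longlongrightarrow> \<phi> 0) (at 0 within {0..})"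
    using phi_continuous by (auto simp: continuous_on_def)
  then show "(\<phi> \<longlongrightarrow> 0) (at_right 0)"
    by (simp add: phi_0 at_within_Ici_at_right)
qed

lemma order_at_0_comp_phi:
  assumes v: "order_at_0 k v"
  shows "order_at_0 k (\<lambda>x. v (\<phi> x))"
proof -
  obtain C where C: "C \<ge> 0" "\<forall>\<^sub>F x in at_right 0. norm (v x) \<le> C * x ^ k"
    using order_at_0_nonneg[OF v] by blast
  have "\<forall>\<^sub>F x in at_right 0. norm (v (\<phi> x)) \<le> C * \<phi> x ^ k"
    by (rule eventually_compose_filterlim[OF C(2) filterlim_phi_at_right_0])
  moreover have "\<forall>\<^sub>F x in at_right 0. \<phi> x / x < 2"
    by (rule order_tendstoD[OF phi_ratio_tendsto]) simp
  ultimately have "\<forall>\<^sub>F x in at_right 0. norm (v (\<phi> x)) \<le> (C * 2 ^ k) * x ^ k"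
    using eventually_at_right_0_pos
  proof eventually_elim
    case (elim x)
    then have "\<phi> x ^ k \<le> (2 * x) ^ k"
      using phi_pos[of x] by (intro power_mono) (auto simp: field_simps)
    then have "C * \<phi> x ^ k \<le> C * (2 * x) ^ k"
      using C(1) by (rule mult_left_mono)
    with elim show ?case by (simp add: power_mult_distrib mult_ac)
  qed
  then show ?thesis unfolding order_at_0_def by blast
qed

lemma jet_order_comp_phi:
  assumes "smooth_on {0<..} v" "jet_order k n v"
  shows "jet_order k n (\<lambda>x. v (\<phi> x))"
  using assms
proof (induction n arbitrary: v)
  case 0
  then show ?case by (simp add: order_at_0_comp_phi)
next
  case (Suc n)
  have sm: "smooth_on {0<..} (vderiv v)" "smooth_on {0<..} (vderiv \<phi>)"
    using smooth_vderiv[OF _ Suc.prems(1)] smooth_vderiv[OF _ phi_smooth_pos] by auto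
  have "jet_order k n (\<lambda>x. vderiv v (\<phi> x))"
    by (rule Suc.IH[OF sm(1)]) (use Suc.prems in simp)
  then have "jet_order k n (\<lambda>x. vderiv \<phi> x *\<^sub>R vderiv v (\<phi> x))"
    by (intro jet_order_bilinear[OF bounded_bilinear_scaleR] sm vderiv_phi_jet
        smooth_on_compose[OF phi_smooth_pos sm(1)]) (auto intro: phi_pos)
  moreover have "vderiv \<phi> x *\<^sub>R vderiv v (\<phi> x) = vderiv (\<lambda>x. v (\<phi> x)) x" if "x > 0" for x
  proof -
    have "((v \<circ> \<phi>) has_vector_derivative (vderiv \<phi> x *\<^sub>R vderiv v (\<phi> x))) (at x)"
      using smooth_has_vderiv[OF _ phi_smooth_pos, of x] smooth_has_vderiv[OF _ Suc.prems(1), of "\<phi> x"]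
        phi_pos[OF that] that by (intro vector_diff_chain_at) auto
    then show ?thesis by (intro vderiv_eq[symmetric]) (simp add: o_def)
  qed
  ultimately have "jet_order k n (vderiv (\<lambda>x. v (\<phi> x)))"
    using jet_order_cong_pos[of "\<lambda>x. vderiv \<phi> x *\<^sub>R vderiv v (\<phi> x)"] by blast
  with Suc.prems show ?case by (simp add: order_at_0_comp_phi)
qed

subsection \<open>Flatness of solutions of the linear functional equation\<close>

text \<open>When an orbit of \<open>\<phi>\<close> is followed towards \<open>0\<close>, the quotient \<open>norm (v x) / x ^ k\<close> is multiplied by at
  most a factor below \<open>1\<close>, up to a bounded contribution of \<open>b\<close>, because \<open>norm a > 1\<close> whereas \<open>m\<close> and
  \<open>\<phi> x / x\<close> tend to \<open>1\<close>. Hence it stays below a bound obtained from one fundamental interval.\<close>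

lemma order_at_0_functional_equation:
  fixes v b :: "real \<Rightarrow> complex" and m :: "real \<Rightarrow> real"
  assumes cont: "continuous_on {0<..} v" and a: "norm a > 1" and m: "(m \<longlongrightarrow> 1) (at_right 0)"
    and eq: "\<And>x. x > 0 \<Longrightarrow> m x *\<^sub>R v (\<phi> x) = a * v x + b x"
    and b: "order_at_0 k b"
  shows "order_at_0 k v"
proof -
  define A where "A = norm a"
  define q where "q = (1 + A) / 2"
  have A: "A > 1" and q: "1 < q" "q < A" using a by (auto simp: A_def q_def)
  obtain C where C: "C \<ge> 0" "\<forall>\<^sub>F x in at_right 0. norm (b x) \<le> C * x ^ k"
    by (rule order_at_0_nonneg[OF b]) blast
  have "((\<lambda>x. \<bar>m x\<bar> * (\<phi> x / x) ^ k) \<longlongrightarrow> \<bar>1\<bar> * 1 ^ k) (at_right 0)"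
    by (intro tendsto_intros m phi_ratio_tendsto)
  then have "\<forall>\<^sub>F x in at_right 0. \<bar>m x\<bar> * (\<phi> x / x) ^ k < q"
    by (rule order_tendstoD) (use q in simp)
  then have "\<forall>\<^sub>F x in at_right 0. \<bar>m x\<bar> * (\<phi> x / x) ^ k < q \<and> norm (b x) \<le> C * x ^ k"
    using C(2) by eventually_elim auto
  then obtain d where d: "d > 0"
    "\<And>x. 0 < x \<Longrightarrow> x < d \<Longrightarrow> \<bar>m x\<bar> * (\<phi> x / x) ^ k < q \<and> norm (b x) \<le> C * x ^ k"
    by (auto simp: eventually_at_right_field)
  define e where "e = d / 2"
  have e: "0 < e" "e < d" using d by (auto simp: e_def)
  define W where "W x = norm (v x) / x ^ k" for x
  have "continuous_on {e..\<phi> e} W"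
    unfolding W_def using e(1) by (intro continuous_intros continuous_on_subset[OF cont]) auto
  then have "bounded (W ` {e..\<phi> e})"
    using compact_continuous_image compact_imp_bounded compact_Icc by blast
  then obtain M0 where "\<forall>y\<in>W ` {e..\<phi> e}. norm y \<le> M0" by (auto simp: bounded_iff)
  then have M0: "W x \<le> M0" if "e \<le> x" "x \<le> \<phi> e" for x
    using that by (metis abs_ge_self atLeastAtMost_iff image_eqI order_trans real_norm_def)
  \<comment> \<open>\<open>C / (A - q)\<close> is the fixed point of the recursion \<open>W \<mapsto> (q * W + C) / A\<close> for the quotients.\<close>
  define M where "M = max M0 (C / (A - q))"
  have "C / (A - q) \<le> M" by (simp add: M_def)
  then have CM: "C \<le> (A - q) * M" using q by (simp add: field_simps)
  have M_nonneg: "M \<ge> 0"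
    using C(1) q \<open>C / (A - q) \<le> M\<close> by (meson diff_ge_0_iff_ge divide_nonneg_nonneg less_imp_le order_trans)
  have step: "W x \<le> M" if x: "0 < x" "x \<le> e" and W: "W (\<phi> x) \<le> M" for x
  proof -
    have px: "\<phi> x > 0" by (rule phi_pos[OF x(1)])
    have xd: "x < d" using x e by simp
    have "A * norm (v x) = norm (m x *\<^sub>R v (\<phi> x) - b x)"
      using eq[OF x(1)] by (simp add: A_def norm_mult)
    also have "\<dots> \<le> \<bar>m x\<bar> * norm (v (\<phi> x)) + norm (b x)"
      using norm_triangle_ineq4[of "m x *\<^sub>R v (\<phi> x)" "b x"] by simp
    also have "norm (v (\<phi> x)) = W (\<phi> x) * \<phi> x ^ k" using px by (simp add: W_def)
    also have "\<bar>m x\<bar> * (W (\<phi> x) * \<phi> x ^ k) + norm (b x) \<le> \<bar>m x\<bar> * (M * \<phi> x ^ k) + C * x ^ k"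
      using W px d(2)[OF x(1) xd] by (intro add_mono mult_left_mono mult_right_mono) auto
    also have "\<dots> = ((\<bar>m x\<bar> * (\<phi> x / x) ^ k) * M + C) * x ^ k"
      using x(1) by (simp add: field_simps)
    also have "\<dots> \<le> (q * M + C) * x ^ k"
      using d(2)[OF x(1) xd] M_nonneg x(1) by (intro mult_right_mono add_right_mono) auto
    also have "\<dots> \<le> (A * M) * x ^ k"
      using CM x(1) by (intro mult_right_mono) (auto simp: algebra_simps)
    finally have "A * norm (v x) \<le> A * (M * x ^ k)" by (simp add: mult_ac)
    then have "norm (v x) \<le> M * x ^ k" using A by simp
    then show ?thesis unfolding W_def using x(1) by (simp add: field_simps)
  qed
  have "W x \<le> M" if "0 < x" "x \<le> e" "(\<phi> ^^ n) x > e" for n x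
    using that
  proof (induction n arbitrary: x)
    case (Suc n)
    show ?case
    proof (rule step[OF Suc.prems(1,2)])
      show "W (\<phi> x) \<le> M"
      proof (cases "\<phi> x \<le> e")
        case True
        with Suc show ?thesis by (simp add: funpow_swap1 phi_pos)
      next
        case False
        then show ?thesis
          using M0[of "\<phi> x"] phi_mono[of x e] Suc.prems by (simp add: M_def)
      qed
    qed
  qed simp
  then have "W x \<le> M" if "0 < x" "x \<le> e" for x
    using that phi_pow_escapes[of x e] by blast
  then have "\<forall>\<^sub>F x in at_right 0. norm (v x) \<le> M * x ^ k"
    unfolding eventually_at_right_field using e(1)
    by (intro exI[of _ e]) (auto simp: W_def field_simps)
  then show ?thesis unfolding order_at_0_def by blast
qed

text \<open>The derivative of a solution solves an equation of the same type: the factor \<open>m\<close> is replaced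
  by \<open>m * \<phi>'\<close>, and the inhomogeneous term by one that involves only lower derivatives of \<open>v\<close>.\<close>

lemma jet_order_functional_equation:
  fixes v b :: "real \<Rightarrow> complex" and m :: "real \<Rightarrow> real"
  assumes "norm a > 1" "smooth_on {0<..} v" "smooth_on {0<..} b" "smooth_on {0<..} m"
    and "(m \<longlongrightarrow> 1) (at_right 0)" "\<And>i. jet_order 0 i m"
    and "\<And>x. x > 0 \<Longrightarrow> m x *\<^sub>R v (\<phi> x) = a * v x + b x"
    and "jet_order k n b"
  shows "jet_order k n v"
  using assms(2-)
proof (induction n arbitrary: m v b)
  case 0
  then show ?case
    using order_at_0_functional_equation[OF smooth_on_imp_continuous_on[OF 0(1)] assms(1) 0(4), of b k]
    by simp
next
  case (Suc n)
  note v = \<open>smooth_on {0<..} v\<close> and b = \<open>smooth_on {0<..} b\<close> and m = \<open>smooth_on {0<..} m\<close>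
  have sm: "smooth_on {0<..} (vderiv v)" "smooth_on {0<..} (vderiv b)" "smooth_on {0<..} (vderiv m)"
    "smooth_on {0<..} (vderiv \<phi>)"
    using smooth_vderiv[OF _ v] smooth_vderiv[OF _ b] smooth_vderiv[OF _ m] smooth_vderiv[OF _ phi_smooth_pos]
    by auto
  have v_phi: "smooth_on {0<..} (\<lambda>x. v (\<phi> x))"
    by (rule smooth_on_compose[OF phi_smooth_pos v]) (auto intro: phi_pos)
  have "jet_order k n v"
    by (rule Suc.IH[OF Suc.prems(1-6)]) (use Suc.prems(7) jet_order_Suc_lower in blast)+
  then have jv: "jet_order k n (\<lambda>x. v (\<phi> x))"
    by (rule jet_order_comp_phi[OF v])
  define b' where "b' = (\<lambda>x. vderiv b x + (- vderiv m x) *\<^sub>R v (\<phi> x))"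
  have neg_m: "smooth_on {0<..} (\<lambda>x. - vderiv m x)" "jet_order 0 i (\<lambda>x. - vderiv m x)" for i
    using sm(3) Suc.prems(5)[of "Suc i"] bounded_linear_minus[OF bounded_linear_ident]
    by (auto intro: smooth_on_linear jet_order_linear)
  have "jet_order k n (vderiv v)"
  proof (rule Suc.IH[of "vderiv v" b' "\<lambda>x. m x * vderiv \<phi> x"])
    show "smooth_on {0<..} b'"
      unfolding b'_def
      by (intro smooth_on_add smooth_on_bilinear[OF bounded_bilinear_scaleR] sm neg_m v_phi)
    show "smooth_on {0<..} (\<lambda>x. m x * vderiv \<phi> x)"
      by (intro smooth_on_mult m sm)
    show "((\<lambda>x. m x * vderiv \<phi> x) \<longlongrightarrow> 1) (at_right 0)"
      using tendsto_mult[OF Suc.prems(4) vderiv_phi_tendsto] by simp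
    show "jet_order 0 i (\<lambda>x. m x * vderiv \<phi> x)" for i
      by (intro jet_order_bilinear[OF bounded_bilinear_mult] m sm Suc.prems vderiv_phi_jet)
    show "jet_order k n b'"
      unfolding b'_def using Suc.prems(7)
      by (intro jet_order_add jet_order_bilinear[OF bounded_bilinear_scaleR]
          smooth_on_bilinear[OF bounded_bilinear_scaleR] sm neg_m v_phi jv) auto
    show "(m x * vderiv \<phi> x) *\<^sub>R vderiv v (\<phi> x) = a * vderiv v x + b' x" if x: "x > 0" for x
    proof -
      have "((v \<circ> \<phi>) has_vector_derivative (vderiv \<phi> x *\<^sub>R vderiv v (\<phi> x))) (at x)"
        using smooth_has_vderiv[OF _ phi_smooth_pos, of x] smooth_has_vderiv[OF _ v, of "\<phi> x"]
          phi_pos[OF x] x by (intro vector_diff_chain_at) auto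
      then have d1: "((\<lambda>x. m x *\<^sub>R v (\<phi> x)) has_vector_derivative
          (m x *\<^sub>R (vderiv \<phi> x *\<^sub>R vderiv v (\<phi> x)) + vderiv m x *\<^sub>R v (\<phi> x))) (at x)"
        using smooth_has_vderiv[OF _ m, of x] x
        by (intro bounded_bilinear.has_vector_derivative[OF bounded_bilinear_scaleR]) (auto simp: o_def)
      have "((\<lambda>x. a * v x + b x) has_vector_derivative (a * vderiv v x + vderiv b x)) (at x)"
        using smooth_has_vderiv[OF _ v, of x] smooth_has_vderiv[OF _ b, of x] x
        by (intro has_vector_derivative_add has_vector_derivative_mult_right) auto
      then have d2: "((\<lambda>x. m x *\<^sub>R v (\<phi> x)) has_vector_derivative (a * vderiv v x + vderiv b x)) (at x)"
        by (rule has_vector_derivative_transform_within_open[of _ _ _ "{0<..}"])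
          (use x Suc.prems(6) in auto)
      from vector_derivative_unique_at[OF d1 d2] show ?thesis
        unfolding b'_def by (simp add: algebra_simps)
    qed
  qed (rule sm)
  moreover have "order_at_0 k v"
    using order_at_0_functional_equation[OF smooth_on_imp_continuous_on[OF v] assms(1) Suc.prems(4,6)]
      Suc.prems(7) by simp
  ultimately show ?case by simp
qed

lemma jet_order_eigen_equation:
  fixes v b :: "real \<Rightarrow> complex"
  assumes "norm a > 1" "smooth_on {0<..} v" "smooth_on {0<..} b"
    and "\<And>x. x > 0 \<Longrightarrow> v (\<phi> x) = a * v x + b x" "jet_order k n b"
  shows "jet_order k n v"
proof (rule jet_order_functional_equation[OF assms(1,2,3), of "\<lambda>_. 1"])
  show "jet_order 0 i (\<lambda>_. 1 :: real)" for i
    by (rule jet_order_smooth_at_0[of UNIV]) (auto intro: smooth_on_const)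
qed (use assms in \<open>auto intro: smooth_on_const\<close>)

end

section \<open>Holomorphic maps of two variables\<close>

text \<open>Complex differentiability of a scalar function of two variables. Naming the two partial derivatives
  makes sums, products and compositions a matter of rewriting.\<close>

definition cdiff :: "(complex \<times> complex \<Rightarrow> complex) \<Rightarrow> complex \<times> complex \<Rightarrow> bool" where
  "cdiff g w \<longleftrightarrow> (\<exists>a b. (g has_derivative (\<lambda>v. a * fst v + b * snd v)) (at w))"

lemma cdiff_const: "cdiff (\<lambda>w. c) w"
  unfolding cdiff_def by (intro exI[of _ 0]) simp

lemma cdiff_fst: "cdiff fst w"
  unfolding cdiff_def by (rule exI[of _ 1], rule exI[of _ 0]) (auto intro!: derivative_eq_intros)

lemma cdiff_snd: "cdiff snd w"
  unfolding cdiff_def by (rule exI[of _ 0], rule exI[of _ 1]) (auto intro!: derivative_eq_intros)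

lemma cdiff_add:
  assumes "cdiff f w" "cdiff g w"
  shows "cdiff (\<lambda>w. f w + g w) w"
proof -
  obtain a b where f: "(f has_derivative (\<lambda>v. a * fst v + b * snd v)) (at w)"
    using assms(1) unfolding cdiff_def by blast
  obtain c d where g: "(g has_derivative (\<lambda>v. c * fst v + d * snd v)) (at w)"
    using assms(2) unfolding cdiff_def by blast
  show ?thesis
    unfolding cdiff_def using has_derivative_add[OF f g]
    by (intro exI[of _ "a + c"] exI[of _ "b + d"]) (simp add: algebra_simps)
qed

lemma cdiff_mult:
  assumes "cdiff f w" "cdiff g w"
  shows "cdiff (\<lambda>w. f w * g w) w"
proof -
  obtain a b where f: "(f has_derivative (\<lambda>v. a * fst v + b * snd v)) (at w)"
    using assms(1) unfolding cdiff_def by blast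
  obtain c d where g: "(g has_derivative (\<lambda>v. c * fst v + d * snd v)) (at w)"
    using assms(2) unfolding cdiff_def by blast
  show ?thesis
    unfolding cdiff_def using has_derivative_mult[OF f g]
    by (intro exI[of _ "f w * c + a * g w"] exI[of _ "f w * d + b * g w"]) (simp add: algebra_simps)
qed

lemma cdiff_power: "cdiff f w \<Longrightarrow> cdiff (\<lambda>w. f w ^ n) w"
  by (induction n) (auto intro: cdiff_const cdiff_mult)

lemma cdiff_sum: "(\<And>i. i \<in> I \<Longrightarrow> cdiff (f i) w) \<Longrightarrow> cdiff (\<lambda>w. \<Sum>i\<in>I. f i w) w"
  by (induction I rule: infinite_finite_induct) (auto intro: cdiff_const cdiff_add)

lemma cdiff_minus: "cdiff f w \<Longrightarrow> cdiff g w \<Longrightarrow> cdiff (\<lambda>w. f w - g w) w"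
  using cdiff_add[OF _ cdiff_mult[OF cdiff_const[of "-1"]], of f w g] by simp

lemma cdiff_divide: "cdiff f w \<Longrightarrow> cdiff (\<lambda>w. f w / c) w"
  using cdiff_mult[of f w "\<lambda>w. inverse c"] by (simp add: cdiff_const divide_inverse)

lemmas cdiff_intros = cdiff_const cdiff_fst cdiff_snd cdiff_add cdiff_mult cdiff_power cdiff_sum
  cdiff_minus cdiff_divide

lemma cdiff_compose:
  assumes "cdiff f (h w)" "cdiff (\<lambda>w. fst (h w)) w" "cdiff (\<lambda>w. snd (h w)) w"
  shows "cdiff (\<lambda>w. f (h w)) w"
proof -
  obtain a b where f: "(f has_derivative (\<lambda>v. a * fst v + b * snd v)) (at (h w))"
    using assms(1) unfolding cdiff_def by blast
  obtain c d where 1: "((\<lambda>w. fst (h w)) has_derivative (\<lambda>v. c * fst v + d * snd v)) (at w)"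
    using assms(2) unfolding cdiff_def by blast
  obtain k l where 2: "((\<lambda>w. snd (h w)) has_derivative (\<lambda>v. k * fst v + l * snd v)) (at w)"
    using assms(3) unfolding cdiff_def by blast
  have "(h has_derivative (\<lambda>v. (c * fst v + d * snd v, k * fst v + l * snd v))) (at w)"
    using has_derivative_Pair[OF 1 2] by simp
  from diff_chain_at[OF this f] show ?thesis
    unfolding cdiff_def
    by (intro exI[of _ "a * c + b * k"] exI[of _ "a * d + b * l"]) (simp add: o_def algebra_simps)
qed

lemma cdiff_cong_open:
  assumes "cdiff f w" "open W" "w \<in> W" "\<And>v. v \<in> W \<Longrightarrow> f v = g v"
  shows "cdiff g w"
  using assms has_derivative_transform_within_open[of f _ w UNIV W g] unfolding cdiff_def by blast

lemma holomorphic2_on_iff_cdiff: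
  "holomorphic2_on h W \<longleftrightarrow> (\<forall>w\<in>W. cdiff (\<lambda>w. fst (h w)) w \<and> cdiff (\<lambda>w. snd (h w)) w)"
proof (intro iffI ballI conjI)
  fix w assume h: "holomorphic2_on h W" "w \<in> W"
  then obtain D where D: "(h has_derivative D) (at w)"
    "\<And>a v1 v2. D (a * v1, a * v2) = (a * fst (D (v1, v2)), a * snd (D (v1, v2)))"
    unfolding holomorphic2_on_def by blast
  have lin: "linear D" using D(1) has_derivative_linear by blast
  define a b where "a = D (1, 0)" and "b = D (0, 1)"
  have eq: "D v = (fst a * fst v + fst b * snd v, snd a * fst v + snd b * snd v)" for v
  proof -
    have "D v = D ((fst v * 1, fst v * 0) + (snd v * 0, snd v * 1))" by simp
    also have "\<dots> = D (fst v * 1, fst v * 0) + D (snd v * 0, snd v * 1)"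
      using lin linear_add by blast
    also have "\<dots> = (fst v * fst a, fst v * snd a) + (snd v * fst b, snd v * snd b)"
      by (simp only: D(2) a_def b_def)
    finally show ?thesis by (simp add: mult.commute)
  qed
  show "cdiff (\<lambda>w. fst (h w)) w"
    unfolding cdiff_def using has_derivative_fst[OF D(1)] by (auto simp: eq)
  show "cdiff (\<lambda>w. snd (h w)) w"
    unfolding cdiff_def using has_derivative_snd[OF D(1)] by (auto simp: eq)
next
  assume *: "\<forall>w\<in>W. cdiff (\<lambda>w. fst (h w)) w \<and> cdiff (\<lambda>w. snd (h w)) w"
  show "holomorphic2_on h W"
    unfolding holomorphic2_on_def
  proof
    fix w assume w: "w \<in> W"
    obtain c d where 1: "((\<lambda>w. fst (h w)) has_derivative (\<lambda>v. c * fst v + d * snd v)) (at w)"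
      using * w unfolding cdiff_def by blast
    obtain k l where 2: "((\<lambda>w. snd (h w)) has_derivative (\<lambda>v. k * fst v + l * snd v)) (at w)"
      using * w unfolding cdiff_def by blast
    have "(h has_derivative (\<lambda>v. (c * fst v + d * snd v, k * fst v + l * snd v))) (at w)"
      using has_derivative_Pair[OF 1 2] by simp
    then show "\<exists>D. (h has_derivative D) (at w) \<and>
        (\<forall>a v1 v2. D (a * v1, a * v2) = (a * fst (D (v1, v2)), a * snd (D (v1, v2))))"
      by (intro exI conjI) (auto simp: algebra_simps)
  qed
qed

lemma holomorphic2_on_compose:
  assumes "holomorphic2_on h W" "holomorphic2_on g V" "h ` W \<subseteq> V"
  shows "holomorphic2_on (\<lambda>w. g (h w)) W"
proof -
  have "cdiff (\<lambda>w. fst (g (h w))) w \<and> cdiff (\<lambda>w. snd (g (h w))) w" if "w \<in> W" for w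
    using assms that cdiff_compose[of "\<lambda>v. fst (g v)" h w] cdiff_compose[of "\<lambda>v. snd (g v)" h w]
    unfolding holomorphic2_on_iff_cdiff by blast
  then show ?thesis unfolding holomorphic2_on_iff_cdiff by blast
qed

lemma holomorphic2_on_continuous_on:
  "holomorphic2_on h W \<Longrightarrow> continuous_on W h"
  unfolding holomorphic2_on_def
  by (meson continuous_at_imp_continuous_on has_derivative_continuous)

lemma holomorphic2_on_subset: "holomorphic2_on h W \<Longrightarrow> V \<subseteq> W \<Longrightarrow> holomorphic2_on h V"
  unfolding holomorphic2_on_def by blast

lemma holomorphic2_on_local:
  assumes "\<And>w. w \<in> W \<Longrightarrow> \<exists>V g. open V \<and> w \<in> V \<and> holomorphic2_on g V \<and> (\<forall>v\<in>V. g v = h v)"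
  shows "holomorphic2_on h W"
  unfolding holomorphic2_on_iff_cdiff
proof
  fix w assume "w \<in> W"
  with assms obtain V g where V: "open V" "w \<in> V" "holomorphic2_on g V" "\<And>v. v \<in> V \<Longrightarrow> g v = h v"
    by metis
  then show "cdiff (\<lambda>w. fst (h w)) w \<and> cdiff (\<lambda>w. snd (h w)) w"
    using cdiff_cong_open[of "\<lambda>v. fst (g v)" w V] cdiff_cong_open[of "\<lambda>v. snd (g v)" w V]
    unfolding holomorphic2_on_iff_cdiff by auto
qed

lemma holomorphic2_on_cong:
  "open W \<Longrightarrow> holomorphic2_on h W \<Longrightarrow> (\<And>w. w \<in> W \<Longrightarrow> h w = g w) \<Longrightarrow> holomorphic2_on g W"
  by (rule holomorphic2_on_local) blast

section \<open>The covering and its deck transformations\<close>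

abbreviation level :: "point \<Rightarrow> real" where "level q \<equiv> snd (snd q)"

lemma planar_at_level [simp]: "planar (at_level x w) = w" "level (at_level x w) = x"
  by (auto simp: planar_def at_level_def)

lemma at_level_planar [simp]: "at_level (level q) (planar q) = q"
  by (auto simp: planar_def at_level_def)

lemma at_level_planarI: "level q = x \<Longrightarrow> at_level x (planar q) = q"
  by auto

lemma Rtilde_iff: "q \<in> Rtilde \<longleftrightarrow> level q \<ge> 0 \<and> q \<noteq> 0"
  by (cases q) (auto simp: Rtilde_def zero_prod_def)

lemma leaf_plane_0: "leaf_plane 0 = - {0}"
  by (auto simp: leaf_plane_def Rtilde_iff at_level_def zero_prod_def prod_eq_iff)

lemma leaf_plane_pos: "x > 0 \<Longrightarrow> leaf_plane x = UNIV"
  by (auto simp: leaf_plane_def Rtilde_iff at_level_def zero_prod_def)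

lemma at_level_in_Rtilde: "at_level x w \<in> Rtilde \<longleftrightarrow> w \<in> leaf_plane x"
  by (simp add: leaf_plane_def)

lemma planar_in_leaf_plane: "q \<in> Rtilde \<Longrightarrow> planar q \<in> leaf_plane (level q)"
  by (simp add: leaf_plane_def)

lemma open_leaf_plane: "open (leaf_plane x)"
proof (cases "x > 0")
  case False
  then have "leaf_plane x = (if x = 0 then - {0} else {})"
    using leaf_plane_0 by (auto simp: leaf_plane_def Rtilde_iff)
  then show ?thesis by auto
qed (simp add: leaf_plane_pos)

lemma connected_leaf_plane: "connected (leaf_plane x)"
proof (cases "x > 0")
  case False
  then have "leaf_plane x = (if x = 0 then - {0} else {})"
    using leaf_plane_0 by (auto simp: leaf_plane_def Rtilde_iff)
  then show ?thesis using connected_punctured_universe[of "0 :: complex \<times> complex"] by auto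
qed (simp add: leaf_plane_pos connected_UNIV)

lemma leaf_tilde_eq: "leaf_tilde x = at_level x ` leaf_plane x"
proof
  show "leaf_tilde x \<subseteq> at_level x ` leaf_plane x"
  proof
    fix q assume "q \<in> leaf_tilde x"
    then have q: "q \<in> Rtilde" "level q = x" by (auto simp: leaf_tilde_def)
    then have "q = at_level x (planar q)" by (simp add: at_level_planarI)
    moreover have "planar q \<in> leaf_plane x" using planar_in_leaf_plane[OF q(1)] q(2) by simp
    ultimately show "q \<in> at_level x ` leaf_plane x" by blast
  qed
qed (auto simp: leaf_tilde_def leaf_plane_def)

lemma continuous_at_level: "continuous_on S (at_level x)"
  unfolding at_level_def by (intro continuous_intros)

lemma connected_leaf_tilde: "connected (leaf_tilde x)"
  unfolding leaf_tilde_eq by (rule connected_continuous_image[OF continuous_at_level connected_leaf_plane])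

text \<open>\<open>Rtilde\<close> is star-shaped with respect to every interior point: a segment from such a point
  can meet the removed boundary point only at its end.\<close>

lemma starlike_Rtilde: "starlike Rtilde"
  unfolding starlike_def
proof (intro bexI[of _ "(0, 0, 1)"] ballI subsetI)
  fix q r assume q: "q \<in> Rtilde" and r: "r \<in> closed_segment (0, 0, 1) q"
  then obtain u where u: "0 \<le> u" "u \<le> 1" "r = (1 - u) *\<^sub>R (0, 0, 1) + u *\<^sub>R q"
    by (auto simp: closed_segment_def)
  show "r \<in> Rtilde"
  proof (cases "u = 1")
    case False
    then have "level r > 0" using u q by (auto simp: Rtilde_iff add_pos_nonneg)
    then show ?thesis by (auto simp: Rtilde_iff)
  qed (use u q in \<open>simp flip: zero_prod_def\<close>)
qed (simp add: Rtilde_iff zero_prod_def)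

lemma simply_connected_Rtilde: "simply_connected Rtilde"
  by (rule starlike_imp_simply_connected[OF starlike_Rtilde])

lemma connected_Rtilde: "connected Rtilde"
  by (rule starlike_imp_connected[OF starlike_Rtilde])

lemma locally_path_connected_Rtilde: "locally path_connected Rtilde"
proof (rule locally_open_subset)
  have "convex {q :: point. level q \<ge> 0}"
    by (auto simp: convex_def)
  then show "locally path_connected {q :: point. level q \<ge> 0}"
    by (rule convex_imp_locally_path_connected)
  have "Rtilde = {q. level q \<ge> 0} - {0}"
    by (auto simp: Rtilde_iff)
  moreover have "openin (top_of_set L) (L - {0})" for L :: "point set"
    by (simp add: openin_delete)
  ultimately show "openin (top_of_set {q. level q \<ge> 0}) Rtilde"
    by metis
qed

text \<open>The regularity that deck transformations and lifts of automorphisms have in common. Bijectivity is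
  left out, so that the notion is stable under composition and can be checked for a lift before its
  inverse is known.\<close>

definition leafwise :: "(point \<Rightarrow> point) \<Rightarrow> bool" where
  "leafwise F \<longleftrightarrow> smooth_on Rtilde F \<and> F ` Rtilde \<subseteq> Rtilde \<and>
     (\<forall>q\<in>Rtilde. \<forall>r\<in>Rtilde. level q = level r \<longrightarrow> level (F q) = level (F r)) \<and>
     (\<forall>x\<ge>0. holomorphic2_on (\<lambda>w. planar (F (at_level x w))) (leaf_plane x))"

lemma leafwise_Rtilde: "leafwise F \<Longrightarrow> q \<in> Rtilde \<Longrightarrow> F q \<in> Rtilde"
  unfolding leafwise_def by blast

lemma leafwise_level: "leafwise F \<Longrightarrow> q \<in> Rtilde \<Longrightarrow> r \<in> Rtilde \<Longrightarrow> level q = level r \<Longrightarrow>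
    level (F q) = level (F r)"
  unfolding leafwise_def by blast

lemma leafwise_continuous_on: "leafwise F \<Longrightarrow> continuous_on Rtilde F"
  unfolding leafwise_def using smooth_on_imp_continuous_on by blast

lemma leafwise_holomorphic:
  "leafwise F \<Longrightarrow> x \<ge> 0 \<Longrightarrow> holomorphic2_on (\<lambda>w. planar (F (at_level x w))) (leaf_plane x)"
  unfolding leafwise_def by blast

lemma leafwise_id: "leafwise (\<lambda>q. q)"
  unfolding leafwise_def
  by (auto intro!: smooth_on_id simp: holomorphic2_on_iff_cdiff cdiff_intros)

lemma leafwise_compose:
  assumes "leafwise F" "leafwise G"
  shows "leafwise (\<lambda>q. G (F q))"
  unfolding leafwise_def
proof (intro conjI ballI allI impI)
  show "smooth_on Rtilde (\<lambda>q. G (F q))"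
    using assms by (intro smooth_on_compose[of Rtilde F Rtilde G]) (auto simp: leafwise_def)
  fix x :: real assume x: "x \<ge> 0"
  show "holomorphic2_on (\<lambda>w. planar (G (F (at_level x w)))) (leaf_plane x)"
  proof (cases "leaf_plane x = {}")
    case False
    then obtain w0 where w0: "w0 \<in> leaf_plane x" by blast
    define y where "y = level (F (at_level x w0))"
    have lev: "level (F (at_level x w)) = y" if "w \<in> leaf_plane x" for w
      unfolding y_def using w0 that by (intro leafwise_level[OF assms(1)]) (auto simp: at_level_in_Rtilde)
    have F: "F (at_level x w) \<in> Rtilde" if "w \<in> leaf_plane x" for w
      using that leafwise_Rtilde[OF assms(1)] by (simp add: at_level_in_Rtilde)
    have y: "y \<ge> 0" using F[OF w0] by (simp add: y_def Rtilde_iff)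
    have "holomorphic2_on (\<lambda>w. (\<lambda>v. planar (G (at_level y v))) (planar (F (at_level x w)))) (leaf_plane x)"
      by (rule holomorphic2_on_compose[OF leafwise_holomorphic[OF assms(1) x] leafwise_holomorphic[OF assms(2) y]])
        (use F lev planar_in_leaf_plane in fastforce)
    then show ?thesis
      by (rule holomorphic2_on_cong[OF open_leaf_plane]) (metis lev at_level_planarI)
  qed (simp add: holomorphic2_on_def)
next
  show "(\<lambda>q. G (F q)) ` Rtilde \<subseteq> Rtilde"
    using assms leafwise_Rtilde by blast
  show "level (G (F q)) = level (G (F r))" if "q \<in> Rtilde" "r \<in> Rtilde" "level q = level r" for q r
    by (intro leafwise_level[OF assms(2)] leafwise_Rtilde[OF assms(1)] leafwise_level[OF assms(1)] that)
qed

locale reeb_component = holonomy +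
  fixes \<mu> :: complex and p :: nat
  assumes mu: "norm \<mu> > 1" and p: "p \<ge> 2"
begin

abbreviation T :: "point \<Rightarrow> point" where "T \<equiv> reeb_T \<mu> p \<phi>"

definition Tinv :: "point \<Rightarrow> point" where
  "Tinv q = ((fst q - (fst (snd q) / \<mu>) ^ p) / \<mu> ^ p, fst (snd q) / \<mu>, psi (level q))"

lemma mu_nz: "\<mu> \<noteq> 0"
  using mu by auto

lemma T_eq: "T q = (\<mu> ^ p * fst q + fst (snd q) ^ p, \<mu> * fst (snd q), \<phi> (level q))"
  by (cases q) simp

lemma T_Tinv: "q \<in> Rtilde \<Longrightarrow> T (Tinv q) = q"
  using mu_nz by (cases q) (simp add: Tinv_def Rtilde_iff phi_psi)

lemma Tinv_T: "q \<in> Rtilde \<Longrightarrow> Tinv (T q) = q"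
  using mu_nz by (cases q) (simp add: Tinv_def Rtilde_iff psi_phi)

lemma T_Rtilde: "q \<in> Rtilde \<Longrightarrow> T q \<in> Rtilde"
proof -
  assume q: "q \<in> Rtilde"
  then have l: "level q \<ge> 0" by (simp add: Rtilde_iff)
  have "q = 0" if "T q = 0"
  proof -
    have z: "\<mu> ^ p * fst q + fst (snd q) ^ p = 0" "\<mu> * fst (snd q) = 0" "\<phi> (level q) = 0"
      using that unfolding T_eq by (auto simp: zero_prod_def)
    then have "fst (snd q) = 0" "level q = 0"
      using mu_nz l phi_pos[of "level q"] by (auto simp: less_le)
    then show ?thesis using z mu_nz p by (auto simp: prod_eq_iff power_0_left)
  qed
  then show ?thesis using q l by (auto simp: Rtilde_iff T_eq phi_nonneg)
qed

lemma Tinv_Rtilde: "q \<in> Rtilde \<Longrightarrow> Tinv q \<in> Rtilde"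
proof -
  assume q: "q \<in> Rtilde"
  then have l: "level q \<ge> 0" by (simp add: Rtilde_iff)
  have "T 0 = 0" using p phi_0 by (simp add: T_eq zero_prod_def)
  then have "Tinv q \<noteq> 0" using T_Tinv[OF q] q by (auto simp: Rtilde_iff)
  then show ?thesis using l by (simp add: Rtilde_iff Tinv_def psi_nonneg)
qed

lemma leafwise_T: "leafwise T"
  unfolding leafwise_def
proof (intro conjI ballI allI impI)
  show "smooth_on Rtilde T"
    unfolding T_eq
    by (intro smooth_on_intros smooth_on_compose[OF _ phi_smooth]) (auto simp: Rtilde_iff)
  show "T ` Rtilde \<subseteq> Rtilde" using T_Rtilde by blast
  show "holomorphic2_on (\<lambda>w. planar (T (at_level x w))) (leaf_plane x)" for x
    by (auto simp: holomorphic2_on_iff_cdiff T_eq planar_def at_level_def intro!: cdiff_intros)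
qed (simp add: T_eq)

lemma leafwise_Tinv: "leafwise Tinv"
  unfolding leafwise_def
proof (intro conjI ballI allI impI)
  have "smooth_on Rtilde (\<lambda>q. ((fst q - (fst (snd q) * inverse \<mu>) ^ p) * inverse (\<mu> ^ p),
      fst (snd q) * inverse \<mu>, psi (level q)))"
    by (intro smooth_on_intros smooth_on_compose[OF _ psi_smooth]) (auto simp: Rtilde_iff)
  then show "smooth_on Rtilde Tinv"
    unfolding Tinv_def by (simp add: divide_inverse)
  show "Tinv ` Rtilde \<subseteq> Rtilde" using Tinv_Rtilde by blast
  show "holomorphic2_on (\<lambda>w. planar (Tinv (at_level x w))) (leaf_plane x)" for x
    by (auto simp: holomorphic2_on_iff_cdiff Tinv_def planar_def at_level_def intro!: cdiff_intros)
qed (simp add: Tinv_def)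

text \<open>In this form the shear of \<open>z1\<close> under the \<open>n\<close>-th iterate is linear in \<open>n\<close> and is dominated by the
  exponential factors.\<close>

lemma T_pow: "(T ^^ n) q = ((\<mu> ^ p) ^ n * (fst q + of_nat n * (fst (snd q) / \<mu>) ^ p),
    \<mu> ^ n * fst (snd q), (\<phi> ^^ n) (level q))"
proof (induction n)
  case (Suc n)
  have "(\<mu> ^ n * fst (snd q)) ^ p = \<mu> ^ p * (\<mu> ^ p) ^ n * (fst (snd q) / \<mu>) ^ p"
    using mu_nz by (simp add: power_mult_distrib power_divide flip: power_mult) (simp add: mult.commute)
  moreover have "(T ^^ Suc n) q = T ((T ^^ n) q)" by simp
  ultimately show ?case
    unfolding Suc.IH T_eq[of "(_, _)"] by (simp add: algebra_simps)
qed simp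

subsection \<open>The group of deck transformations\<close>

text \<open>The integral powers of \<open>T\<close>; as \<open>Tinv\<close> inverts \<open>T\<close> on \<open>Rtilde\<close> only, they form a group there.\<close>

definition deck :: "int \<Rightarrow> point \<Rightarrow> point" where
  "deck k = (if k \<ge> 0 then T ^^ nat k else Tinv ^^ nat (- k))"

lemma leafwise_deck: "leafwise (deck k)"
proof -
  have "leafwise (F ^^ n)" if "leafwise F" for F n
    using that by (induction n) (auto simp: o_def id_def intro: leafwise_id leafwise_compose)
  then show ?thesis unfolding deck_def using leafwise_T leafwise_Tinv by auto
qed

lemma deck_Rtilde: "q \<in> Rtilde \<Longrightarrow> deck k q \<in> Rtilde"
  by (rule leafwise_Rtilde[OF leafwise_deck])

lemma deck_0 [simp]: "deck 0 q = q"
  by (simp add: deck_def)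

lemma deck_of_nat: "deck (int n) q = (T ^^ n) q"
  by (simp add: deck_def)

lemma T_deck:
  assumes "q \<in> Rtilde"
  shows "T (deck k q) = deck (k + 1) q"
proof (cases "k \<ge> 0")
  case True
  then have "nat (k + 1) = Suc (nat k)" by simp
  with True show ?thesis by (simp add: deck_def)
next
  case False
  then have s: "nat (- k) = Suc (nat (- (k + 1)))" by simp
  have "deck k q = Tinv (deck (k + 1) q)"
    using False by (auto simp: deck_def s)
  then show ?thesis by (simp add: T_Tinv deck_Rtilde assms)
qed

lemma deck_add:
  assumes "q \<in> Rtilde"
  shows "deck j (deck k q) = deck (j + k) q"
proof (induction j rule: int_induct[where k = 0])
  case (step1 i)
  have "deck (i + 1) (deck k q) = T (deck i (deck k q))"
    using T_deck[OF deck_Rtilde[OF assms]] by simp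
  also have "\<dots> = deck (i + 1 + k) q"
    using T_deck[OF assms, of "i + k"] step1 by (simp add: algebra_simps)
  finally show ?case .
next
  case (step2 i)
  have "T (deck (i - 1) (deck k q)) = T (deck (i - 1 + k) q)"
    using T_deck[OF deck_Rtilde[OF assms], of "i - 1" k] T_deck[OF assms, of "i - 1 + k"] step2
    by (simp add: algebra_simps)
  then show ?case
    by (metis Tinv_T deck_Rtilde assms)
qed simp

lemma deck_minus: "q \<in> Rtilde \<Longrightarrow> deck (- k) (deck k q) = q"
  by (simp add: deck_add)

lemma orbit_rel_iff:
  "(q, r) \<in> orbit_rel T \<longleftrightarrow> q \<in> Rtilde \<and> r \<in> Rtilde \<and> (\<exists>k. deck k q = r)"
proof -
  have "(\<exists>n. (T ^^ n) q = r \<or> (T ^^ n) r = q) \<longleftrightarrow> (\<exists>k. deck k q = r)" if "q \<in> Rtilde" "r \<in> Rtilde"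
  proof
    assume "\<exists>n. (T ^^ n) q = r \<or> (T ^^ n) r = q"
    then obtain n where "deck (int n) q = r \<or> deck (int n) r = q"
      by (auto simp: deck_of_nat)
    then show "\<exists>k. deck k q = r" using deck_minus[OF that(2)] by metis
  next
    assume "\<exists>k. deck k q = r"
    then obtain k where k: "deck k q = r" by blast
    show "\<exists>n. (T ^^ n) q = r \<or> (T ^^ n) r = q"
    proof (cases "k \<ge> 0")
      case True
      then show ?thesis using k deck_of_nat[of "nat k" q] by auto
    next
      case False
      then show ?thesis using k deck_of_nat[of "nat (- k)" r] deck_minus[OF that(1), of k] by auto
    qed
  qed
  then show ?thesis unfolding orbit_rel_def mem_Collect_eq prod.case by blast
qed

lemma equiv_orbit_rel: "equiv Rtilde (orbit_rel T)"
proof (rule equivI)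
  show "orbit_rel T \<subseteq> Rtilde \<times> Rtilde" by (auto simp: orbit_rel_def)
  show "refl_on Rtilde (orbit_rel T)"
    by (auto simp: refl_on_def orbit_rel_iff intro: exI[of _ 0])
  show "sym (orbit_rel T)"
    by (auto simp: sym_def orbit_rel_def)
  show "trans (orbit_rel T)"
    unfolding trans_def orbit_rel_iff using deck_add by metis
qed

lemma proj_eq_iff:
  assumes "q \<in> Rtilde" "r \<in> Rtilde"
  shows "proj T q = proj T r \<longleftrightarrow> (\<exists>k. deck k q = r)"
  using eq_equiv_class_iff[OF equiv_orbit_rel assms] assms by (simp add: proj_def orbit_rel_iff)

lemma proj_deck [simp]: "q \<in> Rtilde \<Longrightarrow> proj T (deck k q) = proj T q"
  using proj_eq_iff[of q "deck k q"] deck_Rtilde by auto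

lemma proj_T [simp]: "q \<in> Rtilde \<Longrightarrow> proj T (T q) = proj T q"
  by (metis T_deck add_0 deck_0 proj_deck)

lemma reeb_eq: "reeb T = proj T ` Rtilde"
  by (auto simp: reeb_def quotient_def proj_def)

lemma proj_eq_deck_orbit:
  assumes q: "q \<in> Rtilde"
  shows "proj T q = range (\<lambda>k. deck k q)"
proof (rule Set.set_eqI)
  fix r
  show "r \<in> proj T q \<longleftrightarrow> r \<in> range (\<lambda>k. deck k q)"
    using orbit_rel_iff[of q r] deck_Rtilde[OF q] q by (auto simp: proj_def)
qed

subsection \<open>Proper discontinuity\<close>

text \<open>Above level \<open>0\<close> the transverse coordinate already separates the points of an orbit. On the
  boundary the modulus of \<open>z2\<close> does so if \<open>z2\<close> does not vanish; otherwise the modulus of \<open>z1\<close> grows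
  by a factor that beats the contribution of a small \<open>z2\<close>.\<close>

lemma wandering_pos:
  assumes "a \<in> Rtilde"
  shows "\<exists>A. open A \<and> a \<in> A \<and> (\<forall>r\<in>A \<inter> Rtilde. \<forall>n\<ge>1. (T ^^ n) r \<notin> A)"
proof (cases "level a > 0")
  case True
  define x where "x = level a"
  have x: "x > 0" using True by (simp add: x_def)
  have "psi x < x" using psi_less[OF x] .
  define l where "l = (psi x + x) / 2"
  have l: "psi x < l" "l < x" "l > 0" using \<open>psi x < x\<close> psi_pos[OF x] by (auto simp: l_def)
  have "\<phi> l > x" using phi_strict_mono[of "psi x" l] l psi_nonneg[of x] x phi_psi[of x] by simp
  define A :: "point set" where "A = {q. level q \<in> {l<..<\<phi> l}}"
  have "open A"
    unfolding A_def greaterThanLessThan_iff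
    by (intro open_Collect_conj open_Collect_less continuous_intros)
  moreover have "a \<in> A" using l \<open>\<phi> l > x\<close> by (simp add: A_def x_def)
  moreover have "(T ^^ n) r \<notin> A" if r: "r \<in> A \<inter> Rtilde" "n \<ge> 1" for r n
  proof
    assume "(T ^^ n) r \<in> A"
    then have "(\<phi> ^^ n) (level r) < \<phi> l" by (simp add: A_def T_pow)
    moreover have "\<phi> l \<le> \<phi> (level r)" using r l by (intro phi_mono) (auto simp: A_def)
    moreover have "\<phi> (level r) \<le> (\<phi> ^^ n) (level r)"
      using phi_pow_ge[of "level r" 1 n] r by (simp add: Rtilde_iff)
    ultimately show False by linarith
  qed
  ultimately show ?thesis by blast
next
  case False
  define z1 z2 where "z1 = fst a" and "z2 = fst (snd a)"
  have z: "z1 \<noteq> 0 \<or> z2 \<noteq> 0"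
    using False assms by (cases a) (auto simp: z1_def z2_def Rtilde_def)
  show ?thesis
  proof (cases "z2 = 0")
    case False
    define m where "m = norm z2 * 2 / (1 + norm \<mu>)"
    have m: "m > 0" "m < norm z2" "norm z2 < norm \<mu> * m"
      using False mu by (auto simp: m_def field_simps)
    define A :: "point set" where "A = {q. m < norm (fst (snd q)) \<and> norm (fst (snd q)) < norm \<mu> * m}"
    have "open A"
      unfolding A_def by (intro open_Collect_conj open_Collect_less continuous_intros)
    moreover have "a \<in> A" using m by (simp add: A_def z2_def)
    moreover have "(T ^^ n) r \<notin> A" if r: "r \<in> A \<inter> Rtilde" "n \<ge> 1" for r n
    proof
      assume "(T ^^ n) r \<in> A"
      then have 1: "norm \<mu> ^ n * norm (fst (snd r)) < norm \<mu> * m"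
        by (simp add: A_def T_pow norm_mult norm_power)
      have "norm \<mu> ^ 1 \<le> norm \<mu> ^ n"
        using mu r(2) by (intro power_increasing) auto
      then have "norm \<mu> * m \<le> norm \<mu> ^ n * norm (fst (snd r))"
        using r(1) m by (intro mult_mono) (auto simp: A_def)
      with 1 show False by linarith
    qed
    ultimately show ?thesis by blast
  next
    case True
    with z have z1: "norm z1 > 0" by simp
    define Lam where "Lam = norm \<mu> ^ p"
    have lam: "Lam > 1" using mu p by (simp add: Lam_def)
    \<comment> \<open>The annulus \<open>m < norm z1 < M\<close> is so thin that Bernoulli's inequality carries every point out of it,
      even after the shear is subtracted.\<close>
    define s where "s = 1 + (Lam - 1) / 4"
    have s: "1 < s" "s < 1 + (Lam - 1) / 2" using lam by (auto simp: s_def)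
    define m where "m = norm z1 / s"
    define M where "M = m * (1 + (Lam - 1) / 2)"
    have m: "m > 0" "m < norm z1" "norm z1 < M"
    proof -
      show "m > 0" "m < norm z1" using z1 s by (auto simp: m_def divide_less_eq)
      have "norm z1 = m * s" using s by (simp add: m_def)
      also have "\<dots> < M" unfolding M_def using s \<open>m > 0\<close> by (intro mult_strict_left_mono) auto
      finally show "norm z1 < M" .
    qed
    define \<delta> where "\<delta> = min 1 (m * (Lam - 1) / 2)"
    have d: "\<delta> > 0" "\<delta> \<le> 1" "\<delta> \<le> m * (Lam - 1) / 2" using m lam by (auto simp: \<delta>_def)
    have "\<delta> ^ p \<le> \<delta> ^ 1" using d p by (intro power_decreasing) auto
    then have dp: "\<delta> ^ p \<le> m * (Lam - 1) / 2" using d by simp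
    define A :: "point set" where
      "A = {q. m < norm (fst q) \<and> norm (fst q) < M \<and> norm (fst (snd q)) < \<delta>}"
    have "open A"
      unfolding A_def by (intro open_Collect_conj open_Collect_less continuous_intros)
    moreover have "a \<in> A" using m d True by (simp add: A_def z1_def z2_def)
    moreover have "(T ^^ n) r \<notin> A" if r: "r \<in> A \<inter> Rtilde" "n \<ge> 1" for r n
    proof
      assume s: "(T ^^ n) r \<in> A"
      define w1 w2 where "w1 = fst r" and "w2 = fst (snd r)"
      have w2: "norm (\<mu> ^ n * w2) < \<delta>" using s by (simp add: A_def T_pow w2_def)
      have "(\<mu> ^ p) ^ n * (of_nat n * (w2 / \<mu>) ^ p) = of_nat n * (\<mu> ^ n * w2) ^ p / \<mu> ^ p"
        by (simp add: power_mult_distrib power_divide mult_ac flip: power_mult)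
      then have "norm ((\<mu> ^ p) ^ n * (of_nat n * (w2 / \<mu>) ^ p)) = real n * norm (\<mu> ^ n * w2) ^ p / Lam"
        by (simp add: norm_mult norm_divide norm_power Lam_def)
      also have "\<dots> \<le> real n * norm (\<mu> ^ n * w2) ^ p / 1"
        using lam by (intro divide_left_mono) auto
      also have "\<dots> \<le> real n * \<delta> ^ p"
        using w2 by (auto intro!: mult_left_mono power_mono)
      finally have b: "norm ((\<mu> ^ p) ^ n * (of_nat n * (w2 / \<mu>) ^ p)) \<le> real n * (m * (Lam - 1) / 2)"
        using dp by (meson mult_left_mono of_nat_0_le_iff order_trans)
      have "norm ((\<mu> ^ p) ^ n * w1 + (\<mu> ^ p) ^ n * (of_nat n * (w2 / \<mu>) ^ p)) < M"
        using s by (simp add: A_def T_pow w1_def w2_def algebra_simps)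
      then have u: "Lam ^ n * norm w1 - real n * (m * (Lam - 1) / 2) < M"
        using b norm_diff_ineq[of "(\<mu> ^ p) ^ n * w1" "(\<mu> ^ p) ^ n * (of_nat n * (w2 / \<mu>) ^ p)"]
        by (simp add: norm_mult norm_power Lam_def)
      have "Lam ^ n * m \<le> Lam ^ n * norm w1"
        using r(1) lam by (intro mult_left_mono) (auto simp: A_def w1_def)
      moreover have "(1 + real n * (Lam - 1)) * m \<le> Lam ^ n * m"
        using Bernoulli_inequality[of "Lam - 1" n] lam m by (intro mult_right_mono) auto
      ultimately have "(1 + real n * (Lam - 1)) * m - real n * (m * (Lam - 1) / 2) < M"
        using u by linarith
      moreover have "(1 + real n * (Lam - 1)) * m = m + 2 * (real n * (m * (Lam - 1) / 2))"
        "M = m + 1 * (m * (Lam - 1) / 2)"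
        by (simp_all add: M_def field_simps)
      ultimately have "real n * (m * (Lam - 1) / 2) < 1 * (m * (Lam - 1) / 2)" by linarith
      then have "real n < 1" using m lam by (subst (asm) mult_less_cancel_right_pos) auto
      then show False using r(2) by simp
    qed
    ultimately show ?thesis by blast
  qed
qed

lemma wandering:
  assumes "a \<in> Rtilde"
  obtains A where "open A" "a \<in> A" "\<And>r k. r \<in> A \<Longrightarrow> r \<in> Rtilde \<Longrightarrow> deck k r \<in> A \<Longrightarrow> k = 0"
proof -
  obtain A where A: "open A" "a \<in> A" "\<And>r n. r \<in> A \<inter> Rtilde \<Longrightarrow> n \<ge> 1 \<Longrightarrow> (T ^^ n) r \<notin> A"
    using wandering_pos[OF assms] by blast
  have A3: "k = 0" if "r \<in> A" "r \<in> Rtilde" "deck k r \<in> A" for r k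
  proof (rule ccontr)
    assume "k \<noteq> 0"
    then consider "k > 0" | "k < 0" by linarith
    then show False
    proof cases
      case 1
      then show False using A(3)[of r "nat k"] that deck_of_nat[of "nat k" r] by simp
    next
      case 2
      then show False
        using A(3)[of "deck k r" "nat (- k)"] that deck_of_nat[of "nat (- k)" "deck k r"]
          deck_minus[of r k] deck_Rtilde[of r k] by (simp add: Suc_le_eq)
    qed
  qed
  show ?thesis by (rule that[OF A(1,2) A3])
qed

lemma deck_free: "q \<in> Rtilde \<Longrightarrow> deck j q = deck k q \<Longrightarrow> j = k"
proof -
  assume q: "q \<in> Rtilde" "deck j q = deck k q"
  have "deck (- k + j) q = q" using q deck_minus[of q k] deck_add[of q "- k" j] by simp
  then have "- k + j = 0" using wandering[OF q(1)] q(1) by metis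
  then show "j = k" by simp
qed

text \<open>Nearby points of one orbit are equal, so the set where the two lifts agree is open as well as
  closed.\<close>

lemma lift_unique:
  fixes F G :: "'a::topological_space \<Rightarrow> point"
  assumes "connected X" "continuous_on X F" "continuous_on X G"
    and "\<And>x. x \<in> X \<Longrightarrow> F x \<in> Rtilde" "\<And>x. x \<in> X \<Longrightarrow> G x \<in> Rtilde"
    and "\<And>x. x \<in> X \<Longrightarrow> proj T (F x) = proj T (G x)"
    and "x0 \<in> X" "F x0 = G x0" "x \<in> X"
  shows "F x = G x"
proof -
  define E where "E = {x \<in> X. F x = G x}"
  have "closedin (top_of_set X) {x \<in> X. F x - G x = 0}"
    by (intro continuous_closedin_preimage_constant continuous_intros assms)
  then have "closedin (top_of_set X) E"
    by (simp add: E_def)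
  moreover have "openin (top_of_set X) E"
  proof (subst openin_subopen, intro ballI)
    fix y assume y: "y \<in> E"
    then have yX: "y \<in> X" and FG: "F y = G y" by (auto simp: E_def)
    obtain A where A: "open A" "F y \<in> A" "\<And>r k. r \<in> A \<Longrightarrow> r \<in> Rtilde \<Longrightarrow> deck k r \<in> A \<Longrightarrow> k = 0"
      using wandering[OF assms(4)[OF yX]] by metis
    define V where "V = (X \<inter> F -` A) \<inter> (X \<inter> G -` A)"
    have "openin (top_of_set X) V"
      unfolding V_def by (intro openin_Int continuous_openin_preimage_gen assms A)
    moreover have "y \<in> V" using A FG yX by (simp add: V_def)
    moreover have "V \<subseteq> E"
    proof
      fix z assume z: "z \<in> V"
      then have zX: "z \<in> X" and zA: "F z \<in> A" "G z \<in> A" by (auto simp: V_def)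
      obtain k where k: "deck k (F z) = G z"
        using proj_eq_iff[OF assms(4)[OF zX] assms(5)[OF zX]] assms(6)[OF zX] by blast
      then have "k = 0" using A(3)[OF zA(1) assms(4)[OF zX]] zA by simp
      then show "z \<in> E" using k zX by (simp add: E_def)
    qed
    ultimately show "\<exists>V. openin (top_of_set X) V \<and> y \<in> V \<and> V \<subseteq> E" by blast
  qed
  ultimately have "E = X"
    using assms(1,7,8) by (auto simp: connected_clopen E_def)
  then show ?thesis using assms(9) by (auto simp: E_def)
qed

end

context reeb_component
begin

section \<open>Lifting automorphisms to the covering\<close>

lemma reeb_smoothE:
  assumes "reeb_smooth T f" "q \<in> Rtilde"
  obtains U F where "open U" "q \<in> U" "smooth_on (U \<inter> Rtilde) F"
    "\<And>r. r \<in> U \<inter> Rtilde \<Longrightarrow> F r \<in> Rtilde"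
    "\<And>r. r \<in> U \<inter> Rtilde \<Longrightarrow> f (proj T r) = proj T (F r)"
proof -
  obtain U F where "open U \<and> q \<in> U \<and> smooth_on (U \<inter> Rtilde) F \<and> F ` (U \<inter> Rtilde) \<subseteq> Rtilde \<and>
      (\<forall>r\<in>U \<inter> Rtilde. f (proj T r) = proj T (F r))"
    using assms(1)[unfolded reeb_smooth_def, rule_format, OF assms(2)] by (elim exE)
  then show ?thesis by (intro that[of U F]) blast+
qed

text \<open>The pairs \<open>(q, r)\<close> such that the orbit of \<open>r\<close> is the image of the orbit of \<open>q\<close> form a covering
  space of \<open>Rtilde\<close>, the pullback along \<open>f\<close> of the covering \<open>Rtilde \<rightarrow> R\<close>. Working with this pullback
  avoids a topology on the set of orbits. Since \<open>Rtilde\<close> is simply connected, the pullback has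
  a section through any given point.\<close>

lemma covering_space_pullback:
  assumes f: "\<And>P. P \<in> reeb T \<Longrightarrow> f P \<in> reeb T" and smooth: "reeb_smooth T f"
  defines "E \<equiv> {(q, r). q \<in> Rtilde \<and> r \<in> Rtilde \<and> f (proj T q) = proj T r}"
  shows "covering_space E fst Rtilde"
  unfolding covering_space_def
proof (intro conjI ballI)
  show "continuous_on E fst" by (intro continuous_intros)
  have "\<exists>r. (q, r) \<in> E" if "q \<in> Rtilde" for q
    using f[of "proj T q"] that by (auto simp: E_def reeb_eq)
  moreover have "fst ` E \<subseteq> Rtilde" by (auto simp: E_def)
  ultimately show "fst ` E = Rtilde"
    by (metis fst_conv image_eqI subsetI subset_antisym)
  fix q0 assume q0: "q0 \<in> Rtilde"
  obtain U F where U: "open U" "q0 \<in> U" and smF: "smooth_on (U \<inter> Rtilde) F"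
    and FR: "\<And>r. r \<in> U \<inter> Rtilde \<Longrightarrow> F r \<in> Rtilde"
    and fF: "\<And>r. r \<in> U \<inter> Rtilde \<Longrightarrow> f (proj T r) = proj T (F r)"
    by (rule reeb_smoothE[OF smooth q0]) blast
  define N where "N = U \<inter> Rtilde"
  define sheet where "sheet k = (\<lambda>r. (r, deck k (F r))) ` N" for k
  have cont: "continuous_on N (\<lambda>r. deck k (F r))" for k
    unfolding N_def
    by (rule continuous_on_compose2[OF leafwise_continuous_on[OF leafwise_deck]
          smooth_on_imp_continuous_on[OF smF] image_subsetI[OF FR]])
  have E_iff: "(r, s) \<in> E \<longleftrightarrow> (\<exists>k. s = deck k (F r))" if "r \<in> N" for r s
    using that FR[of r] fF[of r] proj_eq_iff[of "F r" s] deck_Rtilde[of "F r"]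
    by (auto simp: E_def N_def)
  show "\<exists>N. q0 \<in> N \<and> openin (top_of_set Rtilde) N \<and>
      (\<exists>v. \<Union> v = E \<inter> fst -` N \<and> (\<forall>u\<in>v. openin (top_of_set E) u) \<and> pairwise disjnt v \<and>
         (\<forall>u\<in>v. \<exists>q. homeomorphism u N fst q))"
  proof (intro exI[of _ N] conjI exI[of _ "range sheet"] ballI)
    show "q0 \<in> N" using U q0 by (simp add: N_def)
    show "openin (top_of_set Rtilde) N"
      unfolding N_def using U(1) by (simp add: Int_commute openin_open_Int)
    show "\<Union> (range sheet) = E \<inter> fst -` N"
    proof (intro Set.set_eqI)
      fix v :: "point \<times> point"
      show "v \<in> \<Union> (range sheet) \<longleftrightarrow> v \<in> E \<inter> fst -` N"
        using E_iff[of "fst v" "snd v"] by (cases v) (auto simp: sheet_def)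
    qed
    show "pairwise disjnt (range sheet)"
    proof (rule pairwiseI)
      fix u v assume uv: "u \<in> range sheet" "v \<in> range sheet" "u \<noteq> v"
      show "disjnt u v"
        unfolding disjnt_iff
      proof (intro allI notI)
        fix x assume x: "x \<in> u \<and> x \<in> v"
        obtain j k where jk: "u = sheet j" "v = sheet k" using uv by blast
        with x have "deck j (F (fst x)) = deck k (F (fst x))" "fst x \<in> N"
          by (auto simp: sheet_def)
        then have "j = k" using deck_free[OF FR, of "fst x" j k] by (simp add: N_def)
        with uv jk show False by simp
      qed
    qed
    fix u assume "u \<in> range sheet"
    then obtain k where u: "u = sheet k" by blast
    show "\<exists>g. homeomorphism u N fst g"
      unfolding u sheet_def
      by (intro exI[of _ "\<lambda>r. (r, deck k (F r))"] homeomorphismI continuous_intros cont)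
        (auto intro: continuous_on_subset)
    show "openin (top_of_set E) u"
    proof (subst openin_subopen, intro ballI)
      fix v assume v: "v \<in> u"
      then obtain r where r: "r \<in> N" "v = (r, deck k (F r))" by (auto simp: u sheet_def)
      define s where "s = deck k (F r)"
      have s: "s \<in> Rtilde" using r FR deck_Rtilde by (auto simp: s_def N_def)
      obtain A where A: "open A" "s \<in> A" "\<And>r k. r \<in> A \<Longrightarrow> r \<in> Rtilde \<Longrightarrow> deck k r \<in> A \<Longrightarrow> k = 0"
        using wandering[OF s] by metis
      have "openin (top_of_set N) (N \<inter> (\<lambda>r. deck k (F r)) -` A)"
        by (rule continuous_openin_preimage_gen[OF cont A(1)])
      then obtain O1 where O1: "open O1" "N \<inter> (\<lambda>r. deck k (F r)) -` A = N \<inter> O1"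
        by (auto simp: openin_open)
      define V where "V = E \<inter> ((U \<inter> O1) \<times> A)"
      have "openin (top_of_set E) V"
        unfolding V_def using U(1) O1(1) A(1) by (auto intro!: openin_open_Int open_Times)
      moreover have "v \<in> V"
        using r A(2) O1(2) E_iff[OF r(1)] by (auto simp: V_def s_def N_def)
      moreover have "V \<subseteq> u"
      proof
        fix x assume x: "x \<in> V"
        define r' s' where "r' = fst x" and "s' = snd x"
        have x': "(r', s') \<in> E" "r' \<in> U" "r' \<in> O1" "s' \<in> A" using x by (auto simp: V_def r'_def s'_def)
        then have r'N: "r' \<in> N" by (auto simp: E_def N_def)
        then have "deck k (F r') \<in> A" using O1(2) x' by blast
        moreover obtain j where j: "s' = deck j (F r')" using E_iff[OF r'N] x'(1) by blast
        moreover have Fr: "F r' \<in> Rtilde" using FR r'N by (simp add: N_def)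
        have "s' = deck (j - k) (deck k (F r'))" using j by (simp add: deck_add[OF Fr])
        ultimately have "j - k = 0"
          using A(3)[of "deck k (F r')" "j - k"] x'(4) deck_Rtilde[OF Fr] by simp
        then have "s' = deck k (F r')" using j by simp
        then show "x \<in> u" using r'N by (auto simp: u sheet_def r'_def s'_def image_iff prod_eq_iff)
      qed
      ultimately show "\<exists>V. openin (top_of_set E) V \<and> v \<in> V \<and> V \<subseteq> u" by blast
    qed
  qed
qed

lemma continuous_lift_exists:
  assumes f: "\<And>P. P \<in> reeb T \<Longrightarrow> f P \<in> reeb T" and smooth: "reeb_smooth T f"
    and q0: "q0 \<in> Rtilde" "r0 \<in> Rtilde" "f (proj T q0) = proj T r0"
  obtains F where "continuous_on Rtilde F" "\<And>q. q \<in> Rtilde \<Longrightarrow> F q \<in> Rtilde"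
    "\<And>q. q \<in> Rtilde \<Longrightarrow> proj T (F q) = f (proj T q)" "F q0 = r0"
proof -
  define E where "E = {(q, r). q \<in> Rtilde \<and> r \<in> Rtilde \<and> f (proj T q) = proj T r}"
  have cov: "covering_space E fst Rtilde"
    unfolding E_def by (rule covering_space_pullback[OF f smooth])
  obtain g where g: "continuous_on Rtilde g" "g \<in> Rtilde \<rightarrow> E" "g q0 = (q0, r0)"
    "\<And>y. y \<in> Rtilde \<Longrightarrow> fst (g y) = y"
  proof (rule covering_space_lift_strong[OF cov, of "(q0, r0)" q0 Rtilde "\<lambda>q. q"])
    show "(q0, r0) \<in> E" using q0 by (simp add: E_def)
  qed (use q0 simply_connected_Rtilde locally_path_connected_Rtilde in auto)
  show ?thesis
  proof (rule that[of "\<lambda>q. snd (g q)"])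
    show "continuous_on Rtilde (\<lambda>q. snd (g q))" by (intro continuous_intros g)
    fix q assume q: "q \<in> Rtilde"
    then have "g q \<in> E" "fst (g q) = q" using g by auto
    then show "snd (g q) \<in> Rtilde" "proj T (snd (g q)) = f (proj T q)"
      by (auto simp: E_def case_prod_beta)
  qed (simp add: g)
qed

text \<open>Any continuous lift inherits the regularity of local lifts, because near a point two lifts
  differ by a deck transformation.\<close>

lemma lift_agrees_locally:
  fixes F G :: "'a::topological_space \<Rightarrow> point"
  assumes "open V" "x0 \<in> V \<inter> X" "continuous_on (V \<inter> X) F" "continuous_on (V \<inter> X) G"
    and "\<And>x. x \<in> V \<inter> X \<Longrightarrow> F x \<in> Rtilde" "\<And>x. x \<in> V \<inter> X \<Longrightarrow> G x \<in> Rtilde"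
    and "\<And>x. x \<in> V \<inter> X \<Longrightarrow> proj T (F x) = proj T (G x)"
  obtains k W where "open W" "x0 \<in> W" "W \<subseteq> V" "\<And>x. x \<in> W \<inter> X \<Longrightarrow> F x = deck k (G x)"
proof -
  obtain k where k: "deck k (G x0) = F x0"
    using proj_eq_iff[OF assms(6,5)] assms(2,7) by metis
  obtain A where A: "open A" "F x0 \<in> A" "\<And>r k. r \<in> A \<Longrightarrow> r \<in> Rtilde \<Longrightarrow> deck k r \<in> A \<Longrightarrow> k = 0"
    using wandering[OF assms(5)[OF assms(2)]] by metis
  have cont: "continuous_on (V \<inter> X) (\<lambda>x. deck k (G x))"
    by (rule continuous_on_compose2[OF leafwise_continuous_on[OF leafwise_deck] assms(4)])
      (use assms(6) in auto)
  have "openin (top_of_set (V \<inter> X)) ((V \<inter> X \<inter> F -` A) \<inter> (V \<inter> X \<inter> (\<lambda>x. deck k (G x)) -` A))"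
    by (intro openin_Int continuous_openin_preimage_gen assms(3) cont A(1))
  then obtain O1 where O1: "open O1"
    "(V \<inter> X \<inter> F -` A) \<inter> (V \<inter> X \<inter> (\<lambda>x. deck k (G x)) -` A) = V \<inter> X \<inter> O1"
    by (auto simp: openin_open)
  show ?thesis
  proof (rule that[of "V \<inter> O1" k])
    show "x0 \<in> V \<inter> O1" using O1(2) assms(2) A(2) k by auto
    fix x assume "x \<in> V \<inter> O1 \<inter> X"
    then have x: "x \<in> V \<inter> X" "F x \<in> A" "deck k (G x) \<in> A" using O1(2) by auto
    obtain j where j: "deck j (G x) = F x"
      using proj_eq_iff[OF assms(6,5)] x(1) assms(7) by metis
    have "F x = deck (j - k) (deck k (G x))" using j by (simp add: deck_add assms(6)[OF x(1)])
    then have "j - k = 0"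
      using A(3)[of "deck k (G x)" "j - k"] x deck_Rtilde assms(6)[OF x(1)] by simp
    then show "F x = deck k (G x)" using j by simp
  qed (use O1(1) assms(1) in auto)
qed

lemma lift_smooth:
  assumes smooth: "reeb_smooth T f" and F: "continuous_on Rtilde F" "\<And>q. q \<in> Rtilde \<Longrightarrow> F q \<in> Rtilde"
    "\<And>q. q \<in> Rtilde \<Longrightarrow> proj T (F q) = f (proj T q)"
  shows "smooth_on Rtilde F"
proof (rule smooth_on_local)
  fix q assume q: "q \<in> Rtilde"
  obtain U G where U: "open U" "q \<in> U" and smG: "smooth_on (U \<inter> Rtilde) G"
    and GR: "\<And>r. r \<in> U \<inter> Rtilde \<Longrightarrow> G r \<in> Rtilde"
    and fG: "\<And>r. r \<in> U \<inter> Rtilde \<Longrightarrow> f (proj T r) = proj T (G r)"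
    by (rule reeb_smoothE[OF smooth q]) blast
  obtain k W where W: "open W" "q \<in> W" "W \<subseteq> U" "\<And>r. r \<in> W \<inter> Rtilde \<Longrightarrow> F r = deck k (G r)"
  proof (rule lift_agrees_locally[OF U(1), of q Rtilde F G])
    show "continuous_on (U \<inter> Rtilde) F" using F(1) continuous_on_subset by blast
    show "continuous_on (U \<inter> Rtilde) G" by (rule smooth_on_imp_continuous_on[OF smG])
  qed (use q U F GR fG in auto)
  have "smooth_on (W \<inter> Rtilde) (\<lambda>r. deck k (G r))"
  proof (rule smooth_on_compose[of _ G Rtilde])
    show "smooth_on (W \<inter> Rtilde) G" by (rule smooth_on_subset[OF smG]) (use W in auto)
    show "smooth_on Rtilde (deck k)" using leafwise_deck by (simp add: leafwise_def)
  qed (use W(3) GR in auto)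
  then have "smooth_on (W \<inter> Rtilde) F"
    by (rule smooth_on_cong) (use W in auto)
  then show "\<exists>U. open U \<and> q \<in> U \<and> smooth_on (U \<inter> Rtilde) F" using W by blast
qed

text \<open>Near each point of a leaf, \<open>F\<close> is a holomorphic map into a leaf followed by a deck transformation.
  The level of \<open>F\<close> is therefore locally constant on the leaf, which is connected.\<close>

lemma lift_leafwise:
  assumes smooth: "reeb_smooth T f"
    and leaf: "\<And>x. x \<ge> 0 \<Longrightarrow> \<exists>y\<ge>0. leaf_holomorphic T x y f"
    and F: "continuous_on Rtilde F" "\<And>q. q \<in> Rtilde \<Longrightarrow> F q \<in> Rtilde"
    "\<And>q. q \<in> Rtilde \<Longrightarrow> proj T (F q) = f (proj T q)"
  shows "leafwise F"
proof -
  have local: "\<exists>W g. open W \<and> w \<in> W \<and> W \<subseteq> leaf_plane x \<and> holomorphic2_on g W \<and>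
      (\<forall>v\<in>W. g v = planar (F (at_level x v))) \<and>
      (\<forall>v\<in>W. level (F (at_level x v)) = level (F (at_level x w)))"
    if x: "x \<ge> 0" and w: "w \<in> leaf_plane x" for x w
  proof -
    obtain y where y: "y \<ge> 0" "leaf_holomorphic T x y f" using leaf x by blast
    obtain W h where W: "open W" "w \<in> W" "W \<subseteq> leaf_plane x" "holomorphic2_on h W" "h ` W \<subseteq> leaf_plane y"
      "\<And>v. v \<in> W \<Longrightarrow> f (proj T (at_level x v)) = proj T (at_level y (h v))"
      using y(2) w unfolding leaf_holomorphic_def by metis
    obtain k V where V: "open V" "w \<in> V" "V \<subseteq> W"
      "\<And>v. v \<in> V \<inter> UNIV \<Longrightarrow> F (at_level x v) = deck k (at_level y (h v))"
    proof (rule lift_agrees_locally[OF W(1), of w UNIV "\<lambda>v. F (at_level x v)" "\<lambda>v. at_level y (h v)"])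
      show "continuous_on (W \<inter> UNIV) (\<lambda>v. F (at_level x v))"
        by (rule continuous_on_compose2[OF F(1) continuous_at_level]) (use W in \<open>auto simp: at_level_in_Rtilde\<close>)
      show "continuous_on (W \<inter> UNIV) (\<lambda>v. at_level y (h v))"
        by (rule continuous_on_compose2[OF continuous_at_level[of UNIV]])
          (use holomorphic2_on_continuous_on[OF W(4)] in auto)
      fix v assume "v \<in> W \<inter> UNIV"
      then have v: "v \<in> W" by simp
      then show "F (at_level x v) \<in> Rtilde"
        by (intro F(2)) (use W(3) in \<open>auto simp: at_level_in_Rtilde\<close>)
      show "at_level y (h v) \<in> Rtilde" using v W(5) by (auto simp: at_level_in_Rtilde)
      show "proj T (F (at_level x v)) = proj T (at_level y (h v))"
        using F(3)[of "at_level x v"] W(3,6) v by (auto simp: at_level_in_Rtilde)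
    qed (use W in auto)
    have hV: "holomorphic2_on h V" "h ` V \<subseteq> leaf_plane y"
      using holomorphic2_on_subset[OF W(4) V(3)] W(5) V(3) by auto
    have "holomorphic2_on (\<lambda>v. planar (deck k (at_level y (h v)))) V"
      using holomorphic2_on_compose[OF hV(1) leafwise_holomorphic[OF leafwise_deck y(1)] hV(2)] .
    moreover have "level (F (at_level x v)) = level (F (at_level x w))" if "v \<in> V" for v
      using V(4)[of v] V(4)[of w] that V(2) hV(2)
      by (auto intro!: leafwise_level[OF leafwise_deck] simp: at_level_in_Rtilde)
    moreover have "planar (deck k (at_level y (h v))) = planar (F (at_level x v))" if "v \<in> V" for v
      using V(4)[of v] that by simp
    moreover have "V \<subseteq> leaf_plane x" using V(3) W(3) by blast
    ultimately show ?thesis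
      using V(1,2) by (intro exI[of _ V] exI[of _ "\<lambda>v. planar (deck k (at_level y (h v)))"] conjI ballI)
  qed
  have hol: "holomorphic2_on (\<lambda>w. planar (F (at_level x w))) (leaf_plane x)" if "x \<ge> 0" for x
  proof (rule holomorphic2_on_local)
    fix w assume "w \<in> leaf_plane x"
    from local[OF \<open>x \<ge> 0\<close> this] obtain W g where "open W" "w \<in> W" "holomorphic2_on g W"
      "\<forall>v\<in>W. g v = planar (F (at_level x v))" by (elim exE conjE)
    then show "\<exists>V g. open V \<and> w \<in> V \<and> holomorphic2_on g V \<and> (\<forall>v\<in>V. g v = planar (F (at_level x v)))"
      by (intro exI conjI)
  qed
  have lev: "level (F q) = level (F r)" if qr: "q \<in> Rtilde" "r \<in> Rtilde" "level q = level r" for q r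
  proof -
    define x where "x = level q"
    have x: "x \<ge> 0" using qr by (simp add: x_def Rtilde_iff)
    define g where "g w = level (F (at_level x w))" for w
    have "g constant_on leaf_plane x"
    proof (rule locally_constant_imp_constant[OF connected_leaf_plane])
      fix w assume w: "w \<in> leaf_plane x"
      from local[OF x w] obtain W where W: "open W" "w \<in> W" "W \<subseteq> leaf_plane x" "\<forall>v\<in>W. g v = g w"
        unfolding g_def by (elim exE conjE)
      then show "\<exists>V. openin (top_of_set (leaf_plane x)) V \<and> w \<in> V \<and> (\<forall>v\<in>V. g v = g w)"
        using open_subset by blast
    qed
    moreover have "planar q \<in> leaf_plane x" "planar r \<in> leaf_plane x"
      using planar_in_leaf_plane[OF qr(1)] planar_in_leaf_plane[OF qr(2)] qr(3) by (simp_all add: x_def)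
    ultimately have "g (planar q) = g (planar r)" unfolding constant_on_def by metis
    then show ?thesis using qr by (metis g_def x_def at_level_planar)
  qed
  show ?thesis
    unfolding leafwise_def using hol lev F(2) lift_smooth[OF smooth F] by blast
qed

end

section \<open>Automorphisms and equivariant maps of the covering\<close>

lemma group_BijGroup_carrier:
  assumes sub: "K \<subseteq> Bij S" and one: "(\<lambda>x\<in>S. x) \<in> K"
    and comp: "\<And>f g. f \<in> K \<Longrightarrow> g \<in> K \<Longrightarrow> compose S f g \<in> K"
    and inv: "\<And>f. f \<in> K \<Longrightarrow> (\<lambda>x\<in>S. inv_into S f x) \<in> K"
  shows "group (BijGroup S\<lparr>carrier := K\<rparr>)"
proof -
  interpret B: group "BijGroup S" by (rule group_BijGroup)
  have "subgroup K (BijGroup S)"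
  proof (rule B.subgroupI)
    show "K \<subseteq> carrier (BijGroup S)" using sub by (simp add: BijGroup_def)
    show "K \<noteq> {}" using one by blast
    fix f assume f: "f \<in> K"
    then show "inv\<^bsub>BijGroup S\<^esub> f \<in> K" using inv sub by (auto simp: inv_BijGroup)
    fix g assume "g \<in> K"
    then show "f \<otimes>\<^bsub>BijGroup S\<^esub> g \<in> K"
      using f comp sub by (auto simp: BijGroup_def)
  qed
  then show ?thesis by (rule B.subgroup_imp_group)
qed

context reeb_component
begin

text \<open>The lifts of the elements of \<open>Aut(R,H)\<close>, each together with its inverse. A second map as the inverse
  avoids extensional functions and \<open>inv_into\<close> in all computations.\<close>

definition equivariant_pair :: "(point \<Rightarrow> point) \<Rightarrow> (point \<Rightarrow> point) \<Rightarrow> bool" where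
  "equivariant_pair F G \<longleftrightarrow> leafwise F \<and> leafwise G \<and>
     (\<forall>q\<in>Rtilde. G (F q) = q) \<and> (\<forall>q\<in>Rtilde. F (G q) = q) \<and>
     (\<forall>q\<in>Rtilde. F (T q) = T (F q)) \<and> (\<forall>q\<in>leaf_tilde 0. F q = q)"

definition induced :: "(point \<Rightarrow> point) \<Rightarrow> point set \<Rightarrow> point set" where
  "induced F = (\<lambda>P\<in>reeb T. F ` P)"

lemma leaf_tilde_sub: "q \<in> leaf_tilde x \<Longrightarrow> q \<in> Rtilde"
  by (simp add: leaf_tilde_def)

lemma equivariant_pairD:
  assumes "equivariant_pair F G"
  shows "leafwise F" "leafwise G" "\<And>q. q \<in> Rtilde \<Longrightarrow> G (F q) = q" "\<And>q. q \<in> Rtilde \<Longrightarrow> F (G q) = q"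
    "\<And>q. q \<in> Rtilde \<Longrightarrow> F (T q) = T (F q)" "\<And>q. q \<in> leaf_tilde 0 \<Longrightarrow> F q = q"
    "\<And>q. q \<in> Rtilde \<Longrightarrow> F q \<in> Rtilde" "\<And>q. q \<in> Rtilde \<Longrightarrow> G q \<in> Rtilde"
  using assms leafwise_Rtilde unfolding equivariant_pair_def by blast+

lemma equivariant_pair_sym:
  assumes FG: "equivariant_pair F G"
  shows "equivariant_pair G F"
proof -
  note D = equivariant_pairD[OF FG]
  have "G (T q) = T (G q)" if "q \<in> Rtilde" for q
  proof -
    have "G (T q) = G (T (F (G q)))" using that D(4) by simp
    also have "\<dots> = G (F (T (G q)))" using that D(5)[OF D(8)] by simp
    also have "\<dots> = T (G q)" using that D(3)[OF T_Rtilde[OF D(8)]] by simp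
    finally show ?thesis .
  qed
  moreover have "G q = q" if "q \<in> leaf_tilde 0" for q
    using D(3)[OF leaf_tilde_sub[OF that]] D(6)[OF that] by simp
  ultimately show ?thesis using D unfolding equivariant_pair_def by blast
qed

lemma equivariant_pair_compose:
  assumes "equivariant_pair F G" "equivariant_pair F' G'"
  shows "equivariant_pair (\<lambda>q. F (F' q)) (\<lambda>q. G' (G q))"
  using equivariant_pairD[OF assms(1)] equivariant_pairD[OF assms(2)]
  unfolding equivariant_pair_def by (auto intro: leafwise_compose)

lemma equivariant_pair_id: "equivariant_pair (\<lambda>q. q) (\<lambda>q. q)"
  by (simp add: equivariant_pair_def leafwise_id)

lemma equivariant_deck:
  assumes "equivariant_pair F G" "q \<in> Rtilde"
  shows "F (deck k q) = deck k (F q)"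
proof (induction k rule: int_induct[where k = 0])
  note D = equivariant_pairD[OF assms(1)]
  case (step1 i)
  have "F (T (deck i q)) = T (F (deck i q))" by (rule D(5)[OF deck_Rtilde[OF assms(2)]])
  then show ?case using step1 T_deck[OF assms(2)] T_deck[OF D(7)[OF assms(2)]] by simp
next
  case (step2 i)
  note D = equivariant_pairD[OF assms(1)]
  have "T (F (deck (i - 1) q)) = F (T (deck (i - 1) q))"
    using D(5)[OF deck_Rtilde[OF assms(2)]] by simp
  also have "\<dots> = T (deck (i - 1) (F q))"
    using step2 T_deck[OF assms(2), of "i - 1"] T_deck[OF D(7)[OF assms(2)], of "i - 1"] by simp
  finally show ?case
    using Tinv_T[OF D(7)[OF deck_Rtilde[OF assms(2)]]] Tinv_T[OF deck_Rtilde[OF D(7)[OF assms(2)]]] by metis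
qed simp

lemma induced_proj:
  assumes "equivariant_pair F G" "q \<in> Rtilde"
  shows "induced F (proj T q) = proj T (F q)"
proof -
  have "F ` proj T q = proj T (F q)"
    using equivariant_deck[OF assms] assms(2) equivariant_pairD(7)[OF assms]
    by (simp add: proj_eq_deck_orbit image_image)
  then show ?thesis using assms(2) by (auto simp: induced_def reeb_eq)
qed

lemma induced_compose:
  assumes "equivariant_pair F G" "equivariant_pair F' G'"
  shows "compose (reeb T) (induced F) (induced F') = induced (\<lambda>q. F (F' q))"
proof
  fix P
  show "compose (reeb T) (induced F) (induced F') P = induced (\<lambda>q. F (F' q)) P"
  proof (cases "P \<in> reeb T")
    case True
    then obtain q where q: "q \<in> Rtilde" "P = proj T q" by (auto simp: reeb_eq)
    then show ?thesis
      using True by (simp add: compose_def induced_proj[OF assms(2)] induced_proj[OF assms(1)]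
          induced_proj[OF equivariant_pair_compose[OF assms]] equivariant_pairD(7)[OF assms(2)])
  qed (simp add: compose_def induced_def)
qed

lemma induced_id: "induced (\<lambda>q. q) = (\<lambda>P\<in>reeb T. P)"
  by (simp add: induced_def)

lemma induced_cong: 
  assumes "\<And>q. q \<in> Rtilde \<Longrightarrow> F q = F' q" shows "induced F = induced F'"
proof -
  have "P \<subseteq> Rtilde" if "P \<in> reeb T" for P
    using that by (auto simp: reeb_eq proj_def orbit_rel_iff)
  then show ?thesis unfolding induced_def by (intro restrict_ext image_cong refl assms) blast
qed

lemma induced_Bij:
  assumes FG: "equivariant_pair F G"
  shows "induced F \<in> Bij (reeb T)" and "\<And>q. q \<in> Rtilde \<Longrightarrow> inv_into (reeb T) (induced F) (proj T q) = proj T (G q)"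
proof -
  note GF = equivariant_pair_sym[OF FG]
  have FGp: "induced F (induced G P) = P" "induced G (induced F P) = P" "induced F P \<in> reeb T" "induced G P \<in> reeb T"
    if "P \<in> reeb T" for P
  proof -
    obtain q where q: "q \<in> Rtilde" "P = proj T q" using \<open>P \<in> reeb T\<close> by (auto simp: reeb_eq)
    then show "induced F (induced G P) = P" "induced G (induced F P) = P"
      "induced F P \<in> reeb T" "induced G P \<in> reeb T"
      by (simp_all add: induced_proj[OF FG] induced_proj[OF GF] equivariant_pairD[OF FG] reeb_eq)
  qed
  have bij: "bij_betw (induced F) (reeb T) (reeb T)"
    by (rule bij_betw_byWitness[where f' = "induced G"]) (use FGp in auto)
  then show "induced F \<in> Bij (reeb T)" by (simp add: Bij_def induced_def)
  fix q assume q: "q \<in> Rtilde"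
  then have "proj T q \<in> reeb T" by (simp add: reeb_eq)
  then have "inv_into (reeb T) (induced F) (induced F (induced G (proj T q))) = induced G (proj T q)"
    using bij FGp by (intro inv_into_f_f) (auto simp: bij_betw_def)
  then show "inv_into (reeb T) (induced F) (proj T q) = proj T (G q)"
    using FGp(1)[OF \<open>proj T q \<in> reeb T\<close>] induced_proj[OF GF q] by simp
qed

text \<open>The points \<open>(1, 0, x)\<close> form a transversal that meets each leaf of \<open>Rtilde\<close>, the boundary included.\<close>

definition transverse_level :: "(point \<Rightarrow> point) \<Rightarrow> real \<Rightarrow> real" where
  "transverse_level F x = level (F (1, 0, x))"

lemma base_point: "x \<ge> 0 \<Longrightarrow> (1, 0, x) \<in> Rtilde"
  by (simp add: Rtilde_def)

lemma level_leafwise: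
  assumes "leafwise F" "q \<in> Rtilde"
  shows "level (F q) = transverse_level F (level q)"
  unfolding transverse_level_def
  by (rule leafwise_level[OF assms]) (use assms(2) in \<open>auto simp: Rtilde_iff zero_prod_def\<close>)

lemma transverse_level_nonneg: "leafwise F \<Longrightarrow> x \<ge> 0 \<Longrightarrow> transverse_level F x \<ge> 0"
  using leafwise_Rtilde[OF _ base_point] by (simp add: transverse_level_def Rtilde_iff)

lemma transverse_level_inverse:
  assumes FG: "equivariant_pair F G" and x: "x \<ge> 0"
  shows "transverse_level G (transverse_level F x) = x"
proof -
  note D = equivariant_pairD[OF FG]
  have "level (G (F (1, 0, x))) = transverse_level G (level (F (1, 0, x)))"
    by (rule level_leafwise[OF D(2) D(7)[OF base_point[OF x]]])
  then show ?thesis using D(3)[OF base_point[OF x]] by (simp add: transverse_level_def)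
qed

lemma equivariant_leaf_image:
  assumes FG: "equivariant_pair F G" and x: "x \<ge> 0"
  shows "F ` leaf_tilde x = leaf_tilde (transverse_level F x)"
proof -
  note D = equivariant_pairD[OF FG]
  show ?thesis
  proof (intro equalityI subsetI)
    fix r assume "r \<in> F ` leaf_tilde x"
    then show "r \<in> leaf_tilde (transverse_level F x)"
      using D(7) level_leafwise[OF D(1)] by (auto simp: leaf_tilde_def)
  next
    fix r assume r: "r \<in> leaf_tilde (transverse_level F x)"
    then have "level (G r) = x" "r \<in> Rtilde"
      using level_leafwise[OF D(2)] transverse_level_inverse[OF FG x] by (auto simp: leaf_tilde_def)
    then have "G r \<in> leaf_tilde x" "r = F (G r)" using D(8,4) by (auto simp: leaf_tilde_def)
    then show "r \<in> F ` leaf_tilde x" by blast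
  qed
qed

lemma leafwise_leaf_holomorphic:
  assumes F: "leafwise F" and x: "x \<ge> 0" and f: "\<And>q. q \<in> Rtilde \<Longrightarrow> f (proj T q) = proj T (F q)"
  shows "leaf_holomorphic T x (transverse_level F x) f"
  unfolding leaf_holomorphic_def
proof
  fix w assume w: "w \<in> leaf_plane x"
  have R: "F (at_level x v) \<in> Rtilde" "level (F (at_level x v)) = transverse_level F x"
    if "v \<in> leaf_plane x" for v
    using leafwise_Rtilde[OF F, of "at_level x v"] level_leafwise[OF F, of "at_level x v"] that
    by (simp_all add: at_level_in_Rtilde)
  show "\<exists>W h. open W \<and> w \<in> W \<and> W \<subseteq> leaf_plane x \<and> holomorphic2_on h W \<and>
      h ` W \<subseteq> leaf_plane (transverse_level F x) \<and>
      (\<forall>v\<in>W. f (proj T (at_level x v)) = proj T (at_level (transverse_level F x) (h v)))"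
  proof (intro exI[of _ "leaf_plane x"] exI[of _ "\<lambda>v. planar (F (at_level x v))"] conjI ballI)
    show "(\<lambda>v. planar (F (at_level x v))) ` leaf_plane x \<subseteq> leaf_plane (transverse_level F x)"
      using R planar_in_leaf_plane by (metis (no_types, lifting) image_subsetI)
    fix v assume v: "v \<in> leaf_plane x"
    then have "f (proj T (at_level x v)) = proj T (F (at_level x v))"
      by (intro f) (simp add: at_level_in_Rtilde)
    then show "f (proj T (at_level x v)) = proj T (at_level (transverse_level F x) (planar (F (at_level x v))))"
      using at_level_planarI[OF R(2)[OF v]] by simp
  qed (use w open_leaf_plane leafwise_holomorphic[OF F x] in auto)
qed

lemma mem_Aut_rel_iff:
  "f \<in> carrier (Aut_rel T) \<longleftrightarrow> f \<in> Bij (reeb T) \<and> reeb_smooth T f \<and> reeb_smooth T (inv_into (reeb T) f) \<and>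
     (\<forall>x\<ge>0. \<exists>y\<ge>0. f ` leaf T x = leaf T y \<and> leaf_holomorphic T x y f \<and>
           leaf_holomorphic T y x (inv_into (reeb T) f)) \<and> (\<forall>P\<in>boundary_leaf T. f P = P)"
proof -
  have "restrict f (boundary_leaf T) = (\<lambda>x\<in>boundary_leaf T. x) \<longleftrightarrow> (\<forall>P\<in>boundary_leaf T. f P = P)"
  proof
    assume "restrict f (boundary_leaf T) = (\<lambda>x\<in>boundary_leaf T. x)"
    then show "\<forall>P\<in>boundary_leaf T. f P = P" by (metis restrict_apply')
  qed (auto intro: restrict_ext)
  then show ?thesis
    by (simp add: Aut_rel_def kernel_def Aut_reeb_def Aut_boundary_def BijGroup_def)
qed

lemma leaf_eq_proj: "P \<in> leaf T x \<longleftrightarrow> (\<exists>q\<in>leaf_tilde x. P = proj T q)"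
  by (auto simp: leaf_def)

lemma induced_in_Aut_rel:
  assumes FG: "equivariant_pair F G"
  shows "induced F \<in> carrier (Aut_rel T)"
  unfolding mem_Aut_rel_iff
proof (intro conjI allI impI ballI)
  note D = equivariant_pairD[OF FG]
  show "induced F \<in> Bij (reeb T)" by (rule induced_Bij[OF FG])
  have smooth: "reeb_smooth T f" if "leafwise F" "\<And>q. q \<in> Rtilde \<Longrightarrow> f (proj T q) = proj T (F q)" for f F
    unfolding reeb_smooth_def using that
    by (intro ballI exI[of _ UNIV] exI[of _ F]) (auto simp: leafwise_def)
  show "reeb_smooth T (induced F)" by (rule smooth[OF D(1) induced_proj[OF FG]])
  show "reeb_smooth T (inv_into (reeb T) (induced F))" by (rule smooth[OF D(2) induced_Bij(2)[OF FG]])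
  fix x :: real assume x: "x \<ge> 0"
  have y: "transverse_level F x \<ge> 0" by (rule transverse_level_nonneg[OF D(1) x])
  show "\<exists>y\<ge>0. induced F ` leaf T x = leaf T y \<and> leaf_holomorphic T x y (induced F) \<and>
           leaf_holomorphic T y x (inv_into (reeb T) (induced F))"
  proof (intro exI[of _ "transverse_level F x"] conjI y)
    have "induced F ` leaf T x = proj T ` (F ` leaf_tilde x)"
      unfolding leaf_def image_image
      by (intro image_cong refl induced_proj[OF FG] leaf_tilde_sub)
    then show "induced F ` leaf T x = leaf T (transverse_level F x)"
      using equivariant_leaf_image[OF FG x] by (simp add: leaf_def)
    show "leaf_holomorphic T x (transverse_level F x) (induced F)"
      by (rule leafwise_leaf_holomorphic[OF D(1) x induced_proj[OF FG]])
    show "leaf_holomorphic T (transverse_level F x) x (inv_into (reeb T) (induced F))"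
      using leafwise_leaf_holomorphic[OF D(2) y induced_Bij(2)[OF FG]]
      by (simp add: transverse_level_inverse[OF FG x])
  qed
next
  fix P assume "P \<in> boundary_leaf T"
  then obtain q where "q \<in> leaf_tilde 0" "P = proj T q" by (auto simp: leaf_eq_proj)
  then show "induced F P = P"
    using induced_proj[OF FG leaf_tilde_sub] equivariant_pairD(6)[OF FG] by metis
qed

text \<open>The levels of one orbit of \<open>\<phi>\<close> describe the same leaf of the quotient; a deck transformation changes
  the level by which it is described.\<close>

lemma leaf_holomorphic_deck:
  assumes f: "leaf_holomorphic T y' x f" and q: "q \<in> Rtilde" "level q = y" "level (deck k q) = y'"
  shows "leaf_holomorphic T y x f"
  unfolding leaf_holomorphic_def
proof
  fix w assume w: "w \<in> leaf_plane y"
  have y: "y \<ge> 0" using q by (simp add: Rtilde_iff)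
  define d where "d v = planar (deck k (at_level y v))" for v
  have R: "deck k (at_level y v) \<in> Rtilde" "level (deck k (at_level y v)) = y'" if "v \<in> leaf_plane y" for v
    using deck_Rtilde[of "at_level y v"] leafwise_level[OF leafwise_deck[of k], of "at_level y v" q] that q
    by (simp_all add: at_level_in_Rtilde)
  have d: "d v \<in> leaf_plane y'" "at_level y' (d v) = deck k (at_level y v)" if "v \<in> leaf_plane y" for v
    using R[OF that] planar_in_leaf_plane[OF R(1)[OF that]] at_level_planarI by (auto simp: d_def)
  obtain W h where W: "open W" "d w \<in> W" "W \<subseteq> leaf_plane y'" "holomorphic2_on h W" "h ` W \<subseteq> leaf_plane x"
    "\<And>v. v \<in> W \<Longrightarrow> f (proj T (at_level y' v)) = proj T (at_level x (h v))"
    using f d(1)[OF w] unfolding leaf_holomorphic_def by metis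
  have hold: "holomorphic2_on d (leaf_plane y)"
    unfolding d_def by (rule leafwise_holomorphic[OF leafwise_deck y])
  define V where "V = leaf_plane y \<inter> d -` W"
  have V: "open V"
    unfolding V_def using holomorphic2_on_continuous_on[OF hold] open_leaf_plane W(1)
    by (simp add: continuous_open_preimage)
  have "f (proj T (at_level y v)) = proj T (at_level x (h (d v)))" if "v \<in> V" for v
  proof -
    have v: "v \<in> leaf_plane y" "d v \<in> W" using that by (auto simp: V_def)
    have "proj T (at_level y v) = proj T (at_level y' (d v))"
      using d(2)[OF v(1)] v(1) by (simp add: at_level_in_Rtilde)
    then show ?thesis using W(6)[OF v(2)] by simp
  qed
  moreover have "holomorphic2_on (\<lambda>v. h (d v)) V"
    by (rule holomorphic2_on_compose[OF holomorphic2_on_subset[OF hold] W(4)]) (auto simp: V_def)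
  ultimately show "\<exists>W h. open W \<and> w \<in> W \<and> W \<subseteq> leaf_plane y \<and> holomorphic2_on h W \<and>
      h ` W \<subseteq> leaf_plane x \<and> (\<forall>v\<in>W. f (proj T (at_level y v)) = proj T (at_level x (h v)))"
    using V w W(2,5) by (intro exI[of _ V] exI[of _ "\<lambda>v. h (d v)"]) (auto simp: V_def)
qed

text \<open>The lift that fixes one boundary point fixes the whole boundary, commutes with \<open>T\<close> and is
  inverse to the lift of the inverse: each time two lifts of the same map are compared that agree
  at one point of the boundary.\<close>

lemma equivariant_lift_exists:
  assumes f: "f \<in> carrier (Aut_rel T)"
  obtains F G where "equivariant_pair F G" "\<And>q. q \<in> Rtilde \<Longrightarrow> proj T (F q) = f (proj T q)"
proof -
  define f' where "f' = inv_into (reeb T) f"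
  define q0 :: point where "q0 = (1, 0, 0)"
  have q0: "q0 \<in> leaf_tilde 0" "q0 \<in> Rtilde" by (auto simp: q0_def leaf_tilde_def Rtilde_def)
  have bij: "bij_betw f (reeb T) (reeb T)" using f by (simp add: mem_Aut_rel_iff Bij_def)
  have ff': "f (f' P) = P" "f' (f P) = P" "f P \<in> reeb T" "f' P \<in> reeb T" if "P \<in> reeb T" for P
    using bij_betw_inv_into_right[OF bij that] bij_betw_inv_into_left[OF bij that]
      bij_betw_apply[OF bij that] bij_betw_apply[OF bij_betw_inv_into[OF bij] that]
    by (simp_all add: f'_def)
  have bd: "f (proj T q) = proj T q" "f' (proj T q) = proj T q" if "q \<in> leaf_tilde 0" for q
  proof -
    have "proj T q \<in> boundary_leaf T" using that unfolding leaf_def by (rule imageI)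
    then show "f (proj T q) = proj T q" using f unfolding mem_Aut_rel_iff by blast
    then show "f' (proj T q) = proj T q"
      using ff'(2)[of "proj T q"] leaf_tilde_sub[OF that] by (auto simp: reeb_eq)
  qed
  have leaf': "\<exists>x\<ge>0. leaf_holomorphic T y x f'" if y: "y \<ge> 0" for y
  proof -
    have "proj T (1, 0, y) \<in> reeb T" using base_point[OF y] by (simp add: reeb_eq)
    then obtain q' where q': "q' \<in> Rtilde" "proj T q' = f' (proj T (1, 0, y))" "f (proj T q') = proj T (1, 0, y)"
      using ff'(1,4)[OF \<open>proj T (1, 0, y) \<in> reeb T\<close>] by (auto simp: reeb_eq)
    define x where "x = level q'"
    have x: "x \<ge> 0" using q' by (simp add: x_def Rtilde_iff)
    have "\<exists>y\<ge>0. f ` leaf T x = leaf T y \<and> leaf_holomorphic T x y f \<and> leaf_holomorphic T y x f'"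
      using f x unfolding mem_Aut_rel_iff f'_def by simp
    then obtain y' where y': "f ` leaf T x = leaf T y'" "leaf_holomorphic T y' x f'"
      by (elim exE conjE)
    have "q' \<in> leaf_tilde x" using q'(1) by (simp add: leaf_tilde_def x_def)
    then have "proj T q' \<in> leaf T x" unfolding leaf_def by (rule imageI)
    then have "proj T (1, 0, y) \<in> leaf T y'" using y'(1) q'(3) by auto
    then obtain r where r: "r \<in> leaf_tilde y'" "proj T (1, 0, y) = proj T r" by (auto simp: leaf_eq_proj)
    then obtain k where "deck k (1, 0, y) = r"
      using proj_eq_iff[OF base_point[OF y] leaf_tilde_sub] by blast
    then show ?thesis
      using leaf_holomorphic_deck[OF y'(2) base_point[OF y], of y k] x r(1) by (auto simp: leaf_tilde_def)
  qed
  have one: "\<exists>F. leafwise F \<and> (\<forall>q\<in>Rtilde. proj T (F q) = g (proj T q)) \<and> (\<forall>q\<in>leaf_tilde 0. F q = q) \<and>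
      (\<forall>q\<in>Rtilde. F (T q) = T (F q))"
    if g: "\<And>P. P \<in> reeb T \<Longrightarrow> g P \<in> reeb T" "reeb_smooth T g" "\<And>q. q \<in> leaf_tilde 0 \<Longrightarrow> g (proj T q) = proj T q"
      "\<And>x. x \<ge> 0 \<Longrightarrow> \<exists>y\<ge>0. leaf_holomorphic T x y g" for g
  proof -
    obtain F where F: "continuous_on Rtilde F" "\<And>q. q \<in> Rtilde \<Longrightarrow> F q \<in> Rtilde"
      "\<And>q. q \<in> Rtilde \<Longrightarrow> proj T (F q) = g (proj T q)" "F q0 = q0"
      by (rule continuous_lift_exists[OF g(1,2) q0(2) q0(2) g(3)[OF q0(1)]]) auto
    have lw: "leafwise F" by (rule lift_leafwise[OF g(2,4) F(1,2,3)])
    have fix0: "F q = q" if "q \<in> leaf_tilde 0" for q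
    proof (rule lift_unique[OF connected_leaf_tilde _ continuous_on_id _ _ _ q0(1) _ that])
      show "continuous_on (leaf_tilde 0) F"
        using F(1) leaf_tilde_sub by (meson continuous_on_subset subsetI)
      show "proj T (F x) = proj T x" if "x \<in> leaf_tilde 0" for x
        using F(3)[OF leaf_tilde_sub] g(3) that by simp
    qed (use F leaf_tilde_sub in auto)
    have "T q0 \<in> leaf_tilde 0"
      using T_Rtilde[OF q0(2)] by (simp add: leaf_tilde_def q0_def phi_0)
    have "F (T q) = T (F q)" if "q \<in> Rtilde" for q
    proof (rule lift_unique[OF connected_Rtilde _ _ _ _ _ q0(2) _ that])
      show "continuous_on Rtilde (\<lambda>q. F (T q))"
        by (rule leafwise_continuous_on[OF leafwise_compose[OF leafwise_T lw]])
      show "continuous_on Rtilde (\<lambda>q. T (F q))"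
        by (rule leafwise_continuous_on[OF leafwise_compose[OF lw leafwise_T]])
      show "F (T q0) = T (F q0)" using fix0[OF \<open>T q0 \<in> leaf_tilde 0\<close>] F(4) by simp
    qed (use F T_Rtilde in auto)
    then show ?thesis using lw F(3) fix0 by blast
  qed
  have leaf: "\<exists>y\<ge>0. leaf_holomorphic T x y f" if "x \<ge> 0" for x
    using f that unfolding mem_Aut_rel_iff by blast
  have smooth: "reeb_smooth T f" "reeb_smooth T f'"
    using f unfolding mem_Aut_rel_iff f'_def by blast+
  have "\<exists>F. leafwise F \<and> (\<forall>q\<in>Rtilde. proj T (F q) = f (proj T q)) \<and> (\<forall>q\<in>leaf_tilde 0. F q = q) \<and>
      (\<forall>q\<in>Rtilde. F (T q) = T (F q))"
    by (intro one ff'(3) smooth(1) bd(1) leaf)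
  then obtain F where F: "leafwise F" "\<forall>q\<in>Rtilde. proj T (F q) = f (proj T q)" "\<forall>q\<in>leaf_tilde 0. F q = q"
      "\<forall>q\<in>Rtilde. F (T q) = T (F q)"
    by (elim exE conjE)
  have "\<exists>F. leafwise F \<and> (\<forall>q\<in>Rtilde. proj T (F q) = f' (proj T q)) \<and> (\<forall>q\<in>leaf_tilde 0. F q = q) \<and>
      (\<forall>q\<in>Rtilde. F (T q) = T (F q))"
    by (intro one ff'(4) smooth(2) bd(2) leaf')
  then obtain G where G: "leafwise G" "\<forall>q\<in>Rtilde. proj T (G q) = f' (proj T q)" "\<forall>q\<in>leaf_tilde 0. G q = q"
    by (elim exE conjE)
  have inv: "B (A q) = q"
    if A: "leafwise A" "\<forall>q\<in>Rtilde. proj T (A q) = a (proj T q)" "\<forall>q\<in>leaf_tilde 0. A q = q"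
      and B: "leafwise B" "\<forall>q\<in>Rtilde. proj T (B q) = b (proj T q)" "\<forall>q\<in>leaf_tilde 0. B q = q"
      and ab: "\<And>P. P \<in> reeb T \<Longrightarrow> b (a P) = P" and q: "q \<in> Rtilde" for A B a b q
  proof (rule lift_unique[OF connected_Rtilde _ continuous_on_id _ _ _ q0(2) _ q])
    show "continuous_on Rtilde (\<lambda>q. B (A q))"
      by (rule leafwise_continuous_on[OF leafwise_compose[OF A(1) B(1)]])
    show "B (A x) \<in> Rtilde" if "x \<in> Rtilde" for x
      using that leafwise_Rtilde A(1) B(1) by blast
    show "proj T (B (A x)) = proj T x" if "x \<in> Rtilde" for x
    proof -
      have "proj T (B (A x)) = b (a (proj T x))"
        using A(2) B(2) that leafwise_Rtilde[OF A(1) that] by simp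
      then show ?thesis using ab that by (simp add: reeb_eq)
    qed
    show "B (A q0) = q0" using A(3) B(3) q0(1) by simp
  qed
  have "equivariant_pair F G"
    unfolding equivariant_pair_def
    using F G(1) inv[OF F(1-3) G ff'(2)] inv[OF G F(1-3) ff'(1)] by blast
  with F(2) show ?thesis using that by blast
qed

lemma Aut_rel_eq_induced:
  assumes "f \<in> carrier (Aut_rel T)" "equivariant_pair F G" "\<And>q. q \<in> Rtilde \<Longrightarrow> proj T (F q) = f (proj T q)"
  shows "f = induced F"
proof (rule extensionalityI[of _ "reeb T"])
  show "f \<in> extensional (reeb T)" using assms(1) by (simp add: mem_Aut_rel_iff Bij_def)
  show "induced F \<in> extensional (reeb T)" by (simp add: induced_def)
  fix P assume "P \<in> reeb T"
  then show "f P = induced F P"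
    using induced_proj[OF assms(2)] assms(3) by (auto simp: reeb_eq)
qed

lemma carrier_Aut_rel: "carrier (Aut_rel T) = {induced F | F G. equivariant_pair F G}"
proof (intro equalityI subsetI)
  fix f assume f: "f \<in> carrier (Aut_rel T)"
  obtain F G where FG: "equivariant_pair F G" "\<And>q. q \<in> Rtilde \<Longrightarrow> proj T (F q) = f (proj T q)"
    by (rule equivariant_lift_exists[OF f]) blast
  from Aut_rel_eq_induced[OF f FG] FG(1) show "f \<in> {induced F | F G. equivariant_pair F G}" by blast
qed (use induced_in_Aut_rel in blast)

lemma Aut_rel_eq: "Aut_rel T = BijGroup (reeb T)\<lparr>carrier := carrier (Aut_rel T)\<rparr>"
  by (simp add: Aut_rel_def Aut_reeb_def)

lemma mult_Aut_rel:
  assumes "equivariant_pair F G" "equivariant_pair F' G'"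
  shows "induced F \<otimes>\<^bsub>Aut_rel T\<^esub> induced F' = induced (\<lambda>q. F (F' q))"
  using induced_Bij(1)[OF assms(1)] induced_Bij(1)[OF assms(2)] induced_compose[OF assms]
  by (subst Aut_rel_eq) (simp add: BijGroup_def)

lemma group_Aut_rel: "group (Aut_rel T)"
proof (subst Aut_rel_eq, rule group_BijGroup_carrier)
  show "carrier (Aut_rel T) \<subseteq> Bij (reeb T)"
    by (auto simp: mem_Aut_rel_iff)
  show "(\<lambda>P\<in>reeb T. P) \<in> carrier (Aut_rel T)"
    using induced_in_Aut_rel[OF equivariant_pair_id] by (simp add: induced_id)
  show "compose (reeb T) f g \<in> carrier (Aut_rel T)" if "f \<in> carrier (Aut_rel T)" "g \<in> carrier (Aut_rel T)" for f g
  proof -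
    obtain F F' G G' where "equivariant_pair F G" "f = induced F" "equivariant_pair F' G'" "g = induced F'"
      using \<open>f \<in> _\<close> \<open>g \<in> _\<close> by (auto simp: carrier_Aut_rel)
    then show ?thesis
      using induced_in_Aut_rel[OF equivariant_pair_compose] by (simp add: induced_compose)
  qed
  show "(\<lambda>P\<in>reeb T. inv_into (reeb T) f P) \<in> carrier (Aut_rel T)" if "f \<in> carrier (Aut_rel T)" for f
  proof -
    obtain F G where FG: "equivariant_pair F G" "f = induced F" using \<open>f \<in> _\<close> by (auto simp: carrier_Aut_rel)
    have "(\<lambda>P\<in>reeb T. inv_into (reeb T) f P) = induced G"
    proof (rule extensionalityI[of _ "reeb T"])
      fix P assume "P \<in> reeb T"
      then show "(\<lambda>P\<in>reeb T. inv_into (reeb T) f P) P = induced G P"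
        using induced_Bij(2)[OF FG(1)] induced_proj[OF equivariant_pair_sym[OF FG(1)]] FG(2)
        by (auto simp: reeb_eq)
    qed (auto simp: induced_def)
    then show ?thesis using induced_in_Aut_rel[OF equivariant_pair_sym[OF FG(1)]] by simp
  qed
qed

end

section \<open>The transverse map\<close>

lemma inv_into_Bij_eq:
  assumes "f \<in> Bij S" "x \<in> S" "f x = y"
  shows "inv_into S f y = x"
  using assms by (auto simp: Bij_def bij_betw_def inv_into_f_eq)

context reeb_component
begin

lemma mem_Diff_centralizer_iff:
  "\<eta> \<in> carrier (Diff_centralizer \<phi>) \<longleftrightarrow> \<eta> \<in> Bij {0..} \<and> smooth_on {0..} \<eta> \<and>
     smooth_on {0..} (inv_into {0..} \<eta>) \<and> (\<forall>x\<ge>0. \<eta> (\<phi> x) = \<phi> (\<eta> x))"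
proof -
  have "\<eta> \<otimes>\<^bsub>Diff_half\<^esub> \<phi> = \<phi> \<otimes>\<^bsub>Diff_half\<^esub> \<eta> \<longleftrightarrow> (\<forall>x\<ge>0. \<eta> (\<phi> x) = \<phi> (\<eta> x))" if "\<eta> \<in> Bij {0..}"
  proof -
    have "\<phi> \<in> Bij {0..}" using diffeo by (simp add: Diff_half_def)
    then have "\<eta> \<otimes>\<^bsub>Diff_half\<^esub> \<phi> = compose {0..} \<eta> \<phi>" "\<phi> \<otimes>\<^bsub>Diff_half\<^esub> \<eta> = compose {0..} \<phi> \<eta>"
      using that by (simp_all add: Diff_half_def BijGroup_def)
    moreover have "compose {0..} \<eta> \<phi> = compose {0..} \<phi> \<eta> \<longleftrightarrow> (\<forall>x\<ge>0. \<eta> (\<phi> x) = \<phi> (\<eta> x))"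
      by (auto simp: compose_def fun_eq_iff restrict_def)
    ultimately show ?thesis by simp
  qed
  moreover have "\<eta> \<in> carrier Diff_half \<longleftrightarrow> \<eta> \<in> Bij {0..} \<and> smooth_on {0..} \<eta> \<and> smooth_on {0..} (inv_into {0..} \<eta>)"
    by (simp add: Diff_half_def)
  ultimately show ?thesis by (auto simp: Diff_centralizer_def)
qed

lemma Diff_centralizer_eq:
  "Diff_centralizer \<phi> = BijGroup {0..}\<lparr>carrier := carrier (Diff_centralizer \<phi>)\<rparr>"
  by (simp add: Diff_centralizer_def Diff_half_def)

lemma Bij_half_nonneg: "\<eta> \<in> Bij {0..} \<Longrightarrow> x \<ge> 0 \<Longrightarrow> \<eta> x \<ge> (0::real)"
  using Bij_imp_funcset by fastforce

lemma Bij_half_inv: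
  assumes "\<eta> \<in> Bij {0::real..}" "x \<ge> 0"
  shows "\<eta> (inv_into {0..} \<eta> x) = x" "inv_into {0..} \<eta> (\<eta> x) = x" "inv_into {0..} \<eta> x \<ge> 0"
  using assms bij_betw_inv_into_right[of \<eta> "{0..}" "{0..}" x]
    bij_betw_inv_into_left[of \<eta> "{0..}" "{0..}" x] Bij_inv_into_mem[of \<eta> "{0..}" x]
  by (auto simp: Bij_def)

lemma group_Diff_centralizer: "group (Diff_centralizer \<phi>)"
proof (subst Diff_centralizer_eq, rule group_BijGroup_carrier)
  show "carrier (Diff_centralizer \<phi>) \<subseteq> Bij {0..}"
    by (auto simp: mem_Diff_centralizer_iff)
  have id: "inv_into {0..} (\<lambda>x\<in>{0..}. x) x = x" if "x \<ge> 0" for x :: real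
    by (rule inv_into_Bij_eq[OF id_Bij]) (use that in auto)
  show "(\<lambda>x\<in>{0..}. x) \<in> carrier (Diff_centralizer \<phi>)"
    unfolding mem_Diff_centralizer_iff
  proof (intro conjI allI impI id_Bij)
    show "smooth_on {0..} (\<lambda>x\<in>{0..}. x::real)"
      by (rule smooth_on_cong[OF smooth_on_id]) simp
    show "smooth_on {0..} (inv_into {0..} (\<lambda>x\<in>{0..}. x::real))"
      by (rule smooth_on_cong[OF smooth_on_id id[symmetric]]) simp
  qed (simp add: phi_nonneg)
  fix f assume f: "f \<in> carrier (Diff_centralizer \<phi>)"
  then have fB: "f \<in> Bij {0..}" and fs: "smooth_on {0..} f" "smooth_on {0..} (inv_into {0..} f)"
    and fc: "\<And>x. x \<ge> 0 \<Longrightarrow> f (\<phi> x) = \<phi> (f x)" by (auto simp: mem_Diff_centralizer_iff)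
  have comm: "inv_into {0..} f (\<phi> x) = \<phi> (inv_into {0..} f x)" if "x \<ge> 0" for x
    using inv_into_Bij_eq[OF fB, of "\<phi> (inv_into {0..} f x)" "\<phi> x"] fc Bij_half_inv[OF fB that]
    by (simp add: phi_nonneg)
  have inv: "inv_into {0..} (\<lambda>x\<in>{0..}. inv_into {0..} f x) x = f x" if "x \<ge> 0" for x
    by (rule inv_into_Bij_eq[OF restrict_inv_into_Bij[OF fB]])
      (use that Bij_half_inv[OF fB that] Bij_half_nonneg[OF fB that] in auto)
  show "(\<lambda>x\<in>{0..}. inv_into {0..} f x) \<in> carrier (Diff_centralizer \<phi>)"
    unfolding mem_Diff_centralizer_iff
  proof (intro conjI allI impI)
    show "smooth_on {0..} (\<lambda>x\<in>{0..}. inv_into {0..} f x)" by (rule smooth_on_cong[OF fs(2)]) auto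
    show "smooth_on {0..} (inv_into {0..} (\<lambda>x\<in>{0..}. inv_into {0..} f x))"
      by (rule smooth_on_cong[OF fs(1)]) (auto simp: inv)
  qed (use restrict_inv_into_Bij[OF fB] comm Bij_half_inv[OF fB] in \<open>auto simp: phi_nonneg\<close>)
  fix g assume "g \<in> carrier (Diff_centralizer \<phi>)"
  then have gB: "g \<in> Bij {0..}" and gs: "smooth_on {0..} g" "smooth_on {0..} (inv_into {0..} g)"
    and gc: "\<And>x. x \<ge> 0 \<Longrightarrow> g (\<phi> x) = \<phi> (g x)" by (auto simp: mem_Diff_centralizer_iff)
  have inv: "inv_into {0..} (compose {0..} f g) x = inv_into {0..} g (inv_into {0..} f x)" if "x \<ge> 0" for x
    by (rule inv_into_Bij_eq[OF compose_Bij[OF fB gB]])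
      (use that Bij_half_inv[OF fB that] Bij_half_inv[OF gB, of "inv_into {0..} f x"] in \<open>auto simp: compose_def\<close>)
  show "compose {0..} f g \<in> carrier (Diff_centralizer \<phi>)"
    unfolding mem_Diff_centralizer_iff
  proof (intro conjI allI impI)
    show "smooth_on {0..} (compose {0..} f g)"
      by (rule smooth_on_cong[OF smooth_on_compose[OF gs(1) fs(1)]])
        (use Bij_half_nonneg[OF gB] in \<open>auto simp: compose_def\<close>)
    show "smooth_on {0..} (inv_into {0..} (compose {0..} f g))"
      by (rule smooth_on_cong[OF smooth_on_compose[OF fs(2) gs(2)]])
        (use Bij_half_inv[OF fB] in \<open>auto simp: inv\<close>)
    show "compose {0..} f g (\<phi> x) = \<phi> (compose {0..} f g x)" if "x \<ge> 0" for x
      using that fc gc Bij_half_nonneg[OF gB] by (simp add: compose_def phi_nonneg)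
  qed (rule compose_Bij[OF fB gB])
qed

lemma is_lift_restrict:
  assumes FG: "equivariant_pair F G"
  shows "is_lift T (induced F) (restrict F Rtilde)"
  unfolding is_lift_def
proof (intro conjI ballI)
  note D = equivariant_pairD[OF FG]
  have bij: "restrict F Rtilde \<in> Bij Rtilde"
    unfolding Bij_def using bij_betw_byWitness[where f = F and f' = G and A = Rtilde and A' = Rtilde] D
    by (auto simp: image_subset_iff)
  have inv: "inv_into Rtilde (restrict F Rtilde) q = G q" if "q \<in> Rtilde" for q
    by (rule inv_into_Bij_eq[OF bij]) (use D that in auto)
  show "restrict F Rtilde \<in> Aut_tilde"
    unfolding Aut_tilde_def mem_Collect_eq
  proof (intro conjI allI impI bij)
    show "smooth_on Rtilde (restrict F Rtilde)"
      by (rule smooth_on_cong[of _ F]) (use D(1) in \<open>auto simp: leafwise_def\<close>)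
    show "smooth_on Rtilde (inv_into Rtilde (restrict F Rtilde))"
      by (rule smooth_on_cong[of _ G]) (use D(2) inv in \<open>auto simp: leafwise_def\<close>)
    fix x :: real assume x: "x \<ge> 0"
    show "\<exists>y\<ge>0. restrict F Rtilde ` leaf_tilde x = leaf_tilde y \<and>
        holomorphic2_on (\<lambda>w. planar (restrict F Rtilde (at_level x w))) (leaf_plane x) \<and>
        holomorphic2_on (\<lambda>w. planar (inv_into Rtilde (restrict F Rtilde) (at_level y w))) (leaf_plane y)"
    proof (intro exI[of _ "transverse_level F x"] conjI)
      show y: "transverse_level F x \<ge> 0" by (rule transverse_level_nonneg[OF D(1) x])
      have "restrict F Rtilde ` leaf_tilde x = F ` leaf_tilde x"
        by (intro image_cong refl restrict_apply' leaf_tilde_sub)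
      then show "restrict F Rtilde ` leaf_tilde x = leaf_tilde (transverse_level F x)"
        using equivariant_leaf_image[OF FG x] by simp
      show "holomorphic2_on (\<lambda>w. planar (restrict F Rtilde (at_level x w))) (leaf_plane x)"
        by (rule holomorphic2_on_cong[OF open_leaf_plane leafwise_holomorphic[OF D(1) x]])
          (simp add: at_level_in_Rtilde)
      show "holomorphic2_on (\<lambda>w. planar (inv_into Rtilde (restrict F Rtilde) (at_level (transverse_level F x) w)))
          (leaf_plane (transverse_level F x))"
        by (rule holomorphic2_on_cong[OF open_leaf_plane leafwise_holomorphic[OF D(2) y]])
          (simp add: at_level_in_Rtilde inv)
    qed
  qed
  show "proj T (restrict F Rtilde q) = induced F (proj T q)" if "q \<in> Rtilde" for q
    using that induced_proj[OF FG] by simp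
  show "restrict F Rtilde (T q) = T (restrict F Rtilde q)" if "q \<in> Rtilde" for q
    using that D(5) T_Rtilde by simp
  show "restrict F Rtilde q = q" if "q \<in> leaf_tilde 0" for q
    using that D(6) leaf_tilde_sub by simp
qed

lemma is_lift_unique:
  assumes A: "is_lift T f A" and B: "is_lift T f B" and q: "q \<in> Rtilde"
  shows "A q = B q"
proof (rule lift_unique[OF connected_Rtilde _ _ _ _ _ base_point[of 0] _ q])
  have AB: "A \<in> Bij Rtilde" "B \<in> Bij Rtilde" "smooth_on Rtilde A" "smooth_on Rtilde B"
    using A B by (simp_all add: is_lift_def Aut_tilde_def)
  show "continuous_on Rtilde A" "continuous_on Rtilde B"
    using AB(3,4) by (simp_all add: smooth_on_imp_continuous_on)
  show "A x \<in> Rtilde" "B x \<in> Rtilde" if "x \<in> Rtilde" for x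
    using funcset_mem[OF Bij_imp_funcset[OF AB(1)] that] funcset_mem[OF Bij_imp_funcset[OF AB(2)] that]
    by simp_all
  show "proj T (A x) = proj T (B x)" if "x \<in> Rtilde" for x
    using A B that by (simp add: is_lift_def)
  have "(1, 0, 0) \<in> leaf_tilde 0" using base_point[of 0] by (simp add: leaf_tilde_def)
  then show "A (1, 0, 0) = B (1, 0, 0)"
    using A B unfolding is_lift_def by simp
qed simp

lemma equivariant_pair_unique:
  assumes FG: "equivariant_pair F G" "equivariant_pair F' G'" and eq: "induced F = induced F'"
    and q: "q \<in> Rtilde"
  shows "F q = F' q"
  using is_lift_unique[OF is_lift_restrict[OF FG(1)] is_lift_restrict[OF FG(2), folded eq] q] q by simp

text \<open>The lift is unique, so it determines the map on levels that \<open>transverse\<close> selects.\<close>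

lemma transverse_induced:
  assumes FG: "equivariant_pair F G"
  shows "transverse T (induced F) = (\<lambda>x\<in>{0..}. transverse_level F x)"
  unfolding transverse_def
proof (rule the_equality)
  have "\<forall>(z1, z2, x)\<in>Rtilde. level (restrict F Rtilde (z1, z2, x)) = (\<lambda>x\<in>{0..}. transverse_level F x) x"
    using level_leafwise[OF equivariant_pairD(1)[OF FG]] by (auto simp: Rtilde_iff)
  then show "(\<lambda>x\<in>{0..}. transverse_level F x) \<in> extensional {0..} \<and>
      (\<exists>A. is_lift T (induced F) A \<and>
        (\<forall>(z1, z2, x)\<in>Rtilde. level (A (z1, z2, x)) = (\<lambda>x\<in>{0..}. transverse_level F x) x))"
    using is_lift_restrict[OF FG] by (intro conjI exI restrict_extensional)
  fix \<eta> assume "\<eta> \<in> extensional {0..} \<and>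
      (\<exists>A. is_lift T (induced F) A \<and> (\<forall>(z1, z2, x)\<in>Rtilde. level (A (z1, z2, x)) = \<eta> x))"
  then obtain A where ext: "\<eta> \<in> extensional {0..}" and A: "is_lift T (induced F) A"
    and lev0: "\<forall>(z1, z2, x)\<in>Rtilde. level (A (z1, z2, x)) = \<eta> x"
    by (elim conjE exE)
  have lev: "level (A (z1, z2, x)) = \<eta> x" if "(z1, z2, x) \<in> Rtilde" for z1 z2 x
    using bspec[OF lev0 that] by simp
  show "\<eta> = (\<lambda>x\<in>{0..}. transverse_level F x)"
  proof (rule extensionalityI[OF ext restrict_extensional])
    fix x :: real assume "x \<in> {0..}"
    then have R: "(1, 0, x) \<in> Rtilde" by (simp add: base_point)
    have "\<eta> x = level (A (1, 0, x))" using lev[OF R] by simp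
    also have "A (1, 0, x) = F (1, 0, x)"
      using is_lift_unique[OF A is_lift_restrict[OF FG] R] R by simp
    finally show "\<eta> x = (\<lambda>x\<in>{0..}. transverse_level F x) x"
      using \<open>x \<in> {0..}\<close> by (simp add: transverse_level_def)
  qed
qed

lemma transverse_level_smooth:
  assumes "leafwise F"
  shows "smooth_on {0..} (transverse_level F)"
proof -
  have "smooth_on {0..} (\<lambda>x::real. (1::complex, 0::complex, x))"
    by (intro smooth_on_Pair smooth_on_const smooth_on_id)
  moreover have "smooth_on Rtilde F" using assms by (simp add: leafwise_def)
  ultimately have "smooth_on {0..} (\<lambda>x. F (1, 0, x))"
    by (rule smooth_on_compose) (simp add: base_point)
  then show ?thesis
    unfolding transverse_level_def by (rule smooth_on_snd[OF smooth_on_snd])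
qed

lemma transverse_in_centralizer:
  assumes FG: "equivariant_pair F G"
  shows "(\<lambda>x\<in>{0..}. transverse_level F x) \<in> carrier (Diff_centralizer \<phi>)"
  unfolding mem_Diff_centralizer_iff
proof (intro conjI allI impI)
  note D = equivariant_pairD[OF FG]
  note inv = transverse_level_inverse[OF FG] transverse_level_inverse[OF equivariant_pair_sym[OF FG]]
  have "bij_betw (transverse_level F) {0..} {0..}"
    by (rule bij_betw_byWitness[where f' = "transverse_level G"])
      (use inv transverse_level_nonneg[OF D(1)] transverse_level_nonneg[OF D(2)] in auto)
  then show bij: "(\<lambda>x\<in>{0..}. transverse_level F x) \<in> Bij {0..}"
    by (simp add: Bij_def)
  show "smooth_on {0..} (\<lambda>x\<in>{0..}. transverse_level F x)"
    by (rule smooth_on_cong[OF transverse_level_smooth[OF D(1)]]) simp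
  have "inv_into {0..} (\<lambda>x\<in>{0..}. transverse_level F x) x = transverse_level G x" if "x \<ge> 0" for x
    by (rule inv_into_Bij_eq[OF bij]) (use that inv transverse_level_nonneg[OF D(2)] in auto)
  then show "smooth_on {0..} (inv_into {0..} (\<lambda>x\<in>{0..}. transverse_level F x))"
    by (intro smooth_on_cong[OF transverse_level_smooth[OF D(2)]]) simp
  fix x :: real assume x: "x \<ge> 0"
  have "transverse_level F (\<phi> x) = level (F (T (1, 0, x)))"
    using level_leafwise[OF D(1) T_Rtilde[OF base_point[OF x]]] by (simp add: T_eq)
  also have "\<dots> = \<phi> (transverse_level F x)"
    using D(5)[OF base_point[OF x]] by (simp add: T_eq transverse_level_def)
  finally show "(\<lambda>x\<in>{0..}. transverse_level F x) (\<phi> x) = \<phi> ((\<lambda>x\<in>{0..}. transverse_level F x) x)"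
    using x by (simp add: phi_nonneg)
qed

lemma transverse_hom: "transverse T \<in> hom (Aut_rel T) (Diff_centralizer \<phi>)"
  unfolding hom_def mem_Collect_eq
proof (intro conjI ballI funcsetI)
  fix f assume "f \<in> carrier (Aut_rel T)"
  then obtain F G where FG: "equivariant_pair F G" "f = induced F" by (auto simp: carrier_Aut_rel)
  note D = equivariant_pairD[OF FG(1)]
  show "transverse T f \<in> carrier (Diff_centralizer \<phi>)"
    using transverse_in_centralizer[OF FG(1)] by (simp add: FG(2) transverse_induced[OF FG(1)])
  fix g assume "g \<in> carrier (Aut_rel T)"
  then obtain F' G' where FG': "equivariant_pair F' G'" "g = induced F'" by (auto simp: carrier_Aut_rel)
  note D' = equivariant_pairD[OF FG'(1)]
  have "transverse_level (\<lambda>q. F (F' q)) x = transverse_level F (transverse_level F' x)" if "x \<ge> 0" for x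
    using level_leafwise[OF D(1) D'(7)[OF base_point[OF that]]] by (simp add: transverse_level_def)
  then have "compose {0..} (\<lambda>x\<in>{0..}. transverse_level F x) (\<lambda>x\<in>{0..}. transverse_level F' x)
      = (\<lambda>x\<in>{0..}. transverse_level (\<lambda>q. F (F' q)) x)"
    using transverse_level_nonneg[OF D'(1)] by (auto simp: compose_def fun_eq_iff restrict_def)
  then show "transverse T (f \<otimes>\<^bsub>Aut_rel T\<^esub> g) = transverse T f \<otimes>\<^bsub>Diff_centralizer \<phi>\<^esub> transverse T g"
    using transverse_in_centralizer[OF FG(1)] transverse_in_centralizer[OF FG'(1)]
    by (subst Diff_centralizer_eq) (simp add: FG(2) FG'(2) mult_Aut_rel[OF FG(1) FG'(1)] transverse_induced[OF FG(1)]
        transverse_induced[OF FG'(1)] transverse_induced[OF equivariant_pair_compose[OF FG(1) FG'(1)]]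
        BijGroup_def mem_Diff_centralizer_iff)
qed

text \<open>An element of the centralizer is realised by letting it act on the transverse coordinate only.\<close>

lemma centralizer_equivariant_pair:
  assumes \<eta>: "\<eta> \<in> carrier (Diff_centralizer \<phi>)"
  defines "F \<equiv> \<lambda>q. (fst q, fst (snd q), \<eta> (level q))"
    and "G \<equiv> \<lambda>q. (fst q, fst (snd q), inv_into {0..} \<eta> (level q))"
  shows "equivariant_pair F G"
proof -
  have B: "\<eta> \<in> Bij {0..}" and sm: "smooth_on {0..} \<eta>" "smooth_on {0..} (inv_into {0..} \<eta>)"
    and c: "\<And>x. x \<ge> 0 \<Longrightarrow> \<eta> (\<phi> x) = \<phi> (\<eta> x)" using \<eta> by (auto simp: mem_Diff_centralizer_iff)
  note inv = Bij_half_inv[OF B]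
  have "\<phi> (\<eta> 0) = \<eta> 0" using c[of 0] by (simp add: phi_0)
  then have eta0: "\<eta> 0 = 0"
    using moves[of "\<eta> 0"] Bij_half_nonneg[OF B, of 0] by (auto simp: less_le)
  have eta_eq_0: "x = 0" if "x \<ge> 0" "\<eta> x = 0" for x using inv(2)[of x] inv(2)[of 0] that eta0 by simp
  have inv_eq_0: "x = 0" if "x \<ge> 0" "inv_into {0..} \<eta> x = 0" for x using inv(1)[of x] that eta0 by simp
  have lw: "leafwise (\<lambda>q. (fst q, fst (snd q), h (level q)))"
    if h: "smooth_on {0..} h" "\<And>x. x \<ge> 0 \<Longrightarrow> h x \<ge> 0" "\<And>x. x \<ge> 0 \<Longrightarrow> h x = 0 \<Longrightarrow> x = 0" for h
    unfolding leafwise_def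
  proof (intro conjI ballI allI impI)
    show "smooth_on Rtilde (\<lambda>q. (fst q, fst (snd q), h (level q)))"
      by (intro smooth_on_intros smooth_on_compose[OF _ h(1)]) (auto simp: Rtilde_iff)
    show "(\<lambda>q. (fst q, fst (snd q), h (level q))) ` Rtilde \<subseteq> Rtilde"
      using h(2,3) by (auto simp: Rtilde_iff zero_prod_def)
    show "holomorphic2_on (\<lambda>w. planar (fst (at_level x w), fst (snd (at_level x w)), h (level (at_level x w))))
        (leaf_plane x)" for x
      by (auto simp: holomorphic2_on_iff_cdiff planar_def at_level_def intro!: cdiff_intros)
  qed simp
  have "leafwise F" "leafwise G"
    unfolding F_def G_def
    by (rule lw[OF sm(1) Bij_half_nonneg[OF B] eta_eq_0], assumption+)
      (rule lw[OF sm(2) inv(3) inv_eq_0], assumption+)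
  moreover have "F (T q) = T (F q)" "G (F q) = q" "F (G q) = q" if "q \<in> Rtilde" for q
    using that c[of "level q"] inv[of "level q"] by (simp_all add: F_def G_def T_eq Rtilde_iff)
  moreover have "F q = q" if "q \<in> leaf_tilde 0" for q
    using that eta0 by (auto simp: F_def leaf_tilde_def prod_eq_iff)
  ultimately show ?thesis unfolding equivariant_pair_def by blast
qed

lemma transverse_epi: "transverse T \<in> epi (Aut_rel T) (Diff_centralizer \<phi>)"
proof -
  have "\<eta> \<in> transverse T ` carrier (Aut_rel T)" if \<eta>: "\<eta> \<in> carrier (Diff_centralizer \<phi>)" for \<eta>
  proof -
    note FG = centralizer_equivariant_pair[OF \<eta>]
    have ext: "\<eta> \<in> extensional {0..}" using \<eta> by (simp add: mem_Diff_centralizer_iff Bij_def)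
    have "\<eta> = transverse T (induced (\<lambda>q. (fst q, fst (snd q), \<eta> (level q))))"
      unfolding transverse_induced[OF FG]
      by (rule extensionalityI[OF ext restrict_extensional]) (simp add: transverse_level_def)
    then show ?thesis using induced_in_Aut_rel[OF FG] by (rule image_eqI)
  qed
  moreover have "transverse T f \<in> carrier (Diff_centralizer \<phi>)" if "f \<in> carrier (Aut_rel T)" for f
    using transverse_hom that by (auto simp: hom_def)
  ultimately show ?thesis using transverse_hom unfolding epi_def by blast
qed

lemma kernel_transverse:
  "f \<in> kernel (Aut_rel T) (Diff_centralizer \<phi>) (transverse T) \<longleftrightarrow>
    (\<exists>F G. equivariant_pair F G \<and> f = induced F \<and> (\<forall>q\<in>Rtilde. level (F q) = level q))"
proof -
  have one: "\<one>\<^bsub>Diff_centralizer \<phi>\<^esub> = (\<lambda>x\<in>{0..}. x)"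
    by (subst Diff_centralizer_eq) (simp add: BijGroup_def)
  have "transverse T (induced F) = (\<lambda>x\<in>{0..}. x) \<longleftrightarrow> (\<forall>q\<in>Rtilde. level (F q) = level q)"
    if FG: "equivariant_pair F G" for F G
  proof
    assume "transverse T (induced F) = (\<lambda>x\<in>{0..}. x)"
    then have eq: "(\<lambda>x\<in>{0..}. transverse_level F x) = (\<lambda>x\<in>{0..}. x)" using transverse_induced[OF FG] by simp
    have "transverse_level F x = x" if "x \<ge> 0" for x
      using fun_cong[OF eq, of x] that by simp
    then show "\<forall>q\<in>Rtilde. level (F q) = level q"
      using level_leafwise[OF equivariant_pairD(1)[OF FG]] by (auto simp: Rtilde_iff)
  next
    assume "\<forall>q\<in>Rtilde. level (F q) = level q"
    then have "transverse_level F x = x" if "x \<ge> 0" for x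
      using base_point[OF that] by (auto simp: transverse_level_def)
    then show "transverse T (induced F) = (\<lambda>x\<in>{0..}. x)"
      unfolding transverse_induced[OF FG] by (auto intro!: restrict_ext)
  qed
  then show ?thesis
    unfolding kernel_def one mem_Collect_eq carrier_Aut_rel by blast
qed

end

section \<open>The group of solution tuples\<close>

lemma sum_powers_eq_imp_coeff_eq:
  fixes a b :: "nat \<Rightarrow> complex"
  assumes "\<And>z. (\<Sum>j<p. a j * z ^ j) = (\<Sum>j<p. b j * z ^ j)" "j < p"
  shows "a j = b j"
proof -
  obtain n where n: "p = Suc n" using assms(2) by (cases p) auto
  have "\<forall>z. (\<Sum>i\<le>n. a i * z ^ i) = (\<Sum>i\<le>n. b i * z ^ i)"
    using assms(1) by (simp add: n lessThan_Suc_atMost)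
  then show ?thesis using polyfun_eq_coeffs[of a n b] assms(2) n by simp
qed

lemma binomial_lessThan:
  fixes z g :: complex
  assumes "k < p"
  shows "(z + g) ^ k = (\<Sum>j<p. of_nat (k choose j) * z ^ j * g ^ (k - j))"
proof -
  have "(z + g) ^ k = (\<Sum>j\<le>k. of_nat (k choose j) * z ^ j * g ^ (k - j))"
    by (rule binomial_ring)
  also have "\<dots> = (\<Sum>j<p. of_nat (k choose j) * z ^ j * g ^ (k - j))"
    by (rule sum.mono_neutral_left) (use assms in auto)
  finally show ?thesis .
qed

text \<open>The triangular matrix of binomial coefficients by which a translation acts on the coefficients of a
  polynomial.\<close>

lemma sum_shifted_powers:
  fixes b :: "nat \<Rightarrow> complex" and z g :: complex
  shows "(\<Sum>k<p. b k * (z + g) ^ k) = (\<Sum>j<p. (\<Sum>k=j..<p. of_nat (k choose j) * b k * g ^ (k - j)) * z ^ j)"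
proof -
  have "(\<Sum>k<p. b k * (z + g) ^ k) = (\<Sum>k<p. \<Sum>j<p. of_nat (k choose j) * b k * g ^ (k - j) * z ^ j)"
    by (intro sum.cong refl) (simp add: binomial_lessThan[where p = p] sum_distrib_left mult_ac)
  also have "\<dots> = (\<Sum>j<p. \<Sum>k<p. of_nat (k choose j) * b k * g ^ (k - j) * z ^ j)"
    by (rule sum.swap)
  also have "\<dots> = (\<Sum>j<p. \<Sum>k=j..<p. of_nat (k choose j) * b k * g ^ (k - j) * z ^ j)"
    by (intro sum.cong refl sum.mono_neutral_right) auto
  finally show ?thesis by (simp add: sum_distrib_right)
qed

lemma tuple_comp_eq: "tuple_comp p \<beta> \<gamma> =
   ((\<lambda>j\<in>{..<p}. \<lambda>x\<in>{0<..}. fst \<gamma> j x + (\<Sum>k=j..<p. of_nat (k choose j) * fst \<beta> k x * snd \<gamma> x ^ (k - j))),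
      (\<lambda>x\<in>{0<..}. snd \<beta> x + snd \<gamma> x))"
  by (cases \<beta>; cases \<gamma>) simp

lemma tuple_lift_pos: "x > 0 \<Longrightarrow>
    tuple_lift p \<beta> (z1, z2, x) = (z1 + (\<Sum>j<p. fst \<beta> j x * z2 ^ j), z2 + snd \<beta> x, x)"
  by (cases \<beta>) simp

lemma tuple_lift_0: "tuple_lift p \<beta> (z1, z2, 0) = (z1, z2, 0)"
  by (cases \<beta>) simp

lemma level_tuple_lift [simp]: "level (tuple_lift p \<beta> q) = level q"
  by (cases \<beta>; cases q) auto

lemma tuple_lift_comp:
  assumes "level q \<ge> 0"
  shows "tuple_lift p (tuple_comp p \<beta> \<gamma>) q = tuple_lift p \<beta> (tuple_lift p \<gamma> q)"
proof -
  obtain z1 z2 x where q: "q = (z1, z2, x)" by (cases q)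
  show ?thesis
  proof (cases "x > 0")
    case True
    then show ?thesis
      by (simp add: q tuple_lift_pos tuple_comp_eq sum_shifted_powers algebra_simps sum.distrib)
  next
    case False
    then show ?thesis using assms by (simp add: q tuple_lift_0)
  qed
qed

definition tuple_space :: "nat \<Rightarrow> tuple set" where
  "tuple_space p = ({..<p} \<rightarrow>\<^sub>E extensional {0<..}) \<times> extensional {0<..}"

lemma tuple_space_eqI:
  assumes "\<beta> \<in> tuple_space p" "\<gamma> \<in> tuple_space p"
    and "\<And>j x. j < p \<Longrightarrow> x > 0 \<Longrightarrow> fst \<beta> j x = fst \<gamma> j x" "\<And>x. x > 0 \<Longrightarrow> snd \<beta> x = snd \<gamma> x"
  shows "\<beta> = \<gamma>"
proof (rule prod_eqI)
  have ext: "snd \<beta> \<in> extensional {0<..}" "snd \<gamma> \<in> extensional {0<..}"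
    "fst \<beta> \<in> {..<p} \<rightarrow>\<^sub>E extensional {0<..}" "fst \<gamma> \<in> {..<p} \<rightarrow>\<^sub>E extensional {0<..}"
    using assms(1,2) unfolding tuple_space_def mem_Times_iff by blast+
  show "snd \<beta> = snd \<gamma>"
    by (rule extensionalityI[OF ext(1,2)]) (simp only: assms(4) greaterThan_iff)
  show "fst \<beta> = fst \<gamma>"
  proof (rule PiE_ext[OF ext(3,4)])
    fix j assume j: "j \<in> {..<p}"
    show "fst \<beta> j = fst \<gamma> j"
      by (rule extensionalityI[OF PiE_mem[OF ext(3) j] PiE_mem[OF ext(4) j]])
        (use j in \<open>simp only: assms(3) greaterThan_iff lessThan_iff\<close>)
  qed
qed

text \<open>Tuples act faithfully on the points above the boundary. The group laws for tuples are therefore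
  obtained from those for maps.\<close>

lemma tuple_lift_inject:
  assumes "\<beta> \<in> tuple_space p" "\<gamma> \<in> tuple_space p"
    and eq: "\<And>z1 z2 x. x > 0 \<Longrightarrow> tuple_lift p \<beta> (z1, z2, x) = tuple_lift p \<gamma> (z1, z2, x)"
  shows "\<beta> = \<gamma>"
proof (rule tuple_space_eqI[OF assms(1,2)])
  fix x :: real assume x: "x > 0"
  show "snd \<beta> x = snd \<gamma> x" using eq[OF x, of 0 0] x by (simp add: tuple_lift_pos)
  have "(\<Sum>j<p. fst \<beta> j x * z ^ j) = (\<Sum>j<p. fst \<gamma> j x * z ^ j)" for z
    using eq[OF x, of 0 z] x by (simp add: tuple_lift_pos)
  then show "fst \<beta> j x = fst \<gamma> j x" if "j < p" for j
    using that by (rule sum_powers_eq_imp_coeff_eq)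
qed

text \<open>The coefficients of \<open>- (\<Sum>k<p. \<beta>1 k x * (z2 - \<beta>2 x) ^ k)\<close> in powers of \<open>z2\<close>.\<close>

definition tuple_inv :: "nat \<Rightarrow> tuple \<Rightarrow> tuple" where
  "tuple_inv p \<beta> =
    ((\<lambda>j\<in>{..<p}. \<lambda>x\<in>{0<..}. - (\<Sum>k=j..<p. of_nat (k choose j) * fst \<beta> k x * (- snd \<beta> x) ^ (k - j))),
     (\<lambda>x\<in>{0<..}. - snd \<beta> x))"

lemma tuple_lift_inv:
  assumes "x > 0"
  shows "tuple_lift p (tuple_inv p \<beta>) (z1, z2, x) =
      (z1 - (\<Sum>j<p. fst \<beta> j x * (z2 - snd \<beta> x) ^ j), z2 - snd \<beta> x, x)"
  using assms sum_shifted_powers[of "\<lambda>k. fst \<beta> k x" z2 "- snd \<beta> x" p]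
  by (simp add: tuple_lift_pos tuple_inv_def sum_negf)

lemma tuple_lift_inv_left:
  assumes "level q \<ge> 0"
  shows "tuple_lift p (tuple_inv p \<beta>) (tuple_lift p \<beta> q) = q"
proof -
  obtain z1 z2 x where q: "q = (z1, z2, x)" by (cases q)
  show ?thesis
  proof (cases "x > 0")
    case True
    then show ?thesis by (simp add: q tuple_lift_pos[of _ _ \<beta>] tuple_lift_inv)
  next
    case False
    then show ?thesis using assms by (simp add: q tuple_lift_0)
  qed
qed

lemma tuple_lift_inv_right:
  assumes "level q \<ge> 0"
  shows "tuple_lift p \<beta> (tuple_lift p (tuple_inv p \<beta>) q) = q"
proof -
  obtain z1 z2 x where q: "q = (z1, z2, x)" by (cases q)
  show ?thesis
  proof (cases "x > 0")
    case True
    then show ?thesis by (simp add: q tuple_lift_pos[of _ _ \<beta>] tuple_lift_inv)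
  next
    case False
    then show ?thesis using assms by (simp add: q tuple_lift_0)
  qed
qed

lemma tuple_space_closed:
  "tuple_comp p \<beta> \<gamma> \<in> tuple_space p" "tuple_inv p \<beta> \<in> tuple_space p"
  "((\<lambda>j\<in>{..<p}. \<lambda>x\<in>{0<..}. 0), (\<lambda>x\<in>{0<..}. 0)) \<in> tuple_space p"
  by (auto simp: tuple_comp_eq tuple_inv_def tuple_space_def)

definition smooth_tuple :: "nat \<Rightarrow> tuple \<Rightarrow> bool" where
  "smooth_tuple p \<beta> \<longleftrightarrow> (\<forall>j<p. smooth_on {0<..} (fst \<beta> j)) \<and> smooth_on {0<..} (snd \<beta>)"

lemma smooth_tuple_comp:
  assumes "smooth_tuple p \<beta>" "smooth_tuple p \<gamma>"
  shows "smooth_tuple p (tuple_comp p \<beta> \<gamma>)"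
  unfolding smooth_tuple_def
proof (intro conjI allI impI)
  fix j assume j: "j < p"
  have "smooth_on {0<..} (\<lambda>x. fst \<gamma> j x + (\<Sum>k=j..<p. of_nat (k choose j) * fst \<beta> k x * snd \<gamma> x ^ (k - j)))"
    using assms j by (intro smooth_on_intros) (auto simp: smooth_tuple_def)
  then show "smooth_on {0<..} (fst (tuple_comp p \<beta> \<gamma>) j)"
    by (rule smooth_on_cong) (use j in \<open>simp add: tuple_comp_eq\<close>)
next
  have "smooth_on {0<..} (\<lambda>x. snd \<beta> x + snd \<gamma> x)"
    using assms by (intro smooth_on_intros) (auto simp: smooth_tuple_def)
  then show "smooth_on {0<..} (snd (tuple_comp p \<beta> \<gamma>))"
    by (rule smooth_on_cong) (simp add: tuple_comp_eq)
qed

lemma smooth_tuple_inv: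
  assumes "smooth_tuple p \<beta>"
  shows "smooth_tuple p (tuple_inv p \<beta>)"
  unfolding smooth_tuple_def
proof (intro conjI allI impI)
  fix j assume j: "j < p"
  have "smooth_on {0<..} (\<lambda>x. 0 - (\<Sum>k=j..<p. of_nat (k choose j) * fst \<beta> k x * (0 - snd \<beta> x) ^ (k - j)))"
    using assms j by (intro smooth_on_intros) (auto simp: smooth_tuple_def)
  then show "smooth_on {0<..} (fst (tuple_inv p \<beta>) j)"
    by (rule smooth_on_cong) (use j in \<open>simp add: tuple_inv_def\<close>)
next
  have "smooth_on {0<..} (\<lambda>x. 0 - snd \<beta> x)"
    using assms by (intro smooth_on_intros) (auto simp: smooth_tuple_def)
  then show "smooth_on {0<..} (snd (tuple_inv p \<beta>))"
    by (rule smooth_on_cong) (simp add: tuple_inv_def)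
qed

locale reeb_solutions = reeb_component +
  fixes c :: "nat \<Rightarrow> complex"
  assumes c: "\<And>j. j < p \<Longrightarrow> c j = of_nat (p choose j) * (1 / \<mu> ^ j)"
begin

abbreviation Sol :: "tuple set" where "Sol \<equiv> solutions \<phi> \<mu> p c"

lemma mem_Sol_iff: "\<beta> \<in> Sol \<longleftrightarrow> \<beta> \<in> tuple_space p \<and> smooth_tuple p \<beta> \<and>
     (\<forall>j<p. \<forall>x>0. fst \<beta> j (\<phi> x) = \<mu> ^ (p - j) * fst \<beta> j x + c j * snd \<beta> x ^ (p - j)) \<and>
     (\<forall>x>0. snd \<beta> (\<phi> x) = \<mu> * snd \<beta> x)"
  by (cases \<beta>) (auto simp: solutions_def tuple_space_def smooth_tuple_def)

text \<open>The system of functional equations says, coefficient by coefficient in \<open>z2\<close>, that the map of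
  the covering belonging to the tuple commutes with \<open>T\<close>.\<close>

lemma functional_equations_iff_commute:
  assumes x: "x > 0"
  shows "(\<forall>j<p. fst \<beta> j (\<phi> x) = \<mu> ^ (p - j) * fst \<beta> j x + c j * snd \<beta> x ^ (p - j)) \<and>
      snd \<beta> (\<phi> x) = \<mu> * snd \<beta> x \<longleftrightarrow>
    (\<forall>z1 z2. tuple_lift p \<beta> (T (z1, z2, x)) = T (tuple_lift p \<beta> (z1, z2, x)))"
proof -
  define B where "B x z = (\<Sum>j<p. fst \<beta> j x * z ^ j)" for x z
  have px: "\<phi> x > 0" by (rule phi_pos[OF x])
  have expand: "(z + g) ^ p = z ^ p + (\<Sum>j<p. of_nat (p choose j) * g ^ (p - j) * z ^ j)" for z g :: complex
  proof -
    have "(z + g) ^ p = (\<Sum>j\<le>p. of_nat (p choose j) * z ^ j * g ^ (p - j))"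
      by (rule binomial_ring)
    also have "\<dots> = (\<Sum>j<p. of_nat (p choose j) * z ^ j * g ^ (p - j)) + z ^ p"
      by (simp add: lessThan_Suc_atMost[symmetric])
    also have "\<dots> = z ^ p + (\<Sum>j<p. of_nat (p choose j) * g ^ (p - j) * z ^ j)"
      by (simp add: mult_ac)
    finally show ?thesis .
  qed
  have rhs: "\<mu> ^ p * B x z + (z + g) ^ p - z ^ p
      = (\<Sum>j<p. (\<mu> ^ p * fst \<beta> j x + of_nat (p choose j) * g ^ (p - j)) * z ^ j)" for z g
    unfolding expand B_def by (simp add: sum_distrib_left sum.distrib algebra_simps)
  have lhs: "B (\<phi> x) (\<mu> * z) = (\<Sum>j<p. (fst \<beta> j (\<phi> x) * \<mu> ^ j) * z ^ j)" for z
    by (simp add: B_def power_mult_distrib mult_ac)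
  have L: "tuple_lift p \<beta> (T (z1, z2, x)) = (\<mu> ^ p * z1 + z2 ^ p + B (\<phi> x) (\<mu> * z2), \<mu> * z2 + snd \<beta> (\<phi> x), \<phi> x)"
    "T (tuple_lift p \<beta> (z1, z2, x)) = (\<mu> ^ p * (z1 + B x z2) + (z2 + snd \<beta> x) ^ p, \<mu> * (z2 + snd \<beta> x), \<phi> x)"
    for z1 z2 using x px by (simp_all add: tuple_lift_pos B_def)
  have first: "a * z + b + u = a * (z + d) + e \<longleftrightarrow> u = a * d + e - b" for a b d e u z :: complex
  proof -
    have "a * z + b + u = a * (z + d) + e \<longleftrightarrow> u + b = a * d + e"
      by (simp add: distrib_left add.assoc add.commute[of b u])
    then show ?thesis by (simp add: eq_diff_eq)
  qed
  have second: "a * z + u = a * (z + d) \<longleftrightarrow> u = a * d" for a d u z :: complex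
    by (simp add: distrib_left)
  have "(\<forall>z1 z2. tuple_lift p \<beta> (T (z1, z2, x)) = T (tuple_lift p \<beta> (z1, z2, x))) \<longleftrightarrow>
      snd \<beta> (\<phi> x) = \<mu> * snd \<beta> x \<and> (\<forall>z. B (\<phi> x) (\<mu> * z) = \<mu> ^ p * B x z + (z + snd \<beta> x) ^ p - z ^ p)"
    unfolding L prod.inject first second by blast
  also have "(\<forall>z. B (\<phi> x) (\<mu> * z) = \<mu> ^ p * B x z + (z + snd \<beta> x) ^ p - z ^ p) \<longleftrightarrow>
      (\<forall>j<p. fst \<beta> j (\<phi> x) * \<mu> ^ j = \<mu> ^ p * fst \<beta> j x + of_nat (p choose j) * snd \<beta> x ^ (p - j))"
    unfolding lhs rhs
  proof (intro iffI allI impI)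
    fix j assume "\<forall>z. (\<Sum>j<p. fst \<beta> j (\<phi> x) * \<mu> ^ j * z ^ j)
        = (\<Sum>j<p. (\<mu> ^ p * fst \<beta> j x + of_nat (p choose j) * snd \<beta> x ^ (p - j)) * z ^ j)" "j < p"
    then show "fst \<beta> j (\<phi> x) * \<mu> ^ j = \<mu> ^ p * fst \<beta> j x + of_nat (p choose j) * snd \<beta> x ^ (p - j)"
      using sum_powers_eq_imp_coeff_eq[where p = p and j = j and a = "\<lambda>j. fst \<beta> j (\<phi> x) * \<mu> ^ j"
          and b = "\<lambda>j. \<mu> ^ p * fst \<beta> j x + of_nat (p choose j) * snd \<beta> x ^ (p - j)"] by blast
  next
    fix z assume *: "\<forall>j<p. fst \<beta> j (\<phi> x) * \<mu> ^ j = \<mu> ^ p * fst \<beta> j x + of_nat (p choose j) * snd \<beta> x ^ (p - j)"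
    show "(\<Sum>j<p. fst \<beta> j (\<phi> x) * \<mu> ^ j * z ^ j)
        = (\<Sum>j<p. (\<mu> ^ p * fst \<beta> j x + of_nat (p choose j) * snd \<beta> x ^ (p - j)) * z ^ j)"
      by (intro sum.cong refl) (simp only: * lessThan_iff)
  qed
  also have "\<dots> \<longleftrightarrow> (\<forall>j<p. fst \<beta> j (\<phi> x) = \<mu> ^ (p - j) * fst \<beta> j x + c j * snd \<beta> x ^ (p - j))"
  proof (intro all_cong1 imp_cong refl)
    fix j assume j: "j < p"
    then have "\<mu> ^ p = \<mu> ^ (p - j) * \<mu> ^ j" by (simp flip: power_add)
    then show "fst \<beta> j (\<phi> x) * \<mu> ^ j = \<mu> ^ p * fst \<beta> j x + of_nat (p choose j) * snd \<beta> x ^ (p - j) \<longleftrightarrow>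
        fst \<beta> j (\<phi> x) = \<mu> ^ (p - j) * fst \<beta> j x + c j * snd \<beta> x ^ (p - j)"
      using mu_nz by (simp add: c[OF j] field_simps)
  qed
  finally show ?thesis by blast
qed

lemma Sol_iff_commute:
  "\<beta> \<in> Sol \<longleftrightarrow> \<beta> \<in> tuple_space p \<and> smooth_tuple p \<beta> \<and>
     (\<forall>q. level q > 0 \<longrightarrow> tuple_lift p \<beta> (T q) = T (tuple_lift p \<beta> q))"
proof -
  have "(\<forall>q. level q > 0 \<longrightarrow> tuple_lift p \<beta> (T q) = T (tuple_lift p \<beta> q)) \<longleftrightarrow>
      (\<forall>x>0. \<forall>z1 z2. tuple_lift p \<beta> (T (z1, z2, x)) = T (tuple_lift p \<beta> (z1, z2, x)))"
    by (metis prod.collapse snd_conv)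
  then show ?thesis
    unfolding mem_Sol_iff using functional_equations_iff_commute by blast
qed

lemma Sol_commute: "\<beta> \<in> Sol \<Longrightarrow> level q > 0 \<Longrightarrow> tuple_lift p \<beta> (T q) = T (tuple_lift p \<beta> q)"
  unfolding Sol_iff_commute by blast

lemma level_T [simp]: "level (T q) = \<phi> (level q)"
  by (simp add: T_eq)

lemma Sol_comp:
  assumes "\<beta> \<in> Sol" "\<gamma> \<in> Sol"
  shows "tuple_comp p \<beta> \<gamma> \<in> Sol"
  unfolding Sol_iff_commute
proof (intro conjI allI impI)
  show "smooth_tuple p (tuple_comp p \<beta> \<gamma>)"
    using assms by (intro smooth_tuple_comp) (simp_all add: mem_Sol_iff)
  fix q :: point assume q: "level q > 0"
  then show "tuple_lift p (tuple_comp p \<beta> \<gamma>) (T q) = T (tuple_lift p (tuple_comp p \<beta> \<gamma>) q)"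
    by (simp add: tuple_lift_comp phi_nonneg Sol_commute[OF assms(1)] Sol_commute[OF assms(2)]
        del: reeb_T.simps)
qed (rule tuple_space_closed)

lemma Sol_inv:
  assumes "\<beta> \<in> Sol"
  shows "tuple_inv p \<beta> \<in> Sol"
  unfolding Sol_iff_commute
proof (intro conjI allI impI)
  fix q :: point assume q: "level q > 0"
  define r where "r = tuple_lift p (tuple_inv p \<beta>) q"
  have r: "level r > 0" "tuple_lift p \<beta> r = q"
    using q by (auto simp: r_def tuple_lift_inv_right)
  have "tuple_lift p (tuple_inv p \<beta>) (T q) = tuple_lift p (tuple_inv p \<beta>) (tuple_lift p \<beta> (T r))"
    using Sol_commute[OF assms r(1)] r(2) by simp
  also have "\<dots> = T r"
    using r(1) by (intro tuple_lift_inv_left) (simp add: phi_nonneg)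
  finally show "tuple_lift p (tuple_inv p \<beta>) (T q) = T (tuple_lift p (tuple_inv p \<beta>) q)"
    by (simp add: r_def)
qed (use assms in \<open>simp_all add: mem_Sol_iff tuple_space_closed smooth_tuple_inv\<close>)

abbreviation tuple_one :: tuple where
  "tuple_one \<equiv> ((\<lambda>j\<in>{..<p}. \<lambda>x\<in>{0<..}. 0), (\<lambda>x\<in>{0<..}. 0))"

lemma tuple_lift_one: "level q \<ge> 0 \<Longrightarrow> tuple_lift p tuple_one q = q"
  by (cases q, cases "level q > 0") (auto simp: tuple_lift_pos tuple_lift_0 simp del: tuple_lift.simps)

lemma Sol_one: "tuple_one \<in> Sol"
proof -
  have "smooth_tuple p tuple_one"
  proof -
    have "smooth_on {0<..} (\<lambda>x\<in>{0::real<..}. 0 :: complex)"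
      by (rule smooth_on_cong[OF smooth_on_const[of _ 0]]) simp
    then show ?thesis by (simp add: smooth_tuple_def)
  qed
  then show ?thesis
    using p by (auto simp: mem_Sol_iff tuple_space_closed phi_pos)
qed

lemma Sol_tuple_space: "\<beta> \<in> Sol \<Longrightarrow> \<beta> \<in> tuple_space p"
  by (simp add: mem_Sol_iff)

lemma group_solution_group: "group (solution_group \<phi> \<mu> p c)"
proof (rule groupI)
  fix \<alpha> \<beta> \<gamma>
  assume "\<alpha> \<in> carrier (solution_group \<phi> \<mu> p c)" "\<beta> \<in> carrier (solution_group \<phi> \<mu> p c)"
    "\<gamma> \<in> carrier (solution_group \<phi> \<mu> p c)"
  then have S: "\<alpha> \<in> Sol" "\<beta> \<in> Sol" "\<gamma> \<in> Sol" by (auto simp: solution_group_def)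
  show "\<alpha> \<otimes>\<^bsub>solution_group \<phi> \<mu> p c\<^esub> \<beta> \<in> carrier (solution_group \<phi> \<mu> p c)"
    using Sol_comp[OF S(1,2)] by (simp add: solution_group_def)
  have "tuple_comp p (tuple_comp p \<alpha> \<beta>) \<gamma> = tuple_comp p \<alpha> (tuple_comp p \<beta> \<gamma>)"
    by (rule tuple_lift_inject[of _ p]) (simp_all add: tuple_space_closed tuple_lift_comp del: tuple_lift.simps)
  then show "\<alpha> \<otimes>\<^bsub>solution_group \<phi> \<mu> p c\<^esub> \<beta> \<otimes>\<^bsub>solution_group \<phi> \<mu> p c\<^esub> \<gamma>
      = \<alpha> \<otimes>\<^bsub>solution_group \<phi> \<mu> p c\<^esub> (\<beta> \<otimes>\<^bsub>solution_group \<phi> \<mu> p c\<^esub> \<gamma>)"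
    by (simp add: solution_group_def)
next
  fix \<beta> assume "\<beta> \<in> carrier (solution_group \<phi> \<mu> p c)"
  then have S: "\<beta> \<in> Sol" by (simp add: solution_group_def)
  have "tuple_comp p tuple_one \<beta> = \<beta>"
    by (rule tuple_lift_inject[of _ p])
      (simp_all add: tuple_space_closed Sol_tuple_space[OF S] tuple_lift_comp tuple_lift_one del: tuple_lift.simps)
  then show "\<one>\<^bsub>solution_group \<phi> \<mu> p c\<^esub> \<otimes>\<^bsub>solution_group \<phi> \<mu> p c\<^esub> \<beta> = \<beta>"
    by (simp add: solution_group_def)
  have "tuple_comp p (tuple_inv p \<beta>) \<beta> = tuple_one"
    by (rule tuple_lift_inject[of _ p])
      (simp_all add: tuple_space_closed tuple_lift_comp tuple_lift_one tuple_lift_inv_left del: tuple_lift.simps)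
  then show "\<exists>\<gamma>\<in>carrier (solution_group \<phi> \<mu> p c).
      \<gamma> \<otimes>\<^bsub>solution_group \<phi> \<mu> p c\<^esub> \<beta> = \<one>\<^bsub>solution_group \<phi> \<mu> p c\<^esub>"
    using Sol_inv[OF S] by (intro bexI[of _ "tuple_inv p \<beta>"]) (auto simp: solution_group_def)
qed (use Sol_one in \<open>simp add: solution_group_def\<close>)

subsection \<open>The automorphism of a tuple\<close>

text \<open>\<open>\<beta>2\<close> comes first, because a power of it is the inhomogeneous term in the equations for the other
  components.\<close>

lemma Sol_jet:
  assumes "\<beta> \<in> Sol"
  shows "jet_order k n (snd \<beta>)" "j < p \<Longrightarrow> jet_order k n (fst \<beta> j)"
proof -
  have sm: "smooth_on {0<..} (snd \<beta>)" using assms by (simp add: mem_Sol_iff smooth_tuple_def)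
  have "vderiv (\<lambda>x::real. 0::complex) = (\<lambda>x. 0)"
    by (rule ext) (simp add: vderiv_def)
  then have "jet_order k n (\<lambda>x::real. 0::complex)"
    by (induction n) (auto simp: order_at_0_def intro!: exI[of _ 0])
  then show s: "jet_order k n (snd \<beta>)"
    using assms mu by (intro jet_order_eigen_equation[OF mu sm smooth_on_const[of _ 0]]) (auto simp: mem_Sol_iff)
  assume j: "j < p"
  have "jet_order k n (\<lambda>x. c j * snd \<beta> x ^ (p - j))"
    by (rule jet_order_linear[OF bounded_linear_mult_right smooth_on_power[OF sm]])
      (rule jet_order_power[OF sm s], use j in simp)
  moreover have "norm (\<mu> ^ (p - j)) > 1"
    using mu j by (simp add: norm_power)
  ultimately show "jet_order k n (fst \<beta> j)"
    using assms j by (intro jet_order_eigen_equation[of "\<mu> ^ (p - j)" "fst \<beta> j" "\<lambda>x. c j * snd \<beta> x ^ (p - j)"])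
      (auto simp: mem_Sol_iff smooth_tuple_def intro!: smooth_on_intros)
qed

lemma Sol_zero_extension:
  assumes "\<beta> \<in> Sol"
  shows "smooth_on UNIV (\<lambda>x. if x > 0 then snd \<beta> x else 0)"
    and "j < p \<Longrightarrow> smooth_on UNIV (\<lambda>x. if x > 0 then fst \<beta> j x else 0)"
  using assms zero_extension_smooth[OF _ Sol_jet(1)[OF assms]] zero_extension_smooth[OF _ Sol_jet(2)[OF assms]]
  by (auto simp: smooth_on_open_iff mem_Sol_iff smooth_tuple_def)

lemma leafwise_tuple_lift:
  assumes S: "\<beta> \<in> Sol"
  shows "leafwise (tuple_lift p \<beta>)"
  unfolding leafwise_def
proof (intro conjI ballI allI impI)
  define b1 where "b1 j x = (if x > 0 then fst \<beta> j x else 0)" for j and x :: real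
  define b2 where "b2 x = (if x > 0 then snd \<beta> x else 0)" for x :: real
  have eq: "(fst q + (\<Sum>j<p. b1 j (level q) * fst (snd q) ^ j), fst (snd q) + b2 (level q), level q)
      = tuple_lift p \<beta> q" for q
    by (cases q; cases \<beta>) (simp add: b1_def b2_def)
  have "smooth_on UNIV (b1 j)" if "j < p" for j
    unfolding b1_def using Sol_zero_extension(2)[OF S that] .
  then have sm1: "smooth_on Rtilde (\<lambda>q. b1 j (level q))" if "j < p" for j
    using that by (intro smooth_on_compose[of Rtilde level UNIV "b1 j"] smooth_on_snd smooth_on_id) auto
  have "smooth_on UNIV b2"
    unfolding b2_def using Sol_zero_extension(1)[OF S] .
  then have sm2: "smooth_on Rtilde (\<lambda>q. b2 (level q))"
    by (intro smooth_on_compose[of Rtilde level UNIV b2] smooth_on_snd smooth_on_id) auto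
  have "smooth_on Rtilde (\<lambda>q. (fst q + (\<Sum>j<p. b1 j (level q) * fst (snd q) ^ j), fst (snd q) + b2 (level q), level q))"
    by (intro smooth_on_Pair smooth_on_add smooth_on_sum smooth_on_mult smooth_on_power smooth_on_fst
        smooth_on_snd smooth_on_id sm1 sm2) auto
  then show "smooth_on Rtilde (tuple_lift p \<beta>)" by (simp only: eq)
  have "tuple_lift p \<beta> q \<in> Rtilde" if "q \<in> Rtilde" for q
  proof (cases "level q > 0")
    case False
    then have "level q = 0" using that by (simp add: Rtilde_iff)
    then show ?thesis using that tuple_lift_0 by (cases q) (auto simp del: tuple_lift.simps)
  next
    case True
    then have "level (tuple_lift p \<beta> q) > 0" by simp
    then show ?thesis unfolding Rtilde_iff by (metis less_eq_real_def snd_zero less_irrefl)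
  qed
  then show "tuple_lift p \<beta> ` Rtilde \<subseteq> Rtilde" by blast
  show "holomorphic2_on (\<lambda>w. planar (tuple_lift p \<beta> (at_level x w))) (leaf_plane x)" for x
    unfolding eq[symmetric]
    by (auto simp: holomorphic2_on_iff_cdiff planar_def at_level_def intro!: cdiff_intros)
qed simp

lemma tuple_equivariant_pair:
  assumes S: "\<beta> \<in> Sol"
  shows "equivariant_pair (tuple_lift p \<beta>) (tuple_lift p (tuple_inv p \<beta>))"
  unfolding equivariant_pair_def
proof (intro conjI ballI)
  show "leafwise (tuple_lift p \<beta>)" "leafwise (tuple_lift p (tuple_inv p \<beta>))"
    using leafwise_tuple_lift S Sol_inv by auto
  show "tuple_lift p (tuple_inv p \<beta>) (tuple_lift p \<beta> q) = q" "tuple_lift p \<beta> (tuple_lift p (tuple_inv p \<beta>) q) = q"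
    if "q \<in> Rtilde" for q
    using that by (auto simp: Rtilde_iff tuple_lift_inv_left tuple_lift_inv_right)
  have level0: "tuple_lift p \<beta> q = q" if "level q = 0" for q
    using that tuple_lift_0 by (cases q) (auto simp del: tuple_lift.simps)
  then show "tuple_lift p \<beta> q = q" if "q \<in> leaf_tilde 0" for q
    using that by (simp add: leaf_tilde_def)
  show "tuple_lift p \<beta> (T q) = T (tuple_lift p \<beta> q)" if q: "q \<in> Rtilde" for q
  proof (cases "level q > 0")
    case True
    then show ?thesis by (rule Sol_commute[OF S])
  next
    case False
    then have "level q = 0" using q by (simp add: Rtilde_iff)
    then show ?thesis using level0[of q] level0[of "T q"] phi_0 by simp
  qed
qed

lemma tuple_aut_eq_induced: "tuple_aut T p \<beta> = induced (tuple_lift p \<beta>)"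
  by (simp add: tuple_aut_def induced_def)

lemma tuple_aut_mon: "tuple_aut T p \<in> mon (solution_group \<phi> \<mu> p c) (Aut_rel T)"
  unfolding mon_def hom_def mem_Collect_eq
proof (intro conjI ballI funcsetI inj_onI)
  fix \<beta> assume "\<beta> \<in> carrier (solution_group \<phi> \<mu> p c)"
  then have S: "\<beta> \<in> Sol" by (simp add: solution_group_def)
  show "tuple_aut T p \<beta> \<in> carrier (Aut_rel T)"
    unfolding tuple_aut_eq_induced by (rule induced_in_Aut_rel[OF tuple_equivariant_pair[OF S]])
  fix \<gamma> assume "\<gamma> \<in> carrier (solution_group \<phi> \<mu> p c)"
  then have S': "\<gamma> \<in> Sol" by (simp add: solution_group_def)
  have "induced (tuple_lift p (tuple_comp p \<beta> \<gamma>)) = induced (\<lambda>q. tuple_lift p \<beta> (tuple_lift p \<gamma> q))"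
    by (rule induced_cong) (simp add: tuple_lift_comp Rtilde_iff)
  then show "tuple_aut T p (\<beta> \<otimes>\<^bsub>solution_group \<phi> \<mu> p c\<^esub> \<gamma>) = tuple_aut T p \<beta> \<otimes>\<^bsub>Aut_rel T\<^esub> tuple_aut T p \<gamma>"
    using mult_Aut_rel[OF tuple_equivariant_pair[OF S] tuple_equivariant_pair[OF S']]
    by (simp add: tuple_aut_eq_induced solution_group_def)
  assume eq: "tuple_aut T p \<beta> = tuple_aut T p \<gamma>"
  show "\<beta> = \<gamma>"
  proof (rule tuple_lift_inject[OF Sol_tuple_space[OF S] Sol_tuple_space[OF S']])
    fix z1 z2 :: complex and x :: real assume "x > 0"
    then show "tuple_lift p \<beta> (z1, z2, x) = tuple_lift p \<gamma> (z1, z2, x)"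
      by (intro equivariant_pair_unique[OF tuple_equivariant_pair[OF S] tuple_equivariant_pair[OF S']
          eq[unfolded tuple_aut_eq_induced]]) (simp add: Rtilde_iff zero_prod_def)
  qed
qed

end

section \<open>Leaf-preserving automorphisms are polynomial along the leaves\<close>

text \<open>Cauchy's estimate on the circles of radius \<open>r n\<close> kills all Taylor coefficients of order at
  least \<open>m\<close>.\<close>

lemma entire_small_on_circles_polynomial:
  fixes g :: "complex \<Rightarrow> complex" and r :: "nat \<Rightarrow> real"
  assumes hol: "g holomorphic_on UNIV" and r: "filterlim r at_top sequentially"
    and small: "\<And>e. e > 0 \<Longrightarrow> \<forall>\<^sub>F n in sequentially. \<forall>z::complex. norm z = r n \<longrightarrow> norm (g z) \<le> e * r n ^ m"
  shows "g z = (\<Sum>k<m. (deriv ^^ k) g 0 / fact k * z ^ k)"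
proof -
  have zero: "(deriv ^^ k) g 0 = 0" if k: "k \<ge> m" for k
  proof -
    have "norm ((deriv ^^ k) g 0) \<le> 0 + e" if e: "e > 0" for e :: real
    proof -
      have "\<forall>\<^sub>F n in sequentially. r n \<ge> 1" using r by (simp add: filterlim_at_top)
      with small[of "e / fact k"] e obtain n where n: "r n \<ge> 1"
        "\<And>z. norm z = r n \<Longrightarrow> norm (g z) \<le> e / fact k * r n ^ m"
        using eventually_happens[OF eventually_conj] by fastforce
      have "norm ((deriv ^^ k) g 0) \<le> fact k * (e / fact k * r n ^ m) / r n ^ k"
        by (rule Cauchy_inequality)
          (use n hol in \<open>auto intro: holomorphic_on_subset holomorphic_on_imp_continuous_on\<close>)
      also have "\<dots> = e * (r n ^ m / r n ^ k)" by simp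
      also have "r n ^ m / r n ^ k \<le> 1"
        using n(1) k by (simp add: power_increasing)
      finally show ?thesis using e by simp
    qed
    then have "norm ((deriv ^^ k) g 0) \<le> 0" by (rule field_le_epsilon)
    then show ?thesis by simp
  qed
  have "(\<lambda>k. (deriv ^^ k) g 0 / fact k * (z - 0) ^ k) sums g z"
    by (rule holomorphic_power_series[of g 0 "norm z + 1"]) (use hol in \<open>auto intro: holomorphic_on_subset\<close>)
  moreover have "(\<lambda>k. (deriv ^^ k) g 0 / fact k * (z - 0) ^ k) sums (\<Sum>k<m. (deriv ^^ k) g 0 / fact k * (z - 0) ^ k)"
    by (rule sums_finite) (auto simp: zero)
  ultimately show ?thesis using sums_unique2 by fastforce
qed

lemma cdiff_slice:
  assumes "\<And>w. cdiff g w"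
  shows "(\<lambda>z. g (z, b)) holomorphic_on UNIV" "(\<lambda>z. g (b, z)) holomorphic_on UNIV"
proof -
  have "(\<lambda>z. g (z, b)) field_differentiable at z" for z
  proof -
    obtain k l where D: "(g has_derivative (\<lambda>v. k * fst v + l * snd v)) (at (z, b))"
      using assms unfolding cdiff_def by blast
    have "((\<lambda>z. (z, b)) has_derivative (\<lambda>v. (v, 0))) (at z)"
      by (auto intro!: derivative_eq_intros)
    from diff_chain_at[OF this D] have "((\<lambda>z. g (z, b)) has_derivative (\<lambda>v. k * v)) (at z)"
      by (simp add: o_def)
    then show ?thesis unfolding field_differentiable_def has_field_derivative_def by blast
  qed
  then show "(\<lambda>z. g (z, b)) holomorphic_on UNIV"
    by (simp add: holomorphic_on_def field_differentiable_at_within)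
  have "(\<lambda>z. g (b, z)) field_differentiable at z" for z
  proof -
    obtain k l where D: "(g has_derivative (\<lambda>v. k * fst v + l * snd v)) (at (b, z))"
      using assms unfolding cdiff_def by blast
    have "((\<lambda>z. (b, z)) has_derivative (\<lambda>v. (0, v))) (at z)"
      by (auto intro!: derivative_eq_intros)
    from diff_chain_at[OF this D] have "((\<lambda>z. g (b, z)) has_derivative (\<lambda>v. l * v)) (at z)"
      by (simp add: o_def)
    then show ?thesis unfolding field_differentiable_def has_field_derivative_def by blast
  qed
  then show "(\<lambda>z. g (b, z)) holomorphic_on UNIV"
    by (simp add: holomorphic_on_def field_differentiable_at_within)
qed

text \<open>The coefficients of a polynomial in \<open>z\<close> of degree below \<open>p\<close> are linear combinations of its
  values at the \<open>p\<close>-th roots of unity.\<close>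

lemma coefficient_by_roots_of_unity:
  assumes "j < p"
  obtains w d :: "nat \<Rightarrow> complex"
  where "\<And>a :: nat \<Rightarrow> complex. a j = (\<Sum>k<p. d k * (\<Sum>l<p. a l * w k ^ l))"
proof -
  define \<omega> where "\<omega> = exp (2 * of_real pi * \<i> * of_nat 1 / of_nat p)"
  have p: "1 \<le> p" using assms by simp
  have pw: "\<omega> ^ l = exp (2 * of_real pi * \<i> * of_nat l / of_nat p)" for l
    by (simp add: \<omega>_def mult_ac flip: exp_of_nat_mult)
  have wp: "\<omega> ^ p = 1" using p by (simp add: pw exp_two_pi_i' flip: mult.assoc)
  have nz: "\<omega> \<noteq> 0" by (simp add: \<omega>_def)
  have orth: "(\<Sum>k<p. (\<omega> ^ l / \<omega> ^ j) ^ k) = (if l = j then of_nat p else 0)" if l: "l < p" for l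
  proof (cases "l = j")
    case False
    have "\<omega> ^ l \<noteq> \<omega> ^ j"
      using complex_root_unity_eq[OF p, of l j] False l assms by (simp add: pw cong_def)
    then have "\<omega> ^ l / \<omega> ^ j \<noteq> 1" using nz by simp
    then have "(\<Sum>k<p. (\<omega> ^ l / \<omega> ^ j) ^ k) = ((\<omega> ^ l / \<omega> ^ j) ^ p - 1) / (\<omega> ^ l / \<omega> ^ j - 1)"
      by (rule geometric_sum)
    also have "(\<omega> ^ l / \<omega> ^ j) ^ p = 1"
    proof -
      have "(\<omega> ^ m) ^ p = 1" for m by (metis mult.commute power_mult power_one wp)
      then show ?thesis by (simp add: power_divide)
    qed
    finally show ?thesis using False by simp
  qed (use nz in simp)
  show ?thesis
  proof (rule that[of "\<lambda>k. 1 / (of_nat p * (\<omega> ^ j) ^ k)" "\<lambda>k. \<omega> ^ k"])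
    fix a :: "nat \<Rightarrow> complex"
    have "(\<Sum>k<p. 1 / (of_nat p * (\<omega> ^ j) ^ k) * (\<Sum>l<p. a l * (\<omega> ^ k) ^ l))
        = (\<Sum>k<p. \<Sum>l<p. a l / of_nat p * (\<omega> ^ l / \<omega> ^ j) ^ k)"
      by (simp add: sum_distrib_left power_divide mult_ac flip: power_mult)
    also have "\<dots> = (\<Sum>l<p. a l / of_nat p * (\<Sum>k<p. (\<omega> ^ l / \<omega> ^ j) ^ k))"
      by (subst sum.swap) (simp add: sum_distrib_left)
    also have "\<dots> = (\<Sum>l<p. if l = j then a l else 0)"
      by (intro sum.cong refl) (use p in \<open>auto simp: orth\<close>)
    also have "\<dots> = a j" using assms by simp
    finally show "a j = (\<Sum>k<p. 1 / (of_nat p * (\<omega> ^ j) ^ k) * (\<Sum>l<p. a l * (\<omega> ^ k) ^ l))" ..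
  qed
qed

lemma norm_binomial_diff_le:
  fixes w h :: complex
  assumes "norm w = 1" "norm h \<le> 1" "p > 0"
  shows "norm ((w + h) ^ p - w ^ p) \<le> 2 ^ p * norm h"
proof -
  have "(w + h) ^ p = (\<Sum>j\<le>p. of_nat (p choose j) * w ^ j * h ^ (p - j))"
    by (rule binomial_ring)
  then have "(w + h) ^ p - w ^ p = (\<Sum>j<p. of_nat (p choose j) * w ^ j * h ^ (p - j))"
    by (simp add: lessThan_Suc_atMost[symmetric])
  then have "norm ((w + h) ^ p - w ^ p) \<le> (\<Sum>j<p. norm (of_nat (p choose j) * w ^ j * h ^ (p - j)))"
    by (simp add: norm_sum)
  also have "\<dots> \<le> (\<Sum>j<p. real (p choose j) * norm h)"
  proof (rule sum_mono)
    fix j assume "j \<in> {..<p}"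
    then have "norm h ^ (p - j) \<le> norm h ^ 1"
      using assms(2) by (intro power_decreasing) auto
    then show "norm (of_nat (p choose j) * w ^ j * h ^ (p - j)) \<le> real (p choose j) * norm h"
      using assms(1) by (simp add: norm_mult norm_power mult_left_mono)
  qed
  also have "\<dots> = real (\<Sum>j<p. p choose j) * norm h"
    by (simp add: sum_distrib_right)
  also have "\<dots> \<le> real (2 ^ p) * norm h"
  proof (intro mult_right_mono of_nat_mono norm_ge_zero)
    have "(\<Sum>j<p. p choose j) \<le> (\<Sum>j\<le>p. p choose j)" by (rule sum_mono2) auto
    then show "(\<Sum>j<p. p choose j) \<le> 2 ^ p" by (simp add: choose_row_sum)
  qed
  finally show ?thesis by simp
qed

text \<open>A lift that maps each leaf of \<open>Rtilde\<close> to itself.\<close>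

locale vertical_pair = reeb_solutions +
  fixes F G :: "point \<Rightarrow> point"
  assumes FG: "equivariant_pair F G" and lev: "\<And>q. q \<in> Rtilde \<Longrightarrow> level (F q) = level q"
begin

lemmas F_props = equivariant_pairD[OF FG]

definition xi1 :: "complex \<Rightarrow> complex \<Rightarrow> real \<Rightarrow> complex" where "xi1 z1 z2 x = fst (F (z1, z2, x))"
definition xi2 :: "complex \<Rightarrow> complex \<Rightarrow> real \<Rightarrow> complex" where "xi2 z1 z2 x = fst (snd (F (z1, z2, x)))"

lemma F_xi: "x > 0 \<Longrightarrow> F (z1, z2, x) = (xi1 z1 z2 x, xi2 z1 z2 x, x)"
  using lev[of "(z1, z2, x)"] by (simp add: xi1_def xi2_def Rtilde_iff zero_prod_def prod_eq_iff)

lemma xi_holomorphic: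
  assumes "x > 0"
  shows "(\<lambda>z. xi1 z b x) holomorphic_on UNIV" "(\<lambda>z. xi1 b z x) holomorphic_on UNIV"
    "(\<lambda>z. xi2 z b x) holomorphic_on UNIV" "(\<lambda>z. xi2 b z x) holomorphic_on UNIV"
proof -
  have "cdiff (\<lambda>w. fst (F (fst w, snd w, x))) w" "cdiff (\<lambda>w. fst (snd (F (fst w, snd w, x)))) w" for w
    using leafwise_holomorphic[OF F_props(1), of x] assms
    unfolding leaf_plane_pos[OF assms] holomorphic2_on_iff_cdiff planar_def at_level_def fst_conv snd_conv
    by (simp_all only: less_imp_le UNIV_I)
  from cdiff_slice[OF this(1), of b] cdiff_slice[OF this(2), of b]
  show "(\<lambda>z. xi1 z b x) holomorphic_on UNIV" "(\<lambda>z. xi1 b z x) holomorphic_on UNIV"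
    "(\<lambda>z. xi2 z b x) holomorphic_on UNIV" "(\<lambda>z. xi2 b z x) holomorphic_on UNIV"
    by (simp_all add: xi1_def xi2_def)
qed

text \<open>Following the orbit of \<open>(z1, z2, x)\<close> back by \<open>n\<close> steps, where \<open>n\<close> may depend on the size of the
  point, one arrives near the boundary, where \<open>F\<close> is close to the identity.\<close>

lemma xi_transport:
  fixes n :: nat and w1 w2 :: complex
  assumes x: "x > 0"
  defines "y \<equiv> (psi ^^ n) x"
  defines "z1 \<equiv> (\<mu> ^ p) ^ n * (w1 + of_nat n * (w2 / \<mu>) ^ p)" and "z2 \<equiv> \<mu> ^ n * w2"
  shows "xi2 z1 z2 x - z2 = \<mu> ^ n * (xi2 w1 w2 y - w2)"
    and "xi1 z1 z2 x - z1 = (\<mu> ^ p) ^ n * ((xi1 w1 w2 y - w1)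
      + of_nat n * ((xi2 w1 w2 y / \<mu>) ^ p - (w2 / \<mu>) ^ p))"
proof -
  have y: "y > 0" unfolding y_def by (rule psi_pow_pos[OF x])
  have R: "(w1, w2, y) \<in> Rtilde" using y by (simp add: Rtilde_iff zero_prod_def)
  have z: "deck (int n) (w1, w2, y) = (z1, z2, x)"
    using x by (simp add: deck_of_nat T_pow z1_def z2_def y_def phi_pow_psi_pow)
  have "F (z1, z2, x) = deck (int n) (F (w1, w2, y))"
    using equivariant_deck[OF FG R, of "int n"] z by simp
  then have "(xi1 z1 z2 x, xi2 z1 z2 x, x)
      = ((\<mu> ^ p) ^ n * (xi1 w1 w2 y + of_nat n * (xi2 w1 w2 y / \<mu>) ^ p), \<mu> ^ n * xi2 w1 w2 y, (\<phi> ^^ n) y)"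
    unfolding F_xi[OF x] F_xi[OF y] deck_of_nat T_pow fst_conv snd_conv .
  then have "xi1 z1 z2 x = (\<mu> ^ p) ^ n * (xi1 w1 w2 y + of_nat n * (xi2 w1 w2 y / \<mu>) ^ p)"
    "xi2 z1 z2 x = \<mu> ^ n * xi2 w1 w2 y" unfolding prod.inject by blast+
  then show "xi2 z1 z2 x - z2 = \<mu> ^ n * (xi2 w1 w2 y - w2)"
    "xi1 z1 z2 x - z1 = (\<mu> ^ p) ^ n * ((xi1 w1 w2 y - w1)
      + of_nat n * ((xi2 w1 w2 y / \<mu>) ^ p - (w2 / \<mu>) ^ p))"
    by (simp_all add: z1_def z2_def algebra_simps)
qed

lemma uniformly_close_to_identity:
  assumes x: "x > 0" and e: "e > 0"
  shows "\<forall>\<^sub>F n in sequentially. \<forall>w1 w2. 1 / 2 \<le> norm (w1, w2) \<and> norm (w1, w2) \<le> 2 \<longrightarrow>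
      norm (xi1 w1 w2 ((psi ^^ n) x) - w1) < e \<and> norm (xi2 w1 w2 ((psi ^^ n) x) - w2) < e"
proof -
  define K where "K = (cball 0 2 - ball 0 (1 / 2) :: (complex \<times> complex) set)"
  define f where "f v = F (fst (fst v), snd (fst v), snd v)" for v :: "(complex \<times> complex) \<times> real"
  have "compact K" unfolding K_def by (intro compact_diff compact_cball open_ball)
  then have "compact (K \<times> {0..x})" by (intro compact_Times) auto
  have in_R: "(fst (fst v), snd (fst v), snd v) \<in> Rtilde" if "v \<in> K \<times> {0..x}" for v
    using that by (auto simp: K_def Rtilde_iff zero_prod_def)
  have "continuous_on (K \<times> {0..x}) f"
    unfolding f_def
    by (rule continuous_on_compose2[OF leafwise_continuous_on[OF F_props(1)]])
      (use in_R in \<open>auto intro!: continuous_intros\<close>)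
  then have "uniformly_continuous_on (K \<times> {0..x}) f"
    by (rule compact_uniformly_continuous) fact
  then obtain d where d: "d > 0" "\<And>u v. u \<in> K \<times> {0..x} \<Longrightarrow> v \<in> K \<times> {0..x} \<Longrightarrow> dist v u < d \<Longrightarrow> dist (f v) (f u) < e"
    unfolding uniformly_continuous_on_def using e by metis
  have "\<forall>\<^sub>F n in sequentially. (psi ^^ n) x < min d x"
    using psi_pow_tendsto_0[of x] x d(1) by (intro order_tendstoD) auto
  then show ?thesis
  proof eventually_elim
    case (elim n)
    define y where "y = (psi ^^ n) x"
    have y: "y > 0" "y < d" "y < x" using elim psi_pow_pos[OF x] by (auto simp: y_def)
    show ?case
    proof (intro allI impI)
      fix w1 w2 :: complex assume "1 / 2 \<le> norm (w1, w2) \<and> norm (w1, w2) \<le> 2"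
      then have wK: "(w1, w2) \<in> K" by (auto simp: K_def)
      then have "dist (f ((w1, w2), y)) (f ((w1, w2), 0)) < e"
        using y by (intro d(2)) (auto simp: dist_Pair_Pair dist_real_def)
      moreover have "f ((w1, w2), 0) = (w1, w2, 0)"
      proof -
        have "(w1, w2, 0) \<in> leaf_tilde 0"
          using in_R[of "((w1, w2), 0)"] wK x by (simp add: leaf_tilde_def)
        then show ?thesis by (simp add: f_def F_props(6))
      qed
      moreover have "f ((w1, w2), y) = (xi1 w1 w2 y, xi2 w1 w2 y, y)"
        unfolding f_def using F_xi[OF y(1)] by simp
      ultimately have less: "dist (xi1 w1 w2 y, xi2 w1 w2 y, y) (w1, w2, 0) < e" by simp
      have "dist (xi1 w1 w2 y) w1 \<le> dist (xi1 w1 w2 y, xi2 w1 w2 y, y) (w1, w2, 0)"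
        using dist_fst_le[of "(xi1 w1 w2 y, xi2 w1 w2 y, y)" "(w1, w2, 0)"] by simp
      moreover have "dist (xi2 w1 w2 y) w2 \<le> dist (xi1 w1 w2 y, xi2 w1 w2 y, y) (w1, w2, 0)"
        using dist_snd_le[of "(xi1 w1 w2 y, xi2 w1 w2 y, y)" "(w1, w2, 0)"]
          dist_fst_le[of "(xi2 w1 w2 y, y)" "(w2, 0)"] by simp
      ultimately show "norm (xi1 w1 w2 ((psi ^^ n) x) - w1) < e \<and> norm (xi2 w1 w2 ((psi ^^ n) x) - w2) < e"
        using less by (simp add: y_def dist_norm)
    qed
  qed
qed

lemma norm_mu_p: "norm (\<mu> ^ p) > 1"
  using mu p by (simp add: norm_power)

lemma filterlim_norm_power: "norm a > 1 \<Longrightarrow> filterlim (\<lambda>n. norm a ^ n) at_top sequentially"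
  for a :: complex
proof (rule filterlim_at_infinity_imp_filterlim_at_top)
  assume a: "norm a > 1"
  then show "filterlim (\<lambda>n. norm a ^ n) at_infinity sequentially"
    by (intro filterlim_realpow_sequentially_gt1) simp
  show "\<forall>\<^sub>F n in sequentially. 0 < norm a ^ n"
    using a by (intro always_eventually allI zero_less_power) linarith
qed

lemma n_over_power_tendsto_0:
  fixes a b :: complex
  assumes "norm a > 1"
  shows "(\<lambda>n. of_nat n * b / a ^ n) \<longlonglongrightarrow> 0" "(\<lambda>n. b / a ^ n) \<longlonglongrightarrow> 0"
proof -
  show "(\<lambda>n. of_nat n * b / a ^ n) \<longlonglongrightarrow> 0"
    using tendsto_mult_left[OF lim_n_over_pown[OF assms], of b] by (simp add: mult.commute)
  have "norm (inverse a) < 1" using assms by (simp add: norm_inverse inverse_less_1_iff)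
  then have "(\<lambda>n. inverse a ^ n) \<longlonglongrightarrow> 0" by (rule LIMSEQ_power_zero)
  then have "(\<lambda>n. b * inverse a ^ n) \<longlonglongrightarrow> b * 0" by (intro tendsto_mult tendsto_const)
  then show "(\<lambda>n. b / a ^ n) \<longlonglongrightarrow> 0"
    by (simp add: divide_inverse power_inverse)
qed

lemma eventually_norm_less: "X \<longlonglongrightarrow> 0 \<Longrightarrow> e > 0 \<Longrightarrow> \<forall>\<^sub>F n in sequentially. norm (X n) < e"
  for X :: "nat \<Rightarrow> complex"
  by (rule order_tendstoD(2)[OF tendsto_norm_zero])

text \<open>For fixed \<open>z2\<close> and \<open>z1\<close> of modulus \<open>norm (\<mu> ^ p) ^ n\<close>, going back \<open>n\<close> steps leads close to the unit
  circle in the \<open>z1\<close>-axis, since both the shear and the second coordinate tend to \<open>0\<close>.\<close>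

lemma large_first_coordinate:
  assumes x: "x > 0" and e: "e > 0"
  shows "\<forall>\<^sub>F n in sequentially. \<forall>z::complex. norm z = norm (\<mu> ^ p) ^ n \<longrightarrow>
    (\<exists>w1. z = (\<mu> ^ p) ^ n * (w1 + of_nat n * ((z2 / \<mu> ^ n) / \<mu>) ^ p) \<and>
       norm (xi1 w1 (z2 / \<mu> ^ n) ((psi ^^ n) x) - w1) < e \<and>
       norm (xi2 w1 (z2 / \<mu> ^ n) ((psi ^^ n) x) - z2 / \<mu> ^ n) < e)"
proof -
  have "(\<lambda>n. of_nat n * (z2 / \<mu>) ^ p / (\<mu> ^ p) ^ n) \<longlonglongrightarrow> 0"
    by (rule n_over_power_tendsto_0[OF norm_mu_p])
  then have "\<forall>\<^sub>F n in sequentially. norm (of_nat n * (z2 / \<mu>) ^ p / (\<mu> ^ p) ^ n) < 1 / 4"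
    by (rule eventually_norm_less) simp
  moreover have "\<forall>\<^sub>F n in sequentially. norm (z2 / \<mu> ^ n) < 1 / 4"
    by (rule eventually_norm_less[OF n_over_power_tendsto_0(2)[OF mu]]) simp
  ultimately show ?thesis
    using uniformly_close_to_identity[OF x e]
  proof eventually_elim
    case (elim n)
    show ?case
    proof (intro allI impI)
      fix z :: complex assume z: "norm z = norm (\<mu> ^ p) ^ n"
      define w2 where "w2 = z2 / \<mu> ^ n"
      define u where "u = of_nat n * (w2 / \<mu>) ^ p"
      have "u = of_nat n * (z2 / \<mu>) ^ p / (\<mu> ^ p) ^ n"
        by (simp add: u_def w2_def power_divide power_mult_distrib field_simps flip: power_mult)
      then have u: "norm u < 1 / 4" using elim(1) by simp
      define w1 where "w1 = z / (\<mu> ^ p) ^ n - u"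
      have n1: "norm (z / (\<mu> ^ p) ^ n) = 1" using z mu_nz by (simp add: norm_divide norm_power)
      have w1: "3 / 4 \<le> norm w1" "norm w1 \<le> 5 / 4"
        using norm_triangle_ineq2[of "z / (\<mu> ^ p) ^ n" u] norm_triangle_ineq4[of "z / (\<mu> ^ p) ^ n" u] u n1
        unfolding w1_def by linarith+
      have w2: "norm w2 < 1 / 4" using elim(2) by (simp add: w2_def)
      have "norm w1 \<le> norm (w1, w2)" using norm_fst_le[of w1 w2] by simp
      moreover have "norm (w1, w2) \<le> norm w1 + norm w2" by (rule norm_Pair_le)
      ultimately have "1 / 2 \<le> norm (w1, w2) \<and> norm (w1, w2) \<le> 2" using w1 w2 by linarith
      with elim(3) have "norm (xi1 w1 w2 ((psi ^^ n) x) - w1) < e \<and> norm (xi2 w1 w2 ((psi ^^ n) x) - w2) < e"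
        by blast
      moreover have "z = (\<mu> ^ p) ^ n * (w1 + of_nat n * (w2 / \<mu>) ^ p)"
        using mu_nz by (simp add: w1_def u_def)
      ultimately show "\<exists>w1. z = (\<mu> ^ p) ^ n * (w1 + of_nat n * ((z2 / \<mu> ^ n) / \<mu>) ^ p) \<and>
         norm (xi1 w1 (z2 / \<mu> ^ n) ((psi ^^ n) x) - w1) < e \<and>
         norm (xi2 w1 (z2 / \<mu> ^ n) ((psi ^^ n) x) - z2 / \<mu> ^ n) < e"
        unfolding w2_def by blast
    qed
  qed
qed

lemma large_second_coordinate:
  assumes x: "x > 0" and e: "e > 0"
  shows "\<forall>\<^sub>F n in sequentially. \<forall>w. norm w = 1 \<longrightarrow>
      norm (xi1 0 w ((psi ^^ n) x)) < e \<and> norm (xi2 0 w ((psi ^^ n) x) - w) < e"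
  using uniformly_close_to_identity[OF x e]
proof eventually_elim
  case (elim n)
  show ?case
  proof (intro allI impI)
    fix w :: complex assume "norm w = 1"
    then have "1 / 2 \<le> norm (0 :: complex, w) \<and> norm (0 :: complex, w) \<le> 2" by (simp add: norm_Pair)
    with elim have "norm (xi1 0 w ((psi ^^ n) x) - 0) < e \<and> norm (xi2 0 w ((psi ^^ n) x) - w) < e" by blast
    then show "norm (xi1 0 w ((psi ^^ n) x)) < e \<and> norm (xi2 0 w ((psi ^^ n) x) - w) < e" by simp
  qed
qed

lemma norm_mu_le: "norm \<mu> ^ n \<le> norm (\<mu> ^ p) ^ n"
proof (rule power_mono)
  have "norm \<mu> ^ 1 \<le> norm \<mu> ^ p" using mu p by (intro power_increasing) auto
  then show "norm \<mu> \<le> norm (\<mu> ^ p)" by (simp add: norm_power)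
qed simp

lemma sum_lessThan_1: "(\<Sum>k<1::nat. f k) = f 0"
  by simp

text \<open>The deviation from \<open>z2\<close> is magnified by \<open>\<mu> ^ n\<close> at radius \<open>norm (\<mu> ^ p) ^ n\<close>: it is small compared
  with the radius, hence constant in \<open>z1\<close>.\<close>

lemma xi2_first: 
  assumes x: "x > 0"
  shows "xi2 z1 z2 x = xi2 0 z2 x"
proof -
  define g where "g z = xi2 z z2 x - z2" for z
  have "g z = (\<Sum>k<1. (deriv ^^ k) g 0 / fact k * z ^ k)" for z
  proof (rule entire_small_on_circles_polynomial[OF _ filterlim_norm_power[OF norm_mu_p]])
    show "g holomorphic_on UNIV" unfolding g_def by (intro holomorphic_intros xi_holomorphic[OF x])
    fix e :: real assume e: "e > 0"
    show "\<forall>\<^sub>F n in sequentially. \<forall>z::complex. norm z = norm (\<mu> ^ p) ^ n \<longrightarrow> norm (g z) \<le> e * (norm (\<mu> ^ p) ^ n) ^ 1"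
      using large_first_coordinate[OF x e, of z2]
    proof eventually_elim
      case (elim n)
      show ?case
      proof (intro allI impI)
        fix z :: complex assume "norm z = norm (\<mu> ^ p) ^ n"
        with elim obtain w1 where z: "z = (\<mu> ^ p) ^ n * (w1 + of_nat n * ((z2 / \<mu> ^ n) / \<mu>) ^ p)"
          and w: "norm (xi2 w1 (z2 / \<mu> ^ n) ((psi ^^ n) x) - z2 / \<mu> ^ n) < e" by blast
        have "g z = \<mu> ^ n * (xi2 w1 (z2 / \<mu> ^ n) ((psi ^^ n) x) - z2 / \<mu> ^ n)"
          using xi_transport(1)[OF x, of n w1 "z2 / \<mu> ^ n"] mu_nz by (simp add: g_def z)
        then have "norm (g z) \<le> norm \<mu> ^ n * e"
          using w by (simp add: norm_mult norm_power mult_left_mono)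
        also have "\<dots> \<le> norm (\<mu> ^ p) ^ n * e" using norm_mu_le e by (intro mult_right_mono) auto
        finally show "norm (g z) \<le> e * (norm (\<mu> ^ p) ^ n) ^ 1" by (simp add: mult.commute)
      qed
    qed
  qed
  then have "g z1 = g 0" by (simp only: sum_lessThan_1 power_0)
  then show ?thesis by (simp add: g_def)
qed

definition b2 :: "real \<Rightarrow> complex" where "b2 x = xi2 0 0 x"

text \<open>As \<open>xi2\<close> does not depend on \<open>z1\<close>, that coordinate can be chosen such that the point reached after \<open>n\<close>
  steps back lies on the unit circle of the \<open>z2\<close>-axis. There the deviation tends to \<open>0\<close>, and it is
  magnified by no more than the radius \<open>norm \<mu> ^ n\<close>.\<close>

lemma xi2_eq:
  assumes x: "x > 0"
  shows "xi2 z1 z2 x = z2 + b2 x"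
proof -
  define g where "g z = xi2 0 z x - z" for z
  have "g z = (\<Sum>k<1. (deriv ^^ k) g 0 / fact k * z ^ k)" for z
  proof (rule entire_small_on_circles_polynomial[OF _ filterlim_norm_power[OF mu]])
    show "g holomorphic_on UNIV" unfolding g_def by (intro holomorphic_intros xi_holomorphic[OF x])
    fix e :: real assume e: "e > 0"
    show "\<forall>\<^sub>F n in sequentially. \<forall>z::complex. norm z = norm \<mu> ^ n \<longrightarrow> norm (g z) \<le> e * (norm \<mu> ^ n) ^ 1"
      using large_second_coordinate[OF x e]
    proof eventually_elim
      case (elim n)
      show ?case
      proof (intro allI impI)
        fix z :: complex assume z: "norm z = norm \<mu> ^ n"
        define w where "w = z / \<mu> ^ n"
        have w: "norm w = 1" "z = \<mu> ^ n * w" using z mu_nz by (simp_all add: w_def norm_divide norm_power)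
        have "g z = xi2 ((\<mu> ^ p) ^ n * (0 + of_nat n * (w / \<mu>) ^ p)) (\<mu> ^ n * w) x - \<mu> ^ n * w"
          unfolding g_def w(2) by (subst xi2_first[OF x, of "_ * _"]) (rule refl)
        also have "\<dots> = \<mu> ^ n * (xi2 0 w ((psi ^^ n) x) - w)"
          by (rule xi_transport(1)[OF x])
        finally have "norm (g z) \<le> norm \<mu> ^ n * e"
          using elim w(1) by (simp add: norm_mult norm_power mult_left_mono less_imp_le)
        then show "norm (g z) \<le> e * (norm \<mu> ^ n) ^ 1" by (simp add: mult.commute)
      qed
    qed
  qed
  then have "g z2 = g 0" by (simp only: sum_lessThan_1 power_0)
  then show ?thesis using xi2_first[OF x, of z1 z2] by (simp add: g_def b2_def algebra_simps)
qed

lemma b2_psi_pow: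
  assumes x: "x > 0"
  shows "b2 ((psi ^^ n) x) = b2 x / \<mu> ^ n"
  using xi_transport(1)[OF x, of n 0 0] mu_nz p by (simp add: b2_def power_0_left)

text \<open>Now \<open>xi2\<close> is a translation by \<open>b2\<close>, and \<open>b2\<close> is divided by \<open>\<mu>\<close> at each step back. Relative to the radius
  \<open>norm (\<mu> ^ p) ^ n\<close>, the \<open>n\<close> shears therefore contribute \<open>n\<close> times a number of size \<open>norm (\<mu> ^ p) ^ (- n)\<close>.\<close>

lemma xi1_first:
  assumes x: "x > 0"
  shows "xi1 z1 z2 x = z1 + xi1 0 z2 x"
proof -
  define g where "g z = xi1 z z2 x - z" for z
  have "g z = (\<Sum>k<1. (deriv ^^ k) g 0 / fact k * z ^ k)" for z
  proof (rule entire_small_on_circles_polynomial[OF _ filterlim_norm_power[OF norm_mu_p]])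
    show "g holomorphic_on UNIV" unfolding g_def by (intro holomorphic_intros xi_holomorphic[OF x])
    fix e :: real assume e: "e > 0"
    have e2: "e / 2 > 0" using e by simp
    define C where "C = ((z2 + b2 x) / \<mu>) ^ p - (z2 / \<mu>) ^ p"
    have "\<forall>\<^sub>F n in sequentially. norm (of_nat n * C / (\<mu> ^ p) ^ n) < e / 2"
      by (rule eventually_norm_less[OF n_over_power_tendsto_0(1)[OF norm_mu_p]]) (use e in simp)
    then show "\<forall>\<^sub>F n in sequentially. \<forall>z::complex. norm z = norm (\<mu> ^ p) ^ n \<longrightarrow> norm (g z) \<le> e * (norm (\<mu> ^ p) ^ n) ^ 1"
      using large_first_coordinate[OF x e2, of z2]
    proof (eventually_elim)
      case (elim n)
      show ?case
      proof (intro allI impI)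
        fix z :: complex assume "norm z = norm (\<mu> ^ p) ^ n"
        with elim obtain w1 where z: "z = (\<mu> ^ p) ^ n * (w1 + of_nat n * ((z2 / \<mu> ^ n) / \<mu>) ^ p)"
          and w: "norm (xi1 w1 (z2 / \<mu> ^ n) ((psi ^^ n) x) - w1) < e / 2" by blast
        have y: "(psi ^^ n) x > 0" by (rule psi_pow_pos[OF x])
        have scale: "(u / \<mu> ^ n / \<mu>) ^ p = (u / \<mu>) ^ p / (\<mu> ^ p) ^ n" for u
          by (simp add: power_divide power_mult_distrib mult_ac flip: power_mult)
        have "xi2 w1 (z2 / \<mu> ^ n) ((psi ^^ n) x) = (z2 + b2 x) / \<mu> ^ n"
          by (simp add: xi2_eq[OF y] b2_psi_pow[OF x] add_divide_distrib)
        then have C: "of_nat n * ((xi2 w1 (z2 / \<mu> ^ n) ((psi ^^ n) x) / \<mu>) ^ p - ((z2 / \<mu> ^ n) / \<mu>) ^ p)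
            = of_nat n * C / (\<mu> ^ p) ^ n"
          unfolding C_def by (simp only: scale) (simp add: right_diff_distrib diff_divide_distrib)
        have "g z = (\<mu> ^ p) ^ n * ((xi1 w1 (z2 / \<mu> ^ n) ((psi ^^ n) x) - w1) + of_nat n * C / (\<mu> ^ p) ^ n)"
          using xi_transport(2)[OF x, of n w1 "z2 / \<mu> ^ n"] mu_nz C by (simp add: g_def z)
        moreover have "norm ((xi1 w1 (z2 / \<mu> ^ n) ((psi ^^ n) x) - w1) + of_nat n * C / (\<mu> ^ p) ^ n) \<le> e"
          using norm_triangle_ineq[of "xi1 w1 (z2 / \<mu> ^ n) ((psi ^^ n) x) - w1" "of_nat n * C / (\<mu> ^ p) ^ n"] w elim(1)
          by linarith
        ultimately show "norm (g z) \<le> e * (norm (\<mu> ^ p) ^ n) ^ 1"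
          by (simp add: norm_mult norm_power mult_left_mono mult.commute[of e])
      qed
    qed
  qed
  then have "g z1 = g 0" by (simp only: sum_lessThan_1 power_0)
  then show ?thesis by (simp add: g_def algebra_simps)
qed

definition b1 :: "nat \<Rightarrow> real \<Rightarrow> complex" where
  "b1 j x = (deriv ^^ j) (\<lambda>z. xi1 0 z x) 0 / fact j"

text \<open>The point after \<open>n\<close> steps back is again taken on the unit circle of the \<open>z2\<close>-axis; by \<open>xi1_first\<close> the
  choice of \<open>z1\<close> that this requires does not change \<open>xi1 - z1\<close>. The deviation is magnified by
  \<open>(\<mu> ^ p) ^ n\<close>, the \<open>p\<close>-th power of the radius, and carries a factor that tends to \<open>0\<close>.\<close>

lemma xi1_eq:
  assumes x: "x > 0"
  shows "xi1 z1 z2 x = z1 + (\<Sum>j<p. b1 j x * z2 ^ j)"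
proof -
  have "xi1 0 z2 x = (\<Sum>k<p. (deriv ^^ k) (\<lambda>z. xi1 0 z x) 0 / fact k * z2 ^ k)"
  proof (rule entire_small_on_circles_polynomial[OF xi_holomorphic(2)[OF x] filterlim_norm_power[OF mu]])
    fix e :: real assume e: "e > 0"
    have e2: "e / 2 > 0" using e by simp
    have "\<forall>\<^sub>F n in sequentially. norm (of_nat n * b2 x / \<mu> ^ n) < e / 2 / 2 ^ p"
      by (rule eventually_norm_less[OF n_over_power_tendsto_0(1)[OF mu]]) (use e in simp)
    moreover have "\<forall>\<^sub>F n in sequentially. norm (b2 x / \<mu> ^ n) < 1"
      by (rule eventually_norm_less[OF n_over_power_tendsto_0(2)[OF mu]]) simp
    ultimately show "\<forall>\<^sub>F n in sequentially. \<forall>z::complex. norm z = norm \<mu> ^ n \<longrightarrow> norm (xi1 0 z x) \<le> e * (norm \<mu> ^ n) ^ p"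
      using large_second_coordinate[OF x e2]
    proof eventually_elim
      case (elim n)
      show ?case
      proof (intro allI impI)
        fix z :: complex assume z: "norm z = norm \<mu> ^ n"
        define w where "w = z / \<mu> ^ n"
        have w: "norm w = 1" "z = \<mu> ^ n * w" using z mu_nz by (simp_all add: w_def norm_divide norm_power)
        have y: "(psi ^^ n) x > 0" by (rule psi_pow_pos[OF x])
        define h where "h = b2 x / \<mu> ^ n"
        define z1 where "z1 = (\<mu> ^ p) ^ n * (0 + of_nat n * (w / \<mu>) ^ p)"
        define E where "E = of_nat n * ((xi2 0 w ((psi ^^ n) x) / \<mu>) ^ p - (w / \<mu>) ^ p)"
        have "xi1 0 z x = xi1 z1 (\<mu> ^ n * w) x - z1"
          using xi1_first[OF x, of z1 z] by (simp add: w(2))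
        also have "\<dots> = (\<mu> ^ p) ^ n * ((xi1 0 w ((psi ^^ n) x) - 0) + E)"
          unfolding z1_def E_def by (rule xi_transport(2)[OF x])
        finally have eq: "xi1 0 z x = (\<mu> ^ p) ^ n * (xi1 0 w ((psi ^^ n) x) + E)" by simp
        have "E = of_nat n * ((w + h) ^ p - w ^ p) / \<mu> ^ p"
          by (simp add: E_def h_def xi2_eq[OF y] b2_psi_pow[OF x] power_divide diff_divide_distrib algebra_simps mu_nz)
        then have "norm E = real n * norm ((w + h) ^ p - w ^ p) / norm (\<mu> ^ p)"
          by (simp add: norm_mult norm_divide)
        also have "\<dots> \<le> real n * norm ((w + h) ^ p - w ^ p) / 1"
          using norm_mu_p mu_nz by (intro divide_left_mono) auto
        also have "\<dots> \<le> real n * (2 ^ p * norm h)"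
          using norm_binomial_diff_le[OF w(1), of h p] elim(2) p by (simp add: mult_left_mono h_def)
        also have "\<dots> = 2 ^ p * norm (of_nat n * b2 x / \<mu> ^ n)"
          by (simp add: h_def norm_mult norm_divide)
        also have "\<dots> \<le> 2 ^ p * (e / 2 / 2 ^ p)" using elim(1) by (intro mult_left_mono) auto
        finally have "norm E \<le> e / 2" by simp
        moreover have "norm (xi1 0 w ((psi ^^ n) x)) < e / 2" using elim(3) w(1) by blast
        ultimately have "norm (xi1 0 w ((psi ^^ n) x) + E) \<le> e"
          using norm_triangle_ineq[of "xi1 0 w ((psi ^^ n) x)" E] by linarith
        moreover have "norm ((\<mu> ^ p) ^ n) = (norm \<mu> ^ n) ^ p"
          by (simp add: norm_power mult.commute flip: power_mult)
        ultimately show "norm (xi1 0 z x) \<le> e * (norm \<mu> ^ n) ^ p"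
          unfolding eq norm_mult by (metis mult.commute mult_left_mono norm_ge_zero)
      qed
    qed
  qed
  then show ?thesis using xi1_first[OF x, of z1 z2] by (simp add: b1_def)
qed

lemma xi_smooth: "smooth_on {0<..} (\<lambda>x. xi1 z1 z2 x)" "smooth_on {0<..} (\<lambda>x. xi2 z1 z2 x)"
proof -
  have sm: "smooth_on Rtilde F" using F_props(1) by (simp add: leafwise_def)
  have "smooth_on {0::real<..} (\<lambda>x. (z1, z2, x))"
    by (intro smooth_on_Pair smooth_on_const smooth_on_id)
  then have "smooth_on {0<..} (\<lambda>x. F (z1, z2, x))"
    by (rule smooth_on_compose[OF _ sm]) (simp add: Rtilde_iff zero_prod_def)
  then show "smooth_on {0<..} (\<lambda>x. xi1 z1 z2 x)" "smooth_on {0<..} (\<lambda>x. xi2 z1 z2 x)"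
    unfolding xi1_def xi2_def by (simp_all add: smooth_on_fst smooth_on_snd)
qed

lemma b1_smooth:
  assumes j: "j < p"
  shows "smooth_on {0<..} (b1 j)"
proof -
  obtain w d :: "nat \<Rightarrow> complex" where wd: "\<And>a :: nat \<Rightarrow> complex. a j = (\<Sum>k<p. d k * (\<Sum>l<p. a l * w k ^ l))"
    by (rule coefficient_by_roots_of_unity[OF j]) blast
  have "smooth_on {0<..} (\<lambda>x. \<Sum>k<p. d k * xi1 0 (w k) x)"
    by (intro smooth_on_sum smooth_on_mult smooth_on_const xi_smooth)
  then show ?thesis
  proof (rule smooth_on_cong)
    fix x :: real assume "x \<in> {0<..}"
    then show "(\<Sum>k<p. d k * xi1 0 (w k) x) = b1 j x"
      using wd[of "\<lambda>l. b1 l x"] by (simp add: xi1_eq)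
  qed
qed

definition tup :: tuple where
  "tup = ((\<lambda>j\<in>{..<p}. \<lambda>x\<in>{0<..}. b1 j x), (\<lambda>x\<in>{0<..}. b2 x))"

lemma F_eq_tuple_lift:
  assumes "level q > 0"
  shows "F q = tuple_lift p tup q"
proof -
  obtain z1 z2 x where q: "q = (z1, z2, x)" by (cases q)
  with assms have "x > 0" by simp
  then show ?thesis by (simp add: q tuple_lift_pos F_xi xi1_eq xi2_eq tup_def)
qed

lemma tup_Sol: "tup \<in> Sol"
  unfolding Sol_iff_commute
proof (intro conjI allI impI)
  show "tup \<in> tuple_space p" by (auto simp: tup_def tuple_space_def)
  show "smooth_tuple p tup"
    unfolding smooth_tuple_def
  proof (intro conjI allI impI)
    fix j assume "j < p"
    then show "smooth_on {0<..} (fst tup j)"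
      by (intro smooth_on_cong[OF b1_smooth]) (auto simp: tup_def)
  next
    show "smooth_on {0<..} (snd tup)"
      by (rule smooth_on_cong[OF xi_smooth(2)[of 0 0]]) (simp add: tup_def b2_def)
  qed
  fix q :: point assume q: "level q > 0"
  then have R: "q \<in> Rtilde" by (auto simp: Rtilde_iff)
  have "tuple_lift p tup (T q) = F (T q)"
    by (rule F_eq_tuple_lift[symmetric]) (simp add: phi_pos q)
  also have "\<dots> = T (F q)" by (rule F_props(5)[OF R])
  also have "\<dots> = T (tuple_lift p tup q)" by (simp only: F_eq_tuple_lift[OF q])
  finally show "tuple_lift p tup (T q) = T (tuple_lift p tup q)" .
qed

lemma induced_eq_tuple_aut: "induced F = tuple_aut T p tup"
  unfolding tuple_aut_eq_induced
proof (rule induced_cong)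
  fix q assume q: "q \<in> Rtilde"
  show "F q = tuple_lift p tup q"
  proof (cases "level q > 0")
    case False
    then have "level q = 0" using q by (simp add: Rtilde_iff)
    then have "q \<in> leaf_tilde 0" using q by (simp add: leaf_tilde_def)
    then show ?thesis
      using F_props(6) equivariant_pairD(6)[OF tuple_equivariant_pair[OF tup_Sol]] by simp
  qed (rule F_eq_tuple_lift)
qed

end

context reeb_solutions
begin

lemma kernel_transverse_eq:
  "kernel (Aut_rel T) (Diff_centralizer \<phi>) (transverse T) = tuple_aut T p ` carrier (solution_group \<phi> \<mu> p c)"
proof (intro equalityI subsetI)
  fix f assume "f \<in> kernel (Aut_rel T) (Diff_centralizer \<phi>) (transverse T)"
  then obtain F G where fg: "equivariant_pair F G" "f = induced F" "\<forall>q\<in>Rtilde. level (F q) = level q"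
    unfolding kernel_transverse by blast
  interpret vertical_pair \<phi> \<mu> p c F G
    by unfold_locales (use fg in auto)
  show "f \<in> tuple_aut T p ` carrier (solution_group \<phi> \<mu> p c)"
    using induced_eq_tuple_aut tup_Sol by (auto simp: fg(2) solution_group_def)
next
  fix f assume "f \<in> tuple_aut T p ` carrier (solution_group \<phi> \<mu> p c)"
  then obtain \<beta> where S: "\<beta> \<in> Sol" "f = induced (tuple_lift p \<beta>)"
    unfolding solution_group_def tuple_aut_eq_induced by auto
  then show "f \<in> kernel (Aut_rel T) (Diff_centralizer \<phi>) (transverse T)"
    unfolding kernel_transverse using tuple_equivariant_pair[OF S(1)] by (metis level_tuple_lift)
qed

end

section \<open>The vector space of solutions\<close>

subsection \<open>The exponential map on polynomials\<close>

text \<open>For a vector field \<open>(\<Sum>k<p. q k * z2 ^ k) \<partial>\<^sub>1 + s \<partial>\<^sub>2\<close> the flow at time \<open>1\<close> adds to the first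
  coordinate the integral of \<open>\<Sum>k<p. q k * (z2 + t * s) ^ k\<close> over \<open>t\<close> from \<open>0\<close> to \<open>1\<close>. The following
  number is the contribution of \<open>q k\<close> to the coefficient of \<open>z2 ^ j\<close>.\<close>

definition exp_coeff :: "complex \<Rightarrow> nat \<Rightarrow> nat \<Rightarrow> complex" where
  "exp_coeff s k j = of_nat (k choose j) / of_nat (k - j + 1) * s ^ (k - j)"

definition exp_poly :: "nat \<Rightarrow> (nat \<Rightarrow> complex) \<Rightarrow> complex \<Rightarrow> nat \<Rightarrow> complex" where
  "exp_poly p q s j = (\<Sum>k=j..<p. exp_coeff s k j * q k)"

lemma exp_coeff_diag [simp]: "exp_coeff s j j = 1"
  by (simp add: exp_coeff_def)

lemma exp_coeff_zero: "exp_coeff 0 k j = (if j < k then 0 else of_nat (k choose j))"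
  by (auto simp: exp_coeff_def)

lemma exp_poly_rec: "j < p \<Longrightarrow> exp_poly p q s j = q j + (\<Sum>k=Suc j..<p. exp_coeff s k j * q k)"
  by (simp add: exp_poly_def sum.atLeast_Suc_lessThan)

lemma exp_poly_zero: "j < p \<Longrightarrow> exp_poly p q 0 j = q j"
  by (simp add: exp_poly_rec exp_coeff_zero)

lemma exp_poly_top: "p > 0 \<Longrightarrow> exp_poly p q s (p - 1) = q (p - 1)"
  by (simp add: exp_poly_rec)

lemma exp_poly_inject:
  assumes eq: "\<And>j. j < p \<Longrightarrow> exp_poly p q s j = exp_poly p r s j" and j: "j < p"
  shows "q j = r j"
  using j
proof (induction "p - j" arbitrary: j rule: less_induct)
  case less
  have "q k = r k" if "k \<in> {Suc j..<p}" for k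
    using that less.prems by (intro less.hyps) auto
  then have "(\<Sum>k=Suc j..<p. exp_coeff s k j * q k) = (\<Sum>k=Suc j..<p. exp_coeff s k j * r k)"
    by (intro sum.cong refl) simp
  then show ?case using eq[OF less.prems] less.prems by (simp add: exp_poly_rec)
qed

lemma exp_poly_linear:
  "exp_poly p (\<lambda>k. a * q k + b * r k) s j = a * exp_poly p q s j + b * exp_poly p r s j"
  by (simp add: exp_poly_def sum_distrib_left sum.distrib algebra_simps)

lemma exp_coeff_integral:
  "s * (\<Sum>j\<le>k. exp_coeff s k j * z ^ j) = ((z + s) ^ Suc k - z ^ Suc k) / of_nat (Suc k)"
proof -
  have term_eq: "s * (exp_coeff s k j * z ^ j) * of_nat (Suc k) = of_nat (Suc k choose j) * z ^ j * s ^ (Suc k - j)"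
    if j: "j \<le> k" for j
  proof -
    have "(Suc k - j) * (Suc k choose j) = Suc k * (k choose j)"
      using binomial_absorb_comp[of "Suc k" j] by simp
    then have "of_nat (Suc k) * of_nat (k choose j) = (of_nat (k - j + 1) * of_nat (Suc k choose j) :: complex)"
      using j by (metis Suc_diff_le Suc_eq_plus1 of_nat_mult)
    then have "of_nat (Suc k) * (of_nat (k choose j) / of_nat (k - j + 1)) = (of_nat (Suc k choose j) :: complex)"
      by (simp del: of_nat_Suc of_nat_add add: nonzero_divide_eq_eq)
    moreover have "s ^ (Suc k - j) = s * s ^ (k - j)" using j by (simp add: Suc_diff_le)
    moreover have "s * (exp_coeff s k j * z ^ j) * of_nat (Suc k) =
        (of_nat (Suc k) * (of_nat (k choose j) / of_nat (k - j + 1))) * z ^ j * (s * s ^ (k - j))"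
      unfolding exp_coeff_def by (simp only: mult_ac)
    ultimately show ?thesis by simp
  qed
  have "(z + s) ^ Suc k = (\<Sum>j\<le>Suc k. of_nat (Suc k choose j) * z ^ j * s ^ (Suc k - j))"
    by (rule binomial_ring)
  then have "(z + s) ^ Suc k - z ^ Suc k = (\<Sum>j\<le>k. of_nat (Suc k choose j) * z ^ j * s ^ (Suc k - j))"
    by simp
  also have "\<dots> = (\<Sum>j\<le>k. s * (exp_coeff s k j * z ^ j) * of_nat (Suc k))"
    by (intro sum.cong refl) (simp only: term_eq atMost_iff)
  also have "\<dots> = s * (\<Sum>j\<le>k. exp_coeff s k j * z ^ j) * of_nat (Suc k)"
    by (simp only: sum_distrib_left sum_distrib_right)
  finally show ?thesis by (simp add: nonzero_eq_divide_eq del: of_nat_Suc power_Suc)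
qed

definition primitive :: "nat \<Rightarrow> (nat \<Rightarrow> complex) \<Rightarrow> complex poly" where
  "primitive p q = (\<Sum>k<p. monom (q k / of_nat (Suc k)) (Suc k))"

text \<open>The integral over the flow, multiplied by the speed \<open>s\<close>, is a difference of values of a primitive.\<close>

lemma exp_poly_primitive:
  "s * (\<Sum>j<p. exp_poly p q s j * z ^ j) = poly (primitive p q) (z + s) - poly (primitive p q) z"
proof -
  have "(\<Sum>j<p. exp_poly p q s j * z ^ j) = (\<Sum>j<p. \<Sum>k=j..<p. q k * (exp_coeff s k j * z ^ j))"
    by (simp add: exp_poly_def sum_distrib_left sum_distrib_right mult_ac)
  also have "\<dots> = (\<Sum>j<p. \<Sum>k<p. if j \<le> k then q k * (exp_coeff s k j * z ^ j) else 0)"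
    by (intro sum.cong refl sum.mono_neutral_cong_left) auto
  also have "\<dots> = (\<Sum>k<p. \<Sum>j<p. if j \<le> k then q k * (exp_coeff s k j * z ^ j) else 0)"
    by (rule sum.swap)
  also have "\<dots> = (\<Sum>k<p. \<Sum>j\<le>k. q k * (exp_coeff s k j * z ^ j))"
    by (intro sum.cong refl sum.mono_neutral_cong_right) auto
  finally have "s * (\<Sum>j<p. exp_poly p q s j * z ^ j)
      = (\<Sum>k<p. q k * (s * (\<Sum>j\<le>k. exp_coeff s k j * z ^ j)))"
    by (simp add: sum_distrib_left mult_ac)
  also have "\<dots> = (\<Sum>k<p. q k * (((z + s) ^ Suc k - z ^ Suc k) / of_nat (Suc k)))"
    by (simp only: exp_coeff_integral)
  also have "\<dots> = poly (primitive p q) (z + s) - poly (primitive p q) z"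
    by (simp add: primitive_def poly_sum poly_monom right_diff_distrib diff_divide_distrib
        flip: sum_subtractf del: power_Suc of_nat_Suc)
  finally show ?thesis .
qed

lemma periodic_poly_constant:
  fixes f :: "complex poly"
  assumes s: "s \<noteq> 0" and per: "\<And>z. poly f (z + s) = poly f z"
  shows "poly f z = poly f 0"
proof -
  have "poly f (of_nat n * s) = poly f 0" for n
  proof (induction n)
    case (Suc n)
    then show ?case using per[of "of_nat n * s"] by (simp add: algebra_simps)
  qed simp
  then have "range (\<lambda>n::nat. of_nat n * s) \<subseteq> {z. poly (f - [:poly f 0:]) z = 0}" by auto
  moreover have "infinite (range (\<lambda>n::nat. of_nat n * s))"
    using s by (intro range_inj_infinite injI) auto
  ultimately have "f - [:poly f 0:] = 0"
    using poly_roots_finite finite_subset by blast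
  then have "poly (f - [:poly f 0:]) z = 0" by simp
  then show ?thesis by simp
qed

text \<open>Two commuting flows \<open>B\<close> and \<open>C\<close>, with \<open>s \<noteq> 0\<close>: commutation says that \<open>s * C z - (P (z + t) - P z)\<close>,
  where \<open>P\<close> is the primitive of the first vector field, has period \<open>s\<close>. So it is a constant, and
  the second vector field is \<open>t / s\<close> times the first one up to a constant multiple of \<open>\<partial>\<^sub>1\<close>.\<close>

lemma exp_poly_commuting:
  assumes s: "s \<noteq> 0"
    and comm: "\<And>z. (\<Sum>j<p. exp_poly p r t j * z ^ j) + (\<Sum>j<p. exp_poly p q s j * (z + t) ^ j)
      = (\<Sum>j<p. exp_poly p q s j * z ^ j) + (\<Sum>j<p. exp_poly p r t j * (z + s) ^ j)"
  shows "(\<Sum>j<p. exp_poly p (\<lambda>k. q k + r k) (s + t) j * z ^ j)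
      = (\<Sum>j<p. exp_poly p r t j * z ^ j) + (\<Sum>j<p. exp_poly p q s j * (z + t) ^ j)"
proof (cases "p = 0")
  case False
  define P where "P = primitive p q"
  define B where "B z = (\<Sum>j<p. exp_poly p q s j * z ^ j)" for z
  define C where "C = (\<Sum>j<p. monom (exp_poly p r t j) j)"
  have C: "poly C z = (\<Sum>j<p. exp_poly p r t j * z ^ j)" for z
    by (simp add: C_def poly_sum poly_monom)
  have B: "s * B z = poly P (z + s) - poly P z" for z
    unfolding B_def P_def by (rule exp_poly_primitive)
  have comm': "poly C z + B (z + t) = B z + poly C (z + s)" for z
    using comm[of z] by (simp add: B_def C)
  define f where "f = Polynomial.smult s C - (P \<circ>\<^sub>p [:t, 1:] - P)"
  have f: "poly f z = s * poly C z - (poly P (z + t) - poly P z)" for z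
    by (simp add: f_def poly_pcompose add.commute)
  have "poly f (z + s) = poly f z" for z
  proof -
    have "s * poly C z + s * B (z + t) = s * B z + s * poly C (z + s)"
      using comm'[of z] by (metis distrib_left)
    then show ?thesis unfolding f B by (simp add: algebra_simps)
  qed
  then have const: "poly f z = poly f 0" for z by (rule periodic_poly_constant[OF s])
  define \<kappa> where "\<kappa> = poly f 0"
  have sC: "s * poly C z = poly P (z + t) - poly P z + \<kappa>" for z
    using const[of z] f[of z] by (simp add: \<kappa>_def algebra_simps)
  define e where "e k = (if k = 0 then 1 else 0 :: complex)" for k :: nat
  have e: "(\<Sum>j<p. exp_poly p e u j * z ^ j) = 1" for u z
  proof -
    have "exp_poly p e u j = (if j = 0 then 1 else 0)" if "j < p" for j
    proof -
      have "exp_poly p e u j = (\<Sum>k=j..<p. if k = 0 then exp_coeff u 0 j else 0)"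
        unfolding exp_poly_def by (intro sum.cong refl) (simp add: e_def)
      then show ?thesis using that by simp
    qed
    then have "(\<Sum>j<p. exp_poly p e u j * z ^ j) = (\<Sum>j<p. (if j = 0 then 1 else 0) * z ^ j)"
      by (intro sum.cong refl) simp
    also have "\<dots> = (\<Sum>j<p. if j = 0 then 1 else 0)" by (intro sum.cong refl) auto
    finally show ?thesis using False by simp
  qed
  have r: "r k = t / s * q k + \<kappa> / s * e k" if "k < p" for k
  proof (rule exp_poly_inject[OF _ that])
    fix j assume j: "j < p"
    show "exp_poly p r t j = exp_poly p (\<lambda>k. t / s * q k + \<kappa> / s * e k) t j"
    proof (rule sum_powers_eq_imp_coeff_eq[OF _ j])
      fix z
      have "s * (\<Sum>j<p. exp_poly p (\<lambda>k. t / s * q k + \<kappa> / s * e k) t j * z ^ j)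
          = t * (\<Sum>j<p. exp_poly p q t j * z ^ j) + \<kappa> * (\<Sum>j<p. exp_poly p e t j * z ^ j)"
        using s by (simp only: exp_poly_linear, simp add: distrib_right distrib_left sum.distrib sum_distrib_left)
          (simp add: mult.assoc)
      also have "\<dots> = s * poly C z"
        by (simp add: exp_poly_primitive e sC P_def)
      finally show "(\<Sum>j<p. exp_poly p r t j * z ^ j)
          = (\<Sum>j<p. exp_poly p (\<lambda>k. t / s * q k + \<kappa> / s * e k) t j * z ^ j)"
        using s by (simp add: C)
    qed
  qed
  have "exp_poly p (\<lambda>k. q k + r k) (s + t) j = exp_poly p (\<lambda>k. (s + t) / s * q k + \<kappa> / s * e k) (s + t) j" for j
    unfolding exp_poly_def using s
    by (intro sum.cong refl) (simp add: r add_divide_distrib distrib_right)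
  then have "s * (\<Sum>j<p. exp_poly p (\<lambda>k. q k + r k) (s + t) j * z ^ j)
      = (s + t) * (\<Sum>j<p. exp_poly p q (s + t) j * z ^ j) + \<kappa> * (\<Sum>j<p. exp_poly p e (s + t) j * z ^ j)"
    using s by (simp only: exp_poly_linear, simp add: distrib_right distrib_left sum.distrib sum_distrib_left add_divide_distrib)
      (simp add: mult.assoc distrib_right distrib_left sum.distrib)
  also have "\<dots> = poly P (z + (s + t)) - poly P z + \<kappa>"
    by (simp only: exp_poly_primitive e P_def mult_1_right)
  also have "\<dots> = s * (poly C z + B (z + t))"
    unfolding distrib_left sC B by (simp add: algebra_simps)
  finally show ?thesis using s by (simp add: C B_def)
qed simp

text \<open>The vector fields invariant under \<open>T\<close> are given by a linear system; the exponential map turns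
  it into the system for the tuples.\<close>

lemma exp_poly_equivariant:
  fixes c :: "nat \<Rightarrow> complex"
  assumes mu: "\<mu> \<noteq> 0" and p: "p > 0" and c: "\<And>j. j < p \<Longrightarrow> c j = of_nat (p choose j) * (1 / \<mu> ^ j)"
  shows "(\<forall>j<p. exp_poly p q' (\<mu> * s) j = \<mu> ^ (p - j) * exp_poly p q s j + c j * s ^ (p - j)) \<longleftrightarrow>
    (\<forall>k<p. q' k = \<mu> ^ (p - k) * q k + (if k = p - 1 then c k * s else 0))"
proof -
  define r where "r k = \<mu> ^ (p - k) * q k + (if k = p - 1 then c k * s else 0)" for k
  have r: "exp_poly p r (\<mu> * s) j = \<mu> ^ (p - j) * exp_poly p q s j + c j * s ^ (p - j)" if j: "j < p" for j
  proof -
    have 1: "exp_coeff (\<mu> * s) k j * \<mu> ^ (p - k) = \<mu> ^ (p - j) * exp_coeff s k j" if "k \<in> {j..<p}" for k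
    proof -
      have "p - j = (k - j) + (p - k)" using that by auto
      then have "\<mu> ^ (p - j) = \<mu> ^ (k - j) * \<mu> ^ (p - k)" by (simp only: power_add)
      then show ?thesis by (simp add: exp_coeff_def power_mult_distrib)
    qed
    have 2: "exp_coeff (\<mu> * s) (p - 1) j * (c (p - 1) * s) = c j * s ^ (p - j)"
    proof -
      have d: "p - j = Suc (p - 1 - j)" using j by simp
      have "(p - j) * (p choose j) = p * ((p - 1) choose j)" by (rule binomial_absorb_comp)
      then have b: "of_nat p * of_nat ((p - 1) choose j) = (of_nat (p - j) * of_nat (p choose j) :: complex)"
        by (metis of_nat_mult)
      have cp: "c (p - 1) = of_nat p * (1 / \<mu> ^ (p - 1))"
      proof -
        have "p choose (p - 1) = p" using binomial_symmetric[of 1 p] p by simp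
        then show ?thesis using c[of "p - 1"] p by simp
      qed
      have "\<mu> ^ (p - 1) = \<mu> ^ (p - 1 - j) * \<mu> ^ j" using j by (simp flip: power_add)
      then have m: "\<mu> ^ (p - 1 - j) * (1 / \<mu> ^ (p - 1)) = 1 / \<mu> ^ j" using mu by simp
      have "exp_coeff (\<mu> * s) (p - 1) j * (c (p - 1) * s)
          = (of_nat p * of_nat ((p - 1) choose j)) / of_nat (p - j) * (\<mu> ^ (p - 1 - j) * (1 / \<mu> ^ (p - 1))) * (s * s ^ (p - 1 - j))"
        unfolding exp_coeff_def cp power_mult_distrib by (simp add: d)
      also have "\<dots> = of_nat (p choose j) * (1 / \<mu> ^ j) * s ^ (p - j)"
        unfolding b m using j by (simp add: d del: of_nat_Suc)
      finally show ?thesis by (simp add: c[OF j])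
    qed
    have "exp_poly p r (\<mu> * s) j = (\<Sum>k=j..<p. exp_coeff (\<mu> * s) k j * \<mu> ^ (p - k) * q k)
        + (\<Sum>k=j..<p. if k = p - 1 then exp_coeff (\<mu> * s) k j * (c k * s) else 0)"
      unfolding exp_poly_def r_def by (subst sum.distrib[symmetric]) (intro sum.cong refl, simp add: algebra_simps)
    also have "(\<Sum>k=j..<p. exp_coeff (\<mu> * s) k j * \<mu> ^ (p - k) * q k) = \<mu> ^ (p - j) * exp_poly p q s j"
      unfolding exp_poly_def sum_distrib_left by (intro sum.cong refl) (simp only: 1 mult.assoc)
    also have "(\<Sum>k=j..<p. if k = p - 1 then exp_coeff (\<mu> * s) k j * (c k * s) else 0) = c j * s ^ (p - j)"
    proof -
      have "j \<le> p - 1" using j by simp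
      then show ?thesis using 2 p by simp
    qed
    finally show ?thesis .
  qed
  have "(\<forall>j<p. exp_poly p q' (\<mu> * s) j = \<mu> ^ (p - j) * exp_poly p q s j + c j * s ^ (p - j)) \<longleftrightarrow>
      (\<forall>j<p. exp_poly p q' (\<mu> * s) j = exp_poly p r (\<mu> * s) j)"
    by (simp add: r)
  also have "\<dots> \<longleftrightarrow> (\<forall>k<p. q' k = r k)"
  proof (intro iffI allI impI)
    fix k assume "\<forall>j<p. exp_poly p q' (\<mu> * s) j = exp_poly p r (\<mu> * s) j" "k < p"
    then show "q' k = r k" by (intro exp_poly_inject[of p q' "\<mu> * s" r]) auto
  next
    fix j assume "\<forall>k<p. q' k = r k"
    then show "exp_poly p q' (\<mu> * s) j = exp_poly p r (\<mu> * s) j"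
      unfolding exp_poly_def by (intro sum.cong refl) simp
  qed
  finally show ?thesis by (simp add: r_def)
qed

subsection \<open>The vector space structure\<close>

lemma field_complex_field: "field complex_field"
proof -
  have "cring complex_field"
    by (rule cringI) (auto intro!: abelian_groupI comm_monoidI exI[of _ "- _"]
        simp: complex_field_def algebra_simps)
  moreover have "Units complex_field = carrier complex_field - {\<zero>\<^bsub>complex_field\<^esub>}"
  proof -
    have "\<exists>y. y * x = 1 \<and> x * y = 1" if "x \<noteq> 0" for x :: complex
      using that by (intro exI[of _ "inverse x"]) simp
    then show ?thesis by (auto simp: Units_def complex_field_def)
  qed
  ultimately show ?thesis by (intro cring.cring_fieldI)
qed

text \<open>The time-one map of the vector field with coefficients \<open>fst \<xi>\<close> and \<open>snd \<xi>\<close>, level by level.\<close>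

definition tuple_exp :: "nat \<Rightarrow> tuple \<Rightarrow> tuple" where
  "tuple_exp p \<xi> = ((\<lambda>j\<in>{..<p}. \<lambda>x\<in>{0<..}. exp_poly p (\<lambda>k. fst \<xi> k x) (snd \<xi> x) j), snd \<xi>)"

definition tuple_lin :: "nat \<Rightarrow> complex \<Rightarrow> tuple \<Rightarrow> complex \<Rightarrow> tuple \<Rightarrow> tuple" where
  "tuple_lin p a \<xi> b \<zeta> = ((\<lambda>j\<in>{..<p}. \<lambda>x\<in>{0<..}. a * fst \<xi> j x + b * fst \<zeta> j x),
     (\<lambda>x\<in>{0<..}. a * snd \<xi> x + b * snd \<zeta> x))"

lemma tuple_spaceI:
  "s \<in> extensional {0<..} \<Longrightarrow> ((\<lambda>j\<in>{..<p}. \<lambda>x\<in>{0<..}. f j x), s) \<in> tuple_space p"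
  by (auto simp: tuple_space_def)

lemma tuple_space_snd: "\<xi> \<in> tuple_space p \<Longrightarrow> snd \<xi> \<in> extensional {0<..}"
  unfolding tuple_space_def mem_Times_iff by blast

lemma tuple_exp_tuple_space: "\<xi> \<in> tuple_space p \<Longrightarrow> tuple_exp p \<xi> \<in> tuple_space p"
  unfolding tuple_exp_def by (intro tuple_spaceI tuple_space_snd)

context reeb_solutions
begin

text \<open>The components of the vector fields \<open>(\<Sum>k<p. q k x * z2 ^ k) \<partial>\<^sub>1 + s x \<partial>\<^sub>2\<close> invariant under \<open>T\<close>.\<close>

definition Lie :: "tuple set" where
  "Lie = {\<xi> \<in> tuple_space p. smooth_tuple p \<xi> \<and>
     (\<forall>x>0. (\<forall>k<p. fst \<xi> k (\<phi> x) = \<mu> ^ (p - k) * fst \<xi> k x + (if k = p - 1 then c k * snd \<xi> x else 0)) \<and>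
       snd \<xi> (\<phi> x) = \<mu> * snd \<xi> x)}"

lemma tuple_lin_Lie:
  assumes "\<xi> \<in> Lie" "\<zeta> \<in> Lie"
  shows "tuple_lin p a \<xi> b \<zeta> \<in> Lie"
  unfolding Lie_def mem_Collect_eq
proof (intro conjI allI impI)
  show "tuple_lin p a \<xi> b \<zeta> \<in> tuple_space p" by (auto simp: tuple_lin_def tuple_space_def)
  have sm: "smooth_tuple p \<xi>" "smooth_tuple p \<zeta>" using assms by (simp_all add: Lie_def)
  have "smooth_on {0<..} (fst (tuple_lin p a \<xi> b \<zeta>) j)" if j: "j < p" for j
  proof -
    have "smooth_on {0<..} (\<lambda>x. a * fst \<xi> j x + b * fst \<zeta> j x)"
      using sm j by (intro smooth_on_intros) (auto simp: smooth_tuple_def)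
    then show ?thesis by (rule smooth_on_cong) (use j in \<open>simp add: tuple_lin_def\<close>)
  qed
  moreover have "smooth_on {0<..} (snd (tuple_lin p a \<xi> b \<zeta>))"
  proof -
    have "smooth_on {0<..} (\<lambda>x. a * snd \<xi> x + b * snd \<zeta> x)"
      using sm by (intro smooth_on_intros) (auto simp: smooth_tuple_def)
    then show ?thesis by (rule smooth_on_cong) (simp add: tuple_lin_def)
  qed
  ultimately show "smooth_tuple p (tuple_lin p a \<xi> b \<zeta>)" by (simp add: smooth_tuple_def)
  fix x :: real assume x: "x > 0"
  show "snd (tuple_lin p a \<xi> b \<zeta>) (\<phi> x) = \<mu> * snd (tuple_lin p a \<xi> b \<zeta>) x"
    using assms x by (simp add: tuple_lin_def Lie_def phi_pos algebra_simps)
  fix k assume k: "k < p"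
  show "fst (tuple_lin p a \<xi> b \<zeta>) k (\<phi> x) = \<mu> ^ (p - k) * fst (tuple_lin p a \<xi> b \<zeta>) k x
      + (if k = p - 1 then c k * snd (tuple_lin p a \<xi> b \<zeta>) x else 0)"
    using assms x k by (simp add: tuple_lin_def Lie_def phi_pos algebra_simps)
qed

lemma tuple_exp_Sol_iff:
  assumes "\<xi> \<in> tuple_space p" "smooth_tuple p \<xi>"
  shows "tuple_exp p \<xi> \<in> Sol \<longleftrightarrow> \<xi> \<in> Lie"
proof -
  have ts: "tuple_exp p \<xi> \<in> tuple_space p"
    by (rule tuple_exp_tuple_space[OF assms(1)])
  have sm: "smooth_tuple p (tuple_exp p \<xi>)"
    unfolding smooth_tuple_def
  proof (intro conjI allI impI)
    fix j assume j: "j < p"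
    have "smooth_on {0<..} (\<lambda>x. \<Sum>k=j..<p. of_nat (k choose j) / of_nat (k - j + 1) * snd \<xi> x ^ (k - j) * fst \<xi> k x)"
      using assms(2) by (intro smooth_on_intros) (auto simp: smooth_tuple_def)
    then show "smooth_on {0<..} (fst (tuple_exp p \<xi>) j)"
      by (rule smooth_on_cong) (use j in \<open>simp add: tuple_exp_def exp_poly_def exp_coeff_def\<close>)
  qed (use assms(2) in \<open>simp add: tuple_exp_def smooth_tuple_def\<close>)
  have eqs: "(\<forall>j<p. fst (tuple_exp p \<xi>) j (\<phi> x) = \<mu> ^ (p - j) * fst (tuple_exp p \<xi>) j x + c j * snd (tuple_exp p \<xi>) x ^ (p - j)) \<longleftrightarrow>
      (\<forall>k<p. fst \<xi> k (\<phi> x) = \<mu> ^ (p - k) * fst \<xi> k x + (if k = p - 1 then c k * snd \<xi> x else 0))"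
    if x: "x > 0" and s: "snd \<xi> (\<phi> x) = \<mu> * snd \<xi> x" for x
  proof -
    have "fst (tuple_exp p \<xi>) j (\<phi> x) = exp_poly p (\<lambda>k. fst \<xi> k (\<phi> x)) (\<mu> * snd \<xi> x) j"
      "fst (tuple_exp p \<xi>) j x = exp_poly p (\<lambda>k. fst \<xi> k x) (snd \<xi> x) j" if "j < p" for j
      using x phi_pos[OF x] that by (simp_all add: tuple_exp_def s)
    moreover have "p > 0" using p by simp
    moreover have "snd (tuple_exp p \<xi>) = snd \<xi>" by (simp add: tuple_exp_def)
    ultimately show ?thesis
      using exp_poly_equivariant[OF mu_nz _ c, of "\<lambda>k. fst \<xi> k (\<phi> x)" "snd \<xi> x" "\<lambda>k. fst \<xi> k x"]
      by (simp cong: all_cong1)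
  qed
  have "snd (tuple_exp p \<xi>) = snd \<xi>" by (simp add: tuple_exp_def)
  then show ?thesis
    unfolding mem_Sol_iff Lie_def mem_Collect_eq using assms ts sm eqs
    by (metis (no_types, lifting))
qed

lemma Lie_tuple_space: "\<xi> \<in> Lie \<Longrightarrow> \<xi> \<in> tuple_space p" "\<xi> \<in> Lie \<Longrightarrow> smooth_tuple p \<xi>"
  by (simp_all add: Lie_def)

lemma tuple_exp_Sol: "\<xi> \<in> Lie \<Longrightarrow> tuple_exp p \<xi> \<in> Sol"
  using tuple_exp_Sol_iff Lie_tuple_space by blast

lemma tuple_exp_inject:
  assumes "\<xi> \<in> tuple_space p" "\<zeta> \<in> tuple_space p" and eq: "tuple_exp p \<xi> = tuple_exp p \<zeta>"
  shows "\<xi> = \<zeta>"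
proof (rule tuple_space_eqI[OF assms(1,2)])
  have s: "snd \<xi> = snd \<zeta>" using arg_cong[OF eq, of snd] by (simp add: tuple_exp_def)
  then show "snd \<xi> x = snd \<zeta> x" for x by simp
  fix j x assume j: "j < p" and x: "(x::real) > 0"
  have "exp_poly p (\<lambda>k. fst \<xi> k x) (snd \<xi> x) i = exp_poly p (\<lambda>k. fst \<zeta> k x) (snd \<xi> x) i" if "i < p" for i
    using arg_cong[OF eq, of "\<lambda>t. fst t i x"] that x s by (simp add: tuple_exp_def)
  from exp_poly_inject[OF this j] show "fst \<xi> j x = fst \<zeta> j x" .
qed

text \<open>The exponential map is unipotent upper triangular in the coefficients, so it is inverted by
  solving for the highest coefficient first.\<close>

lemma tuple_exp_surj:
  assumes S: "\<beta> \<in> Sol"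
  obtains \<xi> where "\<xi> \<in> Lie" "tuple_exp p \<xi> = \<beta>"
proof -
  have sm: "smooth_on {0<..} (snd \<beta>)" "\<And>j. j < p \<Longrightarrow> smooth_on {0<..} (fst \<beta> j)"
    using S by (simp_all add: mem_Sol_iff smooth_tuple_def)
  have "\<exists>q. (\<forall>j<p. smooth_on {0<..} (q j)) \<and>
      (\<forall>j<p. p - m \<le> j \<longrightarrow> (\<forall>x>0. fst \<beta> j x = exp_poly p (\<lambda>k. q k x) (snd \<beta> x) j))" if "m \<le> p" for m
    using that
  proof (induction m)
    case 0
    show ?case by (intro exI[of _ "\<lambda>j x. 0"]) (auto intro: smooth_on_const)
  next
    case (Suc m)
    then obtain q where q: "\<And>j. j < p \<Longrightarrow> smooth_on {0<..} (q j)"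
      "\<And>j x. j < p \<Longrightarrow> p - m \<le> j \<Longrightarrow> x > 0 \<Longrightarrow> fst \<beta> j x = exp_poly p (\<lambda>k. q k x) (snd \<beta> x) j" by auto
    define i where "i = p - Suc m"
    have i: "i < p" "Suc i = p - m" using Suc.prems by (auto simp: i_def)
    define r where "r = q(i := \<lambda>x. fst \<beta> i x - (\<Sum>k=Suc i..<p. of_nat (k choose i) / of_nat (k - i + 1) * snd \<beta> x ^ (k - i) * q k x))"
    have "smooth_on {0<..} (r j)" if "j < p" for j
    proof (cases "j = i")
      case True
      have "smooth_on {0<..} (\<lambda>x. fst \<beta> i x - (\<Sum>k=Suc i..<p. of_nat (k choose i) / of_nat (k - i + 1) * snd \<beta> x ^ (k - i) * q k x))"
        by (intro smooth_on_minus smooth_on_sum smooth_on_mult smooth_on_const smooth_on_power sm q i) auto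
      then show ?thesis using True by (simp add: r_def)
    qed (use q that in \<open>simp add: r_def\<close>)
    moreover have "fst \<beta> j x = exp_poly p (\<lambda>k. r k x) (snd \<beta> x) j" if j: "j < p" "p - Suc m \<le> j" and x: "x > 0" for j x
    proof (cases "j = i")
      case True
      have "(\<Sum>k=Suc i..<p. exp_coeff (snd \<beta> x) k i * r k x) = (\<Sum>k=Suc i..<p. exp_coeff (snd \<beta> x) k i * q k x)"
        by (intro sum.cong refl) (simp add: r_def)
      then show ?thesis
        using True by (simp add: exp_poly_rec[OF i(1)]) (simp add: r_def exp_coeff_def)
    next
      case False
      then have "exp_poly p (\<lambda>k. r k x) (snd \<beta> x) j = exp_poly p (\<lambda>k. q k x) (snd \<beta> x) j"
        unfolding exp_poly_def using j by (intro sum.cong refl) (auto simp: r_def i_def)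
      then show ?thesis using q(2)[OF j(1) _ x] False j i by (simp add: i_def)
    qed
    ultimately show ?case by blast
  qed
  from this[of p] obtain q where q: "\<And>j. j < p \<Longrightarrow> smooth_on {0<..} (q j)"
    "\<And>j x. j < p \<Longrightarrow> x > 0 \<Longrightarrow> fst \<beta> j x = exp_poly p (\<lambda>k. q k x) (snd \<beta> x) j" by auto
  define \<xi> :: tuple where "\<xi> = ((\<lambda>j\<in>{..<p}. \<lambda>x\<in>{0<..}. q j x), snd \<beta>)"
  have ts: "\<xi> \<in> tuple_space p"
    unfolding \<xi>_def by (rule tuple_spaceI[OF tuple_space_snd[OF Sol_tuple_space[OF S]]])
  have "smooth_on {0<..} (fst \<xi> j)" if "j < p" for j
    by (rule smooth_on_cong[OF q(1)[OF that]]) (use that in \<open>simp add: \<xi>_def\<close>)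
  then have sm\<xi>: "smooth_tuple p \<xi>" using sm(1) by (simp add: smooth_tuple_def \<xi>_def)
  have "tuple_exp p \<xi> = \<beta>"
  proof (rule tuple_space_eqI[OF _ Sol_tuple_space[OF S]])
    show "tuple_exp p \<xi> \<in> tuple_space p"
      by (rule tuple_exp_tuple_space[OF ts])
    fix j x assume j: "j < p" and x: "(x::real) > 0"
    have "exp_poly p (\<lambda>k. fst \<xi> k x) (snd \<beta> x) j = exp_poly p (\<lambda>k. q k x) (snd \<beta> x) j"
      unfolding exp_poly_def using x by (intro sum.cong refl) (simp add: \<xi>_def)
    then show "fst (tuple_exp p \<xi>) j x = fst \<beta> j x"
      using j x q(2)[OF j x] by (simp add: tuple_exp_def \<xi>_def)
  qed (simp add: tuple_exp_def \<xi>_def)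
  moreover from this have "\<xi> \<in> Lie" using tuple_exp_Sol_iff[OF ts sm\<xi>] S by simp
  ultimately show ?thesis using that by blast
qed

definition tuple_log :: "tuple \<Rightarrow> tuple" where
  "tuple_log = inv_into Lie (tuple_exp p)"

lemma inj_on_tuple_exp: "inj_on (tuple_exp p) Lie"
  using tuple_exp_inject Lie_tuple_space by (intro inj_onI) blast

lemma tuple_log_exp: "\<xi> \<in> Lie \<Longrightarrow> tuple_log (tuple_exp p \<xi>) = \<xi>"
  unfolding tuple_log_def by (rule inv_into_f_f[OF inj_on_tuple_exp])

lemma tuple_log:
  assumes "\<beta> \<in> Sol"
  shows "tuple_log \<beta> \<in> Lie" "tuple_exp p (tuple_log \<beta>) = \<beta>" "snd (tuple_log \<beta>) = snd \<beta>"
proof -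
  obtain \<xi> where x: "\<xi> \<in> Lie" "tuple_exp p \<xi> = \<beta>" by (rule tuple_exp_surj[OF assms])
  then have "tuple_log \<beta> = \<xi>" using tuple_log_exp by blast
  with x show "tuple_log \<beta> \<in> Lie" "tuple_exp p (tuple_log \<beta>) = \<beta>" "snd (tuple_log \<beta>) = snd \<beta>"
    by (auto simp: tuple_exp_def)
qed

text \<open>The pointwise structure on \<open>Lie\<close>, transported along the exponential map.\<close>

definition sol_space :: "(complex, tuple) module" where
  "sol_space = \<lparr>carrier = Sol, mult = tuple_comp p, one = tuple_one, zero = tuple_one,
     add = (\<lambda>\<beta> \<gamma>. tuple_exp p (tuple_lin p 1 (tuple_log \<beta>) 1 (tuple_log \<gamma>))),
     smult = (\<lambda>a \<beta>. tuple_exp p (tuple_lin p a (tuple_log \<beta>) 0 (tuple_log \<beta>)))\<rparr>"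

lemma Lie_eqI:
  assumes "\<xi> \<in> Lie" "\<zeta> \<in> Lie" "\<And>j x. j < p \<Longrightarrow> x > 0 \<Longrightarrow> fst \<xi> j x = fst \<zeta> j x"
    "\<And>x. x > 0 \<Longrightarrow> snd \<xi> x = snd \<zeta> x"
  shows "\<xi> = \<zeta>"
  using assms by (intro tuple_space_eqI[of _ p]) (auto intro: Lie_tuple_space)

lemma tuple_one_Lie: "tuple_one \<in> Lie" and tuple_exp_one: "tuple_exp p tuple_one = tuple_one"
proof -
  have "smooth_tuple p tuple_one" using Sol_one unfolding mem_Sol_iff by blast
  then show "tuple_one \<in> Lie" using p by (simp add: Lie_def tuple_space_closed phi_pos)
  show "tuple_exp p tuple_one = tuple_one"
    by (auto simp: tuple_exp_def exp_poly_def fun_eq_iff restrict_def intro!: sum.neutral)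
qed

lemma tuple_log_one: "tuple_log tuple_one = tuple_one"
  using tuple_log_exp[OF tuple_one_Lie] tuple_exp_one by simp

lemma vectorspace_sol_space: "vectorspace complex_field sol_space"
proof -
  note L = tuple_log(1) tuple_lin_Lie tuple_exp_Sol tuple_log_exp tuple_one_Lie
  have lin_fst: "fst (tuple_lin p a \<xi> b \<zeta>) j x = a * fst \<xi> j x + b * fst \<zeta> j x" if "j < p" "x > 0" for a b \<xi> \<zeta> j x
    using that by (simp add: tuple_lin_def)
  have lin_snd: "snd (tuple_lin p a \<xi> b \<zeta>) x = a * snd \<xi> x + b * snd \<zeta> x" if "x > 0" for a b \<xi> \<zeta> x
    using that by (simp add: tuple_lin_def)
  have exp_eqI: "tuple_exp p \<xi> = tuple_exp p \<zeta>"
    if "\<xi> \<in> Lie" "\<zeta> \<in> Lie" "\<And>j x. j < p \<Longrightarrow> x > 0 \<Longrightarrow> fst \<xi> j x = fst \<zeta> j x"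
      "\<And>x. x > 0 \<Longrightarrow> snd \<xi> x = snd \<zeta> x" for \<xi> \<zeta>
    using Lie_eqI[OF that] by simp
  have one: "fst tuple_one j x = 0" "snd tuple_one x = 0" if "j < p" "x > 0" for j and x :: real
    using that by simp_all
  have ag: "abelian_group sol_space"
  proof (rule abelian_groupI)
    fix \<alpha> \<beta> \<gamma> assume "\<alpha> \<in> carrier sol_space" "\<beta> \<in> carrier sol_space" "\<gamma> \<in> carrier sol_space"
    then have S: "\<alpha> \<in> Sol" "\<beta> \<in> Sol" "\<gamma> \<in> Sol" by (auto simp: sol_space_def)
    show "\<alpha> \<oplus>\<^bsub>sol_space\<^esub> \<beta> \<in> carrier sol_space" using S by (simp add: sol_space_def L)
    show "\<alpha> \<oplus>\<^bsub>sol_space\<^esub> \<beta> \<oplus>\<^bsub>sol_space\<^esub> \<gamma> = \<alpha> \<oplus>\<^bsub>sol_space\<^esub> (\<beta> \<oplus>\<^bsub>sol_space\<^esub> \<gamma>)"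
      using S by (simp add: sol_space_def L) (rule exp_eqI; simp add: L lin_fst lin_snd)
    show "\<alpha> \<oplus>\<^bsub>sol_space\<^esub> \<beta> = \<beta> \<oplus>\<^bsub>sol_space\<^esub> \<alpha>"
      using S by (simp add: sol_space_def L) (rule exp_eqI; simp add: L lin_fst lin_snd)
  next
    show "\<zero>\<^bsub>sol_space\<^esub> \<in> carrier sol_space" using Sol_one by (simp add: sol_space_def)
    fix \<alpha> assume "\<alpha> \<in> carrier sol_space"
    then have S: "\<alpha> \<in> Sol" by (simp add: sol_space_def)
    have "tuple_exp p (tuple_lin p 1 (tuple_log tuple_one) 1 (tuple_log \<alpha>)) = tuple_exp p (tuple_log \<alpha>)"
      unfolding tuple_log_one by (rule exp_eqI) (simp_all add: L S lin_fst lin_snd)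
    then show "\<zero>\<^bsub>sol_space\<^esub> \<oplus>\<^bsub>sol_space\<^esub> \<alpha> = \<alpha>" using S by (simp add: sol_space_def tuple_log)
    have "tuple_exp p (tuple_lin p 1 (tuple_lin p (-1) (tuple_log \<alpha>) 0 (tuple_log \<alpha>)) 1 (tuple_log \<alpha>)) = tuple_exp p tuple_one"
      by (rule exp_eqI) (simp_all add: L S lin_fst lin_snd)
    then show "\<exists>\<beta>\<in>carrier sol_space. \<beta> \<oplus>\<^bsub>sol_space\<^esub> \<alpha> = \<zero>\<^bsub>sol_space\<^esub>"
      using S by (intro bexI[of _ "tuple_exp p (tuple_lin p (-1) (tuple_log \<alpha>) 0 (tuple_log \<alpha>))"])
        (simp_all add: sol_space_def L tuple_exp_one)
  qed
  interpret field complex_field by (rule field_complex_field)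
  have "module complex_field sol_space"
  proof (rule moduleI[OF is_cring ag])
    fix a b \<alpha> assume "\<alpha> \<in> carrier sol_space"
    then have S: "\<alpha> \<in> Sol" by (simp add: sol_space_def)
    show "a \<odot>\<^bsub>sol_space\<^esub> \<alpha> \<in> carrier sol_space" using S by (simp add: sol_space_def L)
    show "(a \<oplus>\<^bsub>complex_field\<^esub> b) \<odot>\<^bsub>sol_space\<^esub> \<alpha> = a \<odot>\<^bsub>sol_space\<^esub> \<alpha> \<oplus>\<^bsub>sol_space\<^esub> b \<odot>\<^bsub>sol_space\<^esub> \<alpha>"
      using S by (simp add: sol_space_def complex_field_def L) (rule exp_eqI; simp add: L lin_fst lin_snd algebra_simps)
    show "(a \<otimes>\<^bsub>complex_field\<^esub> b) \<odot>\<^bsub>sol_space\<^esub> \<alpha> = a \<odot>\<^bsub>sol_space\<^esub> (b \<odot>\<^bsub>sol_space\<^esub> \<alpha>)"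
      using S by (simp add: sol_space_def complex_field_def L) (rule exp_eqI; simp add: L lin_fst lin_snd algebra_simps)
    have "tuple_exp p (tuple_lin p 1 (tuple_log \<alpha>) 0 (tuple_log \<alpha>)) = tuple_exp p (tuple_log \<alpha>)"
      by (rule exp_eqI) (simp_all add: L S lin_fst lin_snd)
    then show "\<one>\<^bsub>complex_field\<^esub> \<odot>\<^bsub>sol_space\<^esub> \<alpha> = \<alpha>"
      using S by (simp add: sol_space_def complex_field_def tuple_log)
    fix \<beta> assume "\<beta> \<in> carrier sol_space"
    then have S': "\<beta> \<in> Sol" by (simp add: sol_space_def)
    show "a \<odot>\<^bsub>sol_space\<^esub> (\<alpha> \<oplus>\<^bsub>sol_space\<^esub> \<beta>) = a \<odot>\<^bsub>sol_space\<^esub> \<alpha> \<oplus>\<^bsub>sol_space\<^esub> a \<odot>\<^bsub>sol_space\<^esub> \<beta>"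
      using S S' by (simp add: sol_space_def L) (rule exp_eqI; simp add: L lin_fst lin_snd algebra_simps)
  qed
  then show ?thesis by (intro vectorspace.intro field_complex_field)
qed

text \<open>The three cases are \<open>\<beta>2 x \<noteq> 0\<close>, the same with the roles of \<open>\<beta>\<close> and \<open>\<gamma>\<close> exchanged, and the case in which
  both translations vanish and composition is addition.\<close>

lemma tuple_exp_comp:
  assumes S: "\<beta> \<in> Sol" "\<gamma> \<in> Sol" and comm: "tuple_comp p \<beta> \<gamma> = tuple_comp p \<gamma> \<beta>"
  shows "\<beta> \<oplus>\<^bsub>sol_space\<^esub> \<gamma> = tuple_comp p \<beta> \<gamma>"
proof -
  define \<xi> \<zeta> where "\<xi> = tuple_log \<beta>" and "\<zeta> = tuple_log \<gamma>"
  have L: "\<xi> \<in> Lie" "\<zeta> \<in> Lie" using S tuple_log by (auto simp: \<xi>_def \<zeta>_def)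
  have be: "\<beta> = tuple_exp p \<xi>" "\<gamma> = tuple_exp p \<zeta>" using S tuple_log by (auto simp: \<xi>_def \<zeta>_def)
  have main: "(\<Sum>j<p. exp_poly p (\<lambda>k. fst \<xi> k x + fst \<zeta> k x) (snd \<xi> x + snd \<zeta> x) j * z ^ j)
      = (\<Sum>j<p. fst (tuple_comp p \<beta> \<gamma>) j x * z ^ j)" if x: "x > 0" for x z
  proof -
    define q r s t where "q = (\<lambda>k. fst \<xi> k x)" and "r = (\<lambda>k. fst \<zeta> k x)" and "s = snd \<xi> x" and "t = snd \<zeta> x"
    have comp: "(\<Sum>j<p. fst (tuple_comp p \<beta> \<gamma>) j x * z ^ j)
        = (\<Sum>j<p. exp_poly p r t j * z ^ j) + (\<Sum>j<p. exp_poly p q s j * (z + t) ^ j)" for z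
      using tuple_lift_comp[of "(0, z, x)" p \<beta> \<gamma>] x
      by (simp add: tuple_lift_pos be tuple_exp_def q_def r_def s_def t_def)
    have comp': "(\<Sum>j<p. fst (tuple_comp p \<beta> \<gamma>) j x * z ^ j)
        = (\<Sum>j<p. exp_poly p q s j * z ^ j) + (\<Sum>j<p. exp_poly p r t j * (z + s) ^ j)" for z
      using tuple_lift_comp[of "(0, z, x)" p \<gamma> \<beta>] x unfolding comm
      by (simp add: tuple_lift_pos be tuple_exp_def q_def r_def s_def t_def)
    have eq: "(\<Sum>j<p. exp_poly p r t j * z ^ j) + (\<Sum>j<p. exp_poly p q s j * (z + t) ^ j)
        = (\<Sum>j<p. exp_poly p q s j * z ^ j) + (\<Sum>j<p. exp_poly p r t j * (z + s) ^ j)" for z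
      using comp comp' by metis
    have "(\<Sum>j<p. exp_poly p (\<lambda>k. q k + r k) (s + t) j * z ^ j) = (\<Sum>j<p. fst (tuple_comp p \<beta> \<gamma>) j x * z ^ j)"
    proof (cases "s = 0")
      case False
      then show ?thesis using exp_poly_commuting[OF False eq] comp by simp
    next
      case s: True
      show ?thesis
      proof (cases "t = 0")
        case False
        have "(\<Sum>j<p. exp_poly p (\<lambda>k. r k + q k) (t + s) j * z ^ j)
            = (\<Sum>j<p. exp_poly p q s j * z ^ j) + (\<Sum>j<p. exp_poly p r t j * (z + s) ^ j)"
          by (rule exp_poly_commuting[OF False eq[symmetric]])
        then show ?thesis using comp' by (simp add: add.commute)
      next
        case True
        then show ?thesis
          unfolding comp s by (simp add: exp_poly_zero distrib_right sum.distrib add.commute)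
      qed
    qed
    then show ?thesis by (simp add: q_def r_def s_def t_def)
  qed
  have "tuple_exp p (tuple_lin p 1 \<xi> 1 \<zeta>) = tuple_comp p \<beta> \<gamma>"
  proof (rule tuple_space_eqI[OF _ tuple_space_closed(1)])
    show "tuple_exp p (tuple_lin p 1 \<xi> 1 \<zeta>) \<in> tuple_space p"
      by (rule Sol_tuple_space[OF tuple_exp_Sol[OF tuple_lin_Lie[OF L]]])
    fix x :: real assume x: "x > 0"
    show "snd (tuple_exp p (tuple_lin p 1 \<xi> 1 \<zeta>)) x = snd (tuple_comp p \<beta> \<gamma>) x"
      using x by (simp add: be tuple_exp_def tuple_lin_def tuple_comp_eq)
    fix j assume j: "j < p"
    have "exp_poly p (\<lambda>k. fst (tuple_lin p 1 \<xi> 1 \<zeta>) k x) (snd (tuple_lin p 1 \<xi> 1 \<zeta>) x) j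
        = exp_poly p (\<lambda>k. fst \<xi> k x + fst \<zeta> k x) (snd \<xi> x + snd \<zeta> x) j"
      unfolding exp_poly_def using x by (intro sum.cong) (auto simp: tuple_lin_def)
    then show "fst (tuple_exp p (tuple_lin p 1 \<xi> 1 \<zeta>)) j x = fst (tuple_comp p \<beta> \<gamma>) j x"
      using sum_powers_eq_imp_coeff_eq[OF main[OF x] j] j x by (simp add: tuple_exp_def)
  qed
  then show ?thesis by (simp add: sol_space_def \<xi>_def \<zeta>_def)
qed

lemma fst_tuple_exp_top: "x > 0 \<Longrightarrow> fst (tuple_exp p \<xi>) (p - 1) x = fst \<xi> (p - 1) x"
  using p exp_poly_top[of p "\<lambda>k. fst \<xi> k x" "snd \<xi> x"] by (simp add: tuple_exp_def)

lemma log_top: "\<beta> \<in> Sol \<Longrightarrow> x > 0 \<Longrightarrow> fst (tuple_log \<beta>) (p - 1) x = fst \<beta> (p - 1) x"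
  using fst_tuple_exp_top[of x "tuple_log \<beta>"] tuple_log(2) by simp

lemma solution_vs_structure_sol_space: "solution_vs_structure \<phi> \<mu> p c sol_space"
  unfolding solution_vs_structure_def
proof (intro conjI ballI allI impI)
  show "carrier sol_space = Sol" by (simp add: sol_space_def)
  show "vectorspace complex_field sol_space" by (rule vectorspace_sol_space)
  fix \<beta> assume "\<beta> \<in> carrier sol_space"
  then have S: "\<beta> \<in> Sol" by (simp add: sol_space_def)
  {
    fix \<gamma> assume "\<gamma> \<in> carrier sol_space"
    then have S': "\<gamma> \<in> Sol" by (simp add: sol_space_def)
    show "\<beta> \<oplus>\<^bsub>sol_space\<^esub> \<gamma> = tuple_comp p \<beta> \<gamma>" if "tuple_comp p \<beta> \<gamma> = tuple_comp p \<gamma> \<beta>"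
      by (rule tuple_exp_comp[OF S S' that])
    fix x :: real assume x: "x > 0"
    show "snd (\<beta> \<oplus>\<^bsub>sol_space\<^esub> \<gamma>) x = snd \<beta> x + snd \<gamma> x"
      using x S S' by (simp add: sol_space_def tuple_exp_def tuple_lin_def tuple_log)
    show "fst (\<beta> \<oplus>\<^bsub>sol_space\<^esub> \<gamma>) (p - 1) x = fst \<beta> (p - 1) x + fst \<gamma> (p - 1) x"
      using x p log_top[OF S x] log_top[OF S' x]
        fst_tuple_exp_top[OF x, of "tuple_lin p 1 (tuple_log \<beta>) 1 (tuple_log \<gamma>)"]
      by (simp add: sol_space_def tuple_lin_def)
  }
  fix a
  show "snd (a \<odot>\<^bsub>sol_space\<^esub> \<beta>) x = a * snd \<beta> x" if "x > 0" for x
    using that S by (simp add: sol_space_def tuple_exp_def tuple_lin_def tuple_log)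
  show "fst (a \<odot>\<^bsub>sol_space\<^esub> \<beta>) (p - 1) x = a * fst \<beta> (p - 1) x" if "x > 0" for x
    using that p log_top[OF S that] fst_tuple_exp_top[OF that, of "tuple_lin p a (tuple_log \<beta>) 0 (tuple_log \<beta>)"]
    by (simp add: sol_space_def tuple_lin_def)
  show "fst (a \<odot>\<^bsub>sol_space\<^esub> \<beta>) j x = a * fst \<beta> j x"
    if z: "\<forall>x>0. snd \<beta> x = 0" and j: "j < p" and x: "x > 0" for j x
  proof -
    have "fst (tuple_exp p (tuple_log \<beta>)) j x = fst (tuple_log \<beta>) j x"
      using z x j tuple_log(3)[OF S] by (simp add: tuple_exp_def exp_poly_zero)
    then have "fst \<beta> j x = fst (tuple_log \<beta>) j x" by (simp add: tuple_log(2)[OF S])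
    then show ?thesis
      using z x j tuple_log(3)[OF S]
      by (simp add: sol_space_def tuple_exp_def tuple_lin_def exp_poly_zero)
  qed
qed

end

subsection \<open>Infinite dimension\<close>

text \<open>The functions \<open>(1 / x) ^ m * exp (- (1 / x))\<close> span a space closed under differentiation, so this decay
  covers all derivatives of \<open>exp (- (1 / x))\<close>.\<close>

lemma power_exp_minus_inverse_decay:
  "\<forall>\<^sub>F x::real in at_right 0. norm ((1 / x) ^ m * exp (- (1 / x))) \<le> 1 * x ^ k"
proof -
  have "((\<lambda>t::real. t ^ (m + k) / exp t) \<longlongrightarrow> 0) at_top"
    by (rule tendsto_power_div_exp_0)
  then have "\<forall>\<^sub>F t::real in at_top. t ^ (m + k) / exp t < 1"
    by (rule order_tendstoD) simp
  then have "\<forall>\<^sub>F x::real in at_right 0. inverse x ^ (m + k) / exp (inverse x) < 1"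
    by (rule eventually_compose_filterlim[OF _ filterlim_inverse_at_top_right])
  then show ?thesis
    using eventually_at_right_0_pos
  proof eventually_elim
    case (elim x)
    have "inverse x ^ (m + k) / exp (inverse x) * x ^ k = (1 / x) ^ m * exp (- (1 / x))"
      using elim by (simp add: power_add exp_minus inverse_eq_divide power_divide)
    moreover have "inverse x ^ (m + k) / exp (inverse x) * x ^ k \<le> 1 * x ^ k"
      using elim by (intro mult_right_mono) auto
    moreover have "(1 / x) ^ m * exp (- (1 / x)) \<ge> 0" using elim by simp
    ultimately show ?case by simp
  qed
qed

lemma exp_minus_inverse_has_derivative:
  fixes x :: real
  assumes "x > 0"
  shows "((\<lambda>x. (1 / x) ^ m * exp (- (1 / x))) has_vector_derivative
    (- of_nat m * ((1 / x) ^ (m + 1) * exp (- (1 / x))) + (1 / x) ^ (m + 2) * exp (- (1 / x)))) (at x)"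
proof -
  define u where "u = 1 / x"
  have d1: "((\<lambda>x. 1 / x) has_real_derivative - (u ^ 2)) (at x)"
    using assms by (auto intro!: derivative_eq_intros simp: u_def power2_eq_square)
  have d2: "((\<lambda>x. (1 / x) ^ m) has_real_derivative of_nat m * (- (u ^ 2) * u ^ (m - Suc 0))) (at x)"
    using DERIV_power[OF d1, of m] by (simp add: u_def)
  have d3: "((\<lambda>x. exp (- (1 / x))) has_real_derivative exp (- u) * u ^ 2) (at x)"
    using DERIV_fun_exp[OF DERIV_minus[OF d1]] by (simp add: u_def)
  have "((\<lambda>x. (1 / x) ^ m * exp (- (1 / x))) has_real_derivative
    (- of_nat m * (u ^ (m + 1) * exp (- u)) + u ^ (m + 2) * exp (- u))) (at x)"
    using DERIV_mult[OF d2 d3]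
    by (cases m) (simp_all add: u_def[symmetric] power2_eq_square algebra_simps)
  then have "((\<lambda>x. (1 / x) ^ m * exp (- (1 / x))) has_real_derivative
    (- of_nat m * ((1 / x) ^ (m + 1) * exp (- (1 / x))) + (1 / x) ^ (m + 2) * exp (- (1 / x)))) (at x)"
    unfolding u_def .
  then show ?thesis by (simp add: has_real_derivative_iff_has_vector_derivative)
qed

lemma exp_minus_inverse_smooth: "smooth_on {0::real<..} (\<lambda>x. (1 / x) ^ m * exp (- (1 / x)))"
proof -
  have "Ck_on k {0::real<..} (\<lambda>x. (1 / x) ^ m * exp (- (1 / x)))" for k
  proof (induction k arbitrary: m)
    case 0
    show ?case by (auto intro!: continuous_intros)
  next
    case (Suc k)
    let ?d = "\<lambda>x::real. - of_nat m * ((1 / x) ^ (m + 1) * exp (- (1 / x))) + (1 / x) ^ (m + 2) * exp (- (1 / x))"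
    show ?case
    proof (rule Ck_on_SucI)
      show "((\<lambda>x. (1 / x) ^ m * exp (- (1 / x))) has_derivative (\<lambda>v. v *\<^sub>R ?d x)) (at x)" if "x \<in> {0<..}" for x :: real
        using exp_minus_inverse_has_derivative[of x m] that by (simp only: has_vector_derivative_def greaterThan_iff)
      show "Ck_on k {0<..} (\<lambda>x. v *\<^sub>R ?d x)" for v
        by (intro Ck_on_bounded_linear[OF bounded_linear_scaleR_right] Ck_on_add
            Ck_on_bounded_linear[OF bounded_linear_mult_right] Suc.IH) auto
    qed simp
  qed
  then show ?thesis by (simp add: smooth_on_open_iff)
qed

lemma exp_minus_inverse_jet: "jet_order k n (\<lambda>x::real. (1 / x) ^ m * exp (- (1 / x)))"
proof (induction n arbitrary: m)
  have *: "order_at_0 k (\<lambda>x::real. (1 / x) ^ m * exp (- (1 / x)))" for m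
    unfolding order_at_0_def using power_exp_minus_inverse_decay by blast
  {
    case 0
    then show ?case by (simp only: jet_order.simps *)
  next
    case (Suc n)
    let ?d = "\<lambda>x::real. - of_nat m * ((1 / x) ^ (m + 1) * exp (- (1 / x))) + (1 / x) ^ (m + 2) * exp (- (1 / x))"
    have "jet_order k n ?d"
      by (intro jet_order_add jet_order_linear[OF bounded_linear_mult_right] Suc.IH
          smooth_on_linear[OF bounded_linear_mult_right] exp_minus_inverse_smooth)
    then have "jet_order k n (vderiv (\<lambda>x. (1 / x) ^ m * exp (- (1 / x))))"
      by (rule jet_order_cong_pos[rotated]) (rule vderiv_eq[OF exp_minus_inverse_has_derivative, symmetric])
    then show ?case by (simp only: jet_order.simps *)
  }
qed

definition half_bump :: "real \<Rightarrow> real" where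
  "half_bump x = (if x > 0 then exp (- (1 / x)) else 0)"

lemma half_bump_smooth: "smooth_on UNIV half_bump"
proof -
  have "Ck_on k UNIV half_bump" for k
    using zero_extension_smooth[OF exp_minus_inverse_smooth[of 0] exp_minus_inverse_jet[of 2 _ 0], of k]
    unfolding half_bump_def[abs_def] power_0 mult_1_left .
  then show ?thesis by (simp add: smooth_on_open_iff)
qed

definition bump :: "real \<Rightarrow> real \<Rightarrow> real \<Rightarrow> complex" where
  "bump l u x = of_real (half_bump (x - l) * half_bump (u - x))"

lemma bump_smooth: "smooth_on UNIV (bump l u)"
proof -
  have "smooth_on UNIV (\<lambda>x. half_bump (x - l))" "smooth_on UNIV (\<lambda>x. half_bump (u - x))"
    using half_bump_smooth by (auto intro!: smooth_on_compose[of UNIV _ UNIV half_bump] smooth_on_intros)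
  then show ?thesis
    unfolding bump_def by (intro smooth_on_linear[OF bounded_linear_of_real] smooth_on_mult)
qed

lemma bump_nonzero_iff: "bump l u x \<noteq> 0 \<longleftrightarrow> l < x \<and> x < u"
  by (auto simp: bump_def half_bump_def)

context reeb_solutions
begin

lemma phi_pow_smooth: "smooth_on {0<..} (\<phi> ^^ n)"
proof (induction n)
  case (Suc n)
  have "smooth_on {0<..} (\<lambda>x. \<phi> ((\<phi> ^^ n) x))"
    by (rule smooth_on_compose[OF Suc phi_smooth_pos]) (simp add: phi_pow_pos)
  then show ?case by (simp add: o_def)
qed (simp add: id_def smooth_on_id)

lemma psi_pow_smooth: "smooth_on {0<..} (psi ^^ n)"
proof (induction n)
  case (Suc n)
  have "smooth_on {0<..} (\<lambda>x. psi ((psi ^^ n) x))"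
    by (rule smooth_on_compose[OF Suc psi_smooth_pos]) (simp add: psi_pow_pos)
  then show ?case by (simp add: o_def)
qed (simp add: id_def smooth_on_id)

lemma psi_mono: "0 \<le> x \<Longrightarrow> x \<le> y \<Longrightarrow> psi x \<le> psi y"
  using phi_strict_mono[of "psi y" "psi x"] phi_psi[of x] phi_psi[of y] psi_nonneg[of y]
  by (metis not_less order_trans)

lemma psi_pow_mono: "0 \<le> x \<Longrightarrow> x \<le> y \<Longrightarrow> (psi ^^ n) x \<le> (psi ^^ n) y"
  by (induction n) (auto intro: psi_mono psi_pow_nonneg)

lemma psi_pow_decreasing: "x > 0 \<Longrightarrow> m \<le> n \<Longrightarrow> (psi ^^ n) x \<le> (psi ^^ m) x"
proof (induction n)
  case (Suc n)
  then show ?case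
    using psi_less[of "(psi ^^ n) x"] psi_pow_pos[of x n] by (cases "m = Suc n") (auto simp: le_Suc_eq)
qed simp

text \<open>Translating a function supported in the fundamental interval from \<open>1\<close> to \<open>\<phi> 1\<close> by the powers
  of \<open>\<phi>\<close> gives a solution of the homogeneous equation. Near each point only finitely many terms of
  the two series do not vanish.\<close>

definition spread :: "(real \<Rightarrow> complex) \<Rightarrow> real \<Rightarrow> complex" where
  "spread b x = (\<Sum>n. b ((\<phi> ^^ n) x) / \<mu> ^ n) + (\<Sum>n. \<mu> ^ Suc n * b ((psi ^^ Suc n) x))"

lemma spread_locally_finite:
  assumes b: "\<And>x. b x \<noteq> 0 \<Longrightarrow> 1 < x \<and> x < \<phi> 1" and x0: "x0 > 0"
  shows "\<exists>N. \<forall>x n. x0 / 2 \<le> x \<longrightarrow> x \<le> 2 * x0 \<longrightarrow> n \<ge> N \<longrightarrow> b ((\<phi> ^^ n) x) = 0 \<and> b ((psi ^^ n) x) = 0"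
proof -
  obtain N1 where N1: "(\<phi> ^^ N1) (x0 / 2) > \<phi> 1" using phi_pow_escapes[of "x0 / 2"] x0 by auto
  have "\<forall>\<^sub>F n in sequentially. (psi ^^ n) (2 * x0) < 1"
    by (rule order_tendstoD[OF psi_pow_tendsto_0]) (use x0 in auto)
  then obtain N2 where N2: "(psi ^^ N2) (2 * x0) < 1" by (auto simp: eventually_sequentially)
  show ?thesis
  proof (intro exI[of _ "max N1 N2"] allI impI)
    fix x n assume x: "x0 / 2 \<le> x" "x \<le> 2 * x0" and n: "max N1 N2 \<le> n"
    have "(\<phi> ^^ N1) (x0 / 2) \<le> (\<phi> ^^ N1) x" using x x0 by (intro phi_pow_mono) auto
    also have "\<dots> \<le> (\<phi> ^^ n) x" using x x0 n by (intro phi_pow_ge) auto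
    finally have 1: "b ((\<phi> ^^ n) x) = 0" using N1 b[of "(\<phi> ^^ n) x"] by force
    have "(psi ^^ n) x \<le> (psi ^^ N2) x" using x x0 n by (intro psi_pow_decreasing) auto
    also have "\<dots> \<le> (psi ^^ N2) (2 * x0)" using x x0 by (intro psi_pow_mono) auto
    finally have "b ((psi ^^ n) x) = 0" using N2 b[of "(psi ^^ n) x"] by force
    with 1 show "b ((\<phi> ^^ n) x) = 0 \<and> b ((psi ^^ n) x) = 0" by simp
  qed
qed

lemma spread_summable:
  assumes b: "\<And>x. b x \<noteq> 0 \<Longrightarrow> 1 < x \<and> x < \<phi> 1" and x: "x > 0"
  shows "summable (\<lambda>n. b ((\<phi> ^^ n) x) / \<mu> ^ n)" "summable (\<lambda>n. \<mu> ^ Suc n * b ((psi ^^ Suc n) x))"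
    "summable (\<lambda>n. \<mu> ^ n * b ((psi ^^ n) x))"
proof -
  obtain N where N0: "\<And>y n. x / 2 \<le> y \<Longrightarrow> y \<le> 2 * x \<Longrightarrow> n \<ge> N \<Longrightarrow> b ((\<phi> ^^ n) y) = 0 \<and> b ((psi ^^ n) y) = 0"
    using spread_locally_finite[OF b x] by blast
  have N: "b ((\<phi> ^^ n) x) = 0 \<and> b ((psi ^^ n) x) = 0" if "n \<ge> N" for n
    by (rule N0) (use x that in auto)
  show "summable (\<lambda>n. b ((\<phi> ^^ n) x) / \<mu> ^ n)" "summable (\<lambda>n. \<mu> ^ Suc n * b ((psi ^^ Suc n) x))"
    "summable (\<lambda>n. \<mu> ^ n * b ((psi ^^ n) x))"
    by (rule summable_finite[of "{..<N}"], simp, simp add: N not_less del: funpow.simps)+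
qed

lemma spread_equation:
  assumes b: "\<And>x. b x \<noteq> 0 \<Longrightarrow> 1 < x \<and> x < \<phi> 1" and x: "x > 0"
  shows "spread b (\<phi> x) = \<mu> * spread b x"
proof -
  note S = spread_summable[OF b x]
  have "(\<Sum>n. b ((\<phi> ^^ n) x) / \<mu> ^ n) = b x + (\<Sum>n. b ((\<phi> ^^ Suc n) x) / \<mu> ^ Suc n)"
    using suminf_split_head[OF S(1)] by simp
  also have "(\<Sum>n. b ((\<phi> ^^ Suc n) x) / \<mu> ^ Suc n) = (\<Sum>n. b ((\<phi> ^^ n) (\<phi> x)) / \<mu> ^ n * (1 / \<mu>))"
    by (simp add: funpow_swap1 mult.commute)
  also have "\<dots> = (\<Sum>n. b ((\<phi> ^^ n) (\<phi> x)) / \<mu> ^ n) * (1 / \<mu>)"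
    using spread_summable(1)[OF b phi_pos[OF x]] by (rule suminf_mult2[symmetric])
  finally have 1: "(\<Sum>n. b ((\<phi> ^^ n) (\<phi> x)) / \<mu> ^ n) = \<mu> * (\<Sum>n. b ((\<phi> ^^ n) x) / \<mu> ^ n) - \<mu> * b x"
    using mu_nz by (simp add: field_simps)
  have "(psi ^^ Suc n) (\<phi> x) = (psi ^^ n) x" for n
    using x by (simp add: funpow_swap1[of psi] psi_phi)
  then have "(\<Sum>n. \<mu> ^ Suc n * b ((psi ^^ Suc n) (\<phi> x))) = (\<Sum>n. \<mu> * (\<mu> ^ n * b ((psi ^^ n) x)))"
    by (simp add: mult.assoc del: funpow.simps)
  also have "\<dots> = \<mu> * (\<Sum>n. \<mu> ^ n * b ((psi ^^ n) x))"
    using S(3) by (rule suminf_mult)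
  also have "(\<Sum>n. \<mu> ^ n * b ((psi ^^ n) x)) = b x + (\<Sum>n. \<mu> ^ Suc n * b ((psi ^^ Suc n) x))"
    using suminf_split_head[OF S(3)] by simp
  finally have 2: "(\<Sum>n. \<mu> ^ Suc n * b ((psi ^^ Suc n) (\<phi> x))) = \<mu> * b x + \<mu> * (\<Sum>n. \<mu> ^ Suc n * b ((psi ^^ Suc n) x))"
    by (simp add: distrib_left)
  show ?thesis unfolding spread_def 1 2 by (simp add: algebra_simps)
qed

lemma spread_smooth:
  assumes b: "\<And>x. b x \<noteq> 0 \<Longrightarrow> 1 < x \<and> x < \<phi> 1" and sm: "smooth_on UNIV b"
  shows "smooth_on {0<..} (spread b)"
proof (rule smooth_on_local)
  fix x0 :: real assume "x0 \<in> {0<..}"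
  then have x0: "x0 > 0" by simp
  obtain N where N: "\<And>x n. x0 / 2 \<le> x \<Longrightarrow> x \<le> 2 * x0 \<Longrightarrow> n \<ge> N \<Longrightarrow> b ((\<phi> ^^ n) x) = 0 \<and> b ((psi ^^ n) x) = 0"
    using spread_locally_finite[OF b x0] by blast
  define I where "I = {x0 / 2<..<2 * x0}"
  have I: "I \<subseteq> {0<..}" using x0 by (auto simp: I_def)
  have s1: "smooth_on I (\<lambda>x. b ((\<phi> ^^ n) x))" and s2: "smooth_on I (\<lambda>x. b ((psi ^^ n) x))" for n
    by (rule smooth_on_compose[OF smooth_on_subset[OF phi_pow_smooth I] sm],
        simp, rule smooth_on_compose[OF smooth_on_subset[OF psi_pow_smooth I] sm], simp)
  have "smooth_on I (\<lambda>x. (\<Sum>n<N. b ((\<phi> ^^ n) x) * (1 / \<mu> ^ n)) + (\<Sum>n<N. \<mu> ^ Suc n * b ((psi ^^ Suc n) x)))"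
    by (intro smooth_on_add smooth_on_sum smooth_on_mult smooth_on_const s1 s2)
  then have "smooth_on I (spread b)"
  proof (rule smooth_on_cong)
    fix x assume "x \<in> I"
    then have x: "x0 / 2 \<le> x" "x \<le> 2 * x0" by (auto simp: I_def)
    have "(\<Sum>n. b ((\<phi> ^^ n) x) / \<mu> ^ n) = (\<Sum>n<N. b ((\<phi> ^^ n) x) / \<mu> ^ n)"
      by (rule suminf_finite) (use N[OF x] in auto)
    moreover have "(\<Sum>n. \<mu> ^ Suc n * b ((psi ^^ Suc n) x)) = (\<Sum>n<N. \<mu> ^ Suc n * b ((psi ^^ Suc n) x))"
    proof (rule suminf_finite)
      fix n assume "n \<notin> {..<N}"
      then show "\<mu> ^ Suc n * b ((psi ^^ Suc n) x) = 0" using N[OF x, of "Suc n"] by (simp del: funpow.simps)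
    qed simp
    ultimately show "(\<Sum>n<N. b ((\<phi> ^^ n) x) * (1 / \<mu> ^ n)) + (\<Sum>n<N. \<mu> ^ Suc n * b ((psi ^^ Suc n) x)) = spread b x"
      unfolding spread_def by simp
  qed
  moreover have "I \<inter> {0<..} = I" "open I" "x0 \<in> I" using I x0 by (auto simp: I_def)
  ultimately show "\<exists>U. open U \<and> x0 \<in> U \<and> smooth_on (U \<inter> {0<..}) (spread b)" by metis
qed

lemma spread_eq:
  assumes b: "\<And>x. b x \<noteq> 0 \<Longrightarrow> 1 < x \<and> x < \<phi> 1" and y: "1 < y" "y < \<phi> 1"
  shows "spread b y = b y"
proof -
  have "b ((\<phi> ^^ n) y) / \<mu> ^ n = 0" if "n \<notin> {0}" for n
  proof -
    have "\<phi> 1 \<le> \<phi> y" using y by (intro phi_mono) auto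
    also have "\<phi> y \<le> (\<phi> ^^ n) y" using phi_pow_ge[of y 1 n] that y by simp
    finally show ?thesis using b[of "(\<phi> ^^ n) y"] by force
  qed
  then have 1: "(\<Sum>n. b ((\<phi> ^^ n) y) / \<mu> ^ n) = b y"
    by (subst suminf_finite[of "{0}"]) auto
  have "\<mu> ^ Suc n * b ((psi ^^ Suc n) y) = 0" for n
  proof -
    have "(psi ^^ Suc n) y \<le> (psi ^^ 1) y" using y by (intro psi_pow_decreasing) auto
    also have "(psi ^^ 1) y \<le> psi (\<phi> 1)" using psi_mono[of y "\<phi> 1"] y by simp
    also have "\<dots> = 1" by (simp add: psi_phi)
    finally show ?thesis using b[of "(psi ^^ Suc n) y"] by (force simp del: funpow.simps)
  qed
  then have "(\<lambda>n. \<mu> ^ Suc n * b ((psi ^^ Suc n) y)) = (\<lambda>n. 0)" by (rule ext)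
  then show ?thesis unfolding spread_def 1 by (simp only: suminf_zero add_0_right)
qed

text \<open>A sequence decreasing from \<open>\<phi> 1\<close> to \<open>1\<close>; consecutive members bound the disjoint supports of bump
  functions.\<close>

definition node :: "nat \<Rightarrow> real" where "node i = 1 + (\<phi> 1 - 1) / real (i + 1)"

lemma node_bounds: "1 < node i" "node i \<le> \<phi> 1" "node (Suc i) < node i" "i \<le> j \<Longrightarrow> node j \<le> node i"
proof -
  have d: "\<phi> 1 - 1 > 0" using moves[of 1] by simp
  then show "1 < node i" by (simp add: node_def)
  show mono: "node j \<le> node i" if "i \<le> j" for i j
    unfolding node_def using d that by (intro add_left_mono divide_left_mono) auto
  show "node i \<le> \<phi> 1" using mono[of 0 i] by (simp add: node_def)
  show "node (Suc i) < node i"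
    unfolding node_def using d by (intro add_strict_left_mono divide_strict_left_mono) auto
qed

text \<open>If \<open>\<beta>2 = 0\<close>, the component with index \<open>p - 1\<close> obeys the homogeneous equation with eigenvalue \<open>\<mu>\<close>, and
  this component is linear in the vector space structure.\<close>

definition test_tuple :: "nat \<Rightarrow> tuple" where
  "test_tuple i = ((\<lambda>j\<in>{..<p}. \<lambda>x\<in>{0<..}. if j = p - 1 then spread (bump (node (Suc i)) (node i)) x else 0), (\<lambda>x\<in>{0<..}. 0))"

definition test_point :: "nat \<Rightarrow> real" where
  "test_point i = (node (Suc i) + node i) / 2"

lemma test_bump: "bump (node (Suc i)) (node i) x \<noteq> 0 \<Longrightarrow> 1 < x \<and> x < \<phi> 1"
  using node_bounds(1)[of "Suc i"] node_bounds(2)[of i] by (auto simp: bump_nonzero_iff)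

lemma test_point_bounds: "node (Suc i) < test_point i" "test_point i < node i" "1 < test_point i" "test_point i < \<phi> 1"
  using node_bounds(3)[of i] node_bounds(1)[of "Suc i"] node_bounds(2)[of i] by (auto simp: test_point_def)

lemma test_tuple_Sol: "test_tuple i \<in> Sol"
  unfolding mem_Sol_iff
proof (intro conjI allI impI)
  show "test_tuple i \<in> tuple_space p" unfolding test_tuple_def by (rule tuple_spaceI) simp
  show "smooth_tuple p (test_tuple i)"
    unfolding smooth_tuple_def
  proof (intro conjI allI impI)
    fix j assume j: "j < p"
    have "smooth_on {0<..} (\<lambda>x. if j = p - 1 then spread (bump (node (Suc i)) (node i)) x else 0)"
      using spread_smooth[OF test_bump bump_smooth] by (cases "j = p - 1") (auto intro: smooth_on_const)
    then show "smooth_on {0<..} (fst (test_tuple i) j)"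
      by (rule smooth_on_cong) (use j in \<open>simp add: test_tuple_def\<close>)
  next
    show "smooth_on {0<..} (snd (test_tuple i))"
      by (rule smooth_on_cong[OF smooth_on_const[of _ 0]]) (simp add: test_tuple_def)
  qed
  fix x :: real assume x: "x > 0"
  show "snd (test_tuple i) (\<phi> x) = \<mu> * snd (test_tuple i) x"
    using x by (simp add: test_tuple_def phi_pos)
  fix j assume j: "j < p"
  show "fst (test_tuple i) j (\<phi> x) = \<mu> ^ (p - j) * fst (test_tuple i) j x + c j * snd (test_tuple i) x ^ (p - j)"
    using x j p spread_equation[where b = "bump (node (Suc i)) (node i)", OF test_bump x] by (auto simp: test_tuple_def phi_pos power_0_left)
qed

lemma test_evaluation: "fst (test_tuple i) (p - 1) (test_point k) \<noteq> 0 \<longleftrightarrow> i = k"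
proof -
  have "fst (test_tuple i) (p - 1) (test_point k) = bump (node (Suc i)) (node i) (test_point k)"
    using spread_eq[where b = "bump (node (Suc i)) (node i)" and y = "test_point k", OF test_bump]
      test_point_bounds(3,4)[of k] p by (simp add: test_tuple_def)
  moreover have "node (Suc i) < test_point k \<and> test_point k < node i \<longleftrightarrow> i = k"
  proof
    assume a: "node (Suc i) < test_point k \<and> test_point k < node i"
    show "i = k"
    proof (rule ccontr)
      assume "i \<noteq> k"
      then consider "Suc i \<le> k" | "Suc k \<le> i" by linarith
      then show False
        using a test_point_bounds(1,2)[of k] node_bounds(4)[of "Suc i" k] node_bounds(4)[of "Suc k" i] by cases auto
    qed
  qed (use test_point_bounds in simp)
  ultimately show ?thesis by (simp add: bump_nonzero_iff)
qed

lemma not_fin_dim_sol_space: "\<not> vectorspace.fin_dim complex_field sol_space"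
proof
  interpret V: vectorspace complex_field sol_space by (rule vectorspace_sol_space)
  assume fd: "V.fin_dim"
  define ev where "ev x \<beta> = fst \<beta> (p - 1) x" for x and \<beta> :: tuple
  note str = solution_vs_structure_sol_space[unfolded solution_vs_structure_def]
  have add: "ev x (\<beta> \<oplus>\<^bsub>sol_space\<^esub> \<gamma>) = ev x \<beta> + ev x \<gamma>"
    if "\<beta> \<in> carrier sol_space" "\<gamma> \<in> carrier sol_space" "x > 0" for x \<beta> \<gamma>
    using str that unfolding ev_def by blast
  have scale: "ev x (a \<odot>\<^bsub>sol_space\<^esub> \<beta>) = a * ev x \<beta>" if "\<beta> \<in> carrier sol_space" "x > 0" for x a \<beta>
    using str that unfolding ev_def by blast
  have zero: "ev x \<zero>\<^bsub>sol_space\<^esub> = 0" if "x > 0" for x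
    using that p by (simp add: sol_space_def ev_def)
  have carr: "a \<in> B \<rightarrow> carrier complex_field" for a :: "tuple \<Rightarrow> complex" and B
    by (simp add: complex_field_def)
  have lincomb: "ev x (V.module.lincomb a B) = (\<Sum>v\<in>B. a v * ev x v)"
    if "finite B" "B \<subseteq> carrier sol_space" "x > 0" for x a B
    using that
  proof (induction B rule: finite_induct)
    case (insert v B)
    have cl: "a v \<odot>\<^bsub>sol_space\<^esub> v \<in> carrier sol_space" "V.module.lincomb a B \<in> carrier sol_space"
      using insert.prems carr by (auto intro!: V.smult_closed V.lincomb_closed simp: complex_field_def)
    have "V.module.lincomb a (insert v B) = a v \<odot>\<^bsub>sol_space\<^esub> v \<oplus>\<^bsub>sol_space\<^esub> V.module.lincomb a B"
      unfolding V.lincomb_def using insert carr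
      by (intro V.finsum_insert) (auto intro!: V.smult_closed simp: complex_field_def)
    then show ?case using insert cl by (simp add: add scale)
  qed (simp add: V.lincomb_def zero)
  define A where "A = range test_tuple"
  have AC: "A \<subseteq> carrier sol_space" using test_tuple_Sol by (auto simp: A_def sol_space_def)
  have inj: "inj test_tuple"
    using test_evaluation by (intro injI) metis
  have "\<not> V.module.lin_dep A"
  proof
    assume "V.module.lin_dep A"
    then obtain B a v where B: "finite B" "B \<subseteq> A" "V.module.lincomb a B = \<zero>\<^bsub>sol_space\<^esub>" "v \<in> B" "a v \<noteq> \<zero>\<^bsub>complex_field\<^esub>"
      unfolding V.lin_dep_def by blast
    obtain i where i: "v = test_tuple i" using B by (auto simp: A_def)
    have pos: "test_point i > 0" using test_point_bounds(3)[of i] by simp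
    have "0 = (\<Sum>v\<in>B. a v * ev (test_point i) v)"
      using lincomb[OF B(1) _ pos, of a] B(2,3) AC zero[OF pos] by auto
    also have "\<dots> = (\<Sum>w\<in>{v}. a w * ev (test_point i) w)"
    proof (rule sum.mono_neutral_right)
      show "\<forall>w\<in>B - {v}. a w * ev (test_point i) w = 0"
      proof
        fix w assume w: "w \<in> B - {v}"
        then obtain k where "w = test_tuple k" using B(2) by (auto simp: A_def)
        then show "a w * ev (test_point i) w = 0"
          using w i test_evaluation[of k i] by (auto simp: ev_def)
      qed
    qed (use B in auto)
    finally show False using B(5) test_evaluation[of i i] by (simp add: i ev_def complex_field_def)
  qed
  then have "finite A" by (rule V.fin_dim_li_fin[OF fd _ AC])
  then show False using inj by (simp add: A_def range_inj_infinite)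
qed

end

section \<open>The extension\<close>

theorem theorem3p13:
  fixes \<mu> :: complex and p :: nat and \<phi> :: "real \<Rightarrow> real" and c :: "nat \<Rightarrow> complex"
  assumes "norm \<mu> > 1" and "p \<ge> 2"
    and "\<phi> \<in> carrier Diff_half"
    and "\<And>x. x > 0 \<Longrightarrow> \<phi> x > x"
    and "tangent_to_id_infinite_order \<phi>"
    and "\<And>j. j < p \<Longrightarrow> c j = of_nat (p choose j) * (1 / \<mu> ^ j)"
  shows "group (solution_group \<phi> \<mu> p c)
    \<and> group (Aut_rel (reeb_T \<mu> p \<phi>))
    \<and> group (Diff_centralizer \<phi>)
    \<and> tuple_aut (reeb_T \<mu> p \<phi>) p \<in> mon (solution_group \<phi> \<mu> p c) (Aut_rel (reeb_T \<mu> p \<phi>))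
    \<and> transverse (reeb_T \<mu> p \<phi>) \<in> epi (Aut_rel (reeb_T \<mu> p \<phi>)) (Diff_centralizer \<phi>)
    \<and> kernel (Aut_rel (reeb_T \<mu> p \<phi>)) (Diff_centralizer \<phi>) (transverse (reeb_T \<mu> p \<phi>))
        = tuple_aut (reeb_T \<mu> p \<phi>) p ` carrier (solution_group \<phi> \<mu> p c)
    \<and> (\<exists>V. solution_vs_structure \<phi> \<mu> p c V \<and> \<not> vectorspace.fin_dim complex_field V)"
proof -
  interpret reeb_solutions \<phi> \<mu> p c
    by unfold_locales (use assms in auto)
  show ?thesis
    using group_solution_group group_Aut_rel group_Diff_centralizer tuple_aut_mon transverse_epi
      kernel_transverse_eq solution_vs_structure_sol_space not_fin_dim_sol_space by blast
qed

end
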